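(* Let $\alpha,\beta>0$ with $\alpha\ne\beta$, let $\mu=[a,R,M]\in ID$, and write $\mathcal{J}^{\alpha}(\mathcal{J}^{\beta}(\mu))=[a^{(\alpha,\beta)},R^{(\alpha,\beta)},M^{(\alpha,\beta)}]$. Then: (i) $$a^{(\alpha,\beta)}=\frac{\alpha\beta}{(1+\alpha)(1+\beta)}\,a+\frac{\alpha\beta}{\beta-\alpha}\Bigl[\frac{1}{\alpha+1}\int_{\{\|x\|>1\}}x\,\|x\|^{-1-\alpha}M(dx)-\frac{1}{\beta+1}\int_{\{\|x\|>1\}}x\,\|x\|^{-1-\beta}M(dx)\Bigr]$$ $$=\frac{\beta}{\beta-\alpha}\,a^{(\alpha)}-\frac{\alpha}{\beta-\alpha}\,a^{(\beta)};$$ (ii) $$R^{(\alpha,\beta)}=\frac{\alpha}{2+\alpha}\cdot\frac{\beta}{2+\beta}\,R=\frac{\beta}{\beta-\alpha}\,R^{(\alpha)}-\frac{\alpha}{\beta-\alpha}\,R^{(\beta)};$$ (iii) for all Borel sets $A\subset\mathbb{R}^d\setminus\{0\}$, $$M^{(\alpha,\beta)}(A)=\int_0^1\int_0^1 T_{t^{1/\alpha}s^{1/\beta}}M(A)\,ds\,dt=\frac{\beta}{\beta-\alpha}\,M^{(\alpha)}(A)-\frac{\alpha}{\beta-\alpha}\,M^{(\beta)}(A).$$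
   Context: $ID$ is the set of all infinitely divisible Borel probability measures on $\mathbb{R}^d$. For $\mu\in ID$ we write $\mu=[a,R,M]$ for the (unique) triplet in the Lévy–Khintchine formula $\hat\mu(y)=e^{\Phi(y)}$, $$\Phi(y)=i\langle y,a\rangle-\tfrac12\langle y,Ry\rangle+\int_{\mathbb{R}^d\setminus\{0\}}\bigl[e^{i\langle y,x\rangle}-1-i\langle y,x\rangle 1_B(x)\bigr]M(dx),$$ where $B=\{x:\|x\|\le1\}$, $a\in\mathbb{R}^d$ is the shift vector, $R$ is the Gaussian covariance operator, and $M$ is the Lévy spectral measure, i.e. a Borel measure on $\mathbb{R}^d\setminus\{0\}$ with $\int\min(1,\|x\|^2)M(dx)<\infty$. For $c>0$, $T_cM(A):=\int 1_A(cx)\,M(dx)$ is the image of $M$ under $x\mapsto cx$. $\mathcal{L}(X)$ denotes the probability distribution of a random vector $X$. For $\nu\in ID$, $(Y_\nu(t))_{t\ge 0}$ denotes an $\mathbb{R}^d$-valued Lévy process (started at zero, stationary independent increments, right continuous paths with finite left limits) with $\mathcal{L}(Y_\nu(1))=\nu$. Random integrals are defined pathwise by formal integration by parts: for a continuous function $h$ of bounded variation on $[0,1]$ and a continuous nondecreasing $r:[0,1]\to[0,\infty)$, $$\int_0^1 h(t)\,dY(r(t)):=h(1)Y(r(1))-h(0)Y(r(0))-\int_{(0,1]}Y(r(t)-)\,dh(t).$$ For $\gamma>0$ the mapping $\mathcal{J}^\gamma: ID\to ID$ is defined by $$\mathcal{J}^\gamma(\nu):=\mathcal{L}\Bigl(\int_0^1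 t^{1/\gamma}\,dY_\nu(t)\Bigr)=\mathcal{L}\Bigl(\int_0^1 t\,dY_\nu(t^\gamma)\Bigr).$$ For $\mu=[a,R,M]$ and $\gamma>0$, $[a^{(\gamma)},R^{(\gamma)},M^{(\gamma)}]$ denotes the triplet of $\mathcal{J}^\gamma(\mu)$; explicitly $$a^{(\gamma)}=\frac{\gamma}{\gamma+1}\Bigl(a+\int_{\{\|x\|>1\}}x\,\|x\|^{-1-\gamma}M(dx)\Bigr),\quad R^{(\gamma)}=\frac{\gamma}{2+\gamma}R,\quad M^{(\gamma)}(A)=\int_0^1 T_{t^{1/\gamma}}M(A)\,dt$$ for Borel sets $A\subset\mathbb{R}^d\setminus\{0\}$.
   Formalization: In (iii) the last equality is stated as a difference only when M^(α)(A) or M^(β)(A) is finite (otherwise it reads ∞−∞); for every Borel A it is stated free of subtraction, e.g. (β−α)M^(α,β)(A)+αM^(β)(A)=βM^(α)(A) if α<β. *)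

theory Defs
  imports "HOL-Probability.Probability"
begin

section \<open>Infinitely divisible laws and their Levy--Khintchine triplets\<close>

text \<open>
  The type variable \<open>'a::euclidean_space\<close> plays the role of d-dimensional Euclidean space.
  The library convolution lives on ordered Euclidean spaces only, so the n-fold convolution power
  is the law of the sum of n independent copies.
\<close>

definition infinitely_divisible :: "'a::euclidean_space measure set" where
  "infinitely_divisible = {\<mu>. prob_space \<mu> \<and> sets \<mu> = sets borel \<and>
     (\<forall>n::nat. n \<ge> 1 \<longrightarrow> (\<exists>\<nu> :: 'a measure. prob_space \<nu> \<and> sets \<nu> = sets borel \<and>
        \<mu> = distr (Pi\<^sub>M {..<n} (\<lambda>_. \<nu>)) borel (\<lambda>x. \<Sum>i<n. x i)))}"

definition char_fun :: "'a::euclidean_space measure \<Rightarrow> 'a \<Rightarrow> complex" where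
  "char_fun \<mu> y = (CLINT x|\<mu>. iexp (y \<bullet> x))"

text \<open>A Borel measure on the punctured space is encoded as a Borel measure on the whole space
  that does not charge the origin.\<close>

definition levy_spectral_measure :: "'a::euclidean_space measure \<Rightarrow> bool" where
  "levy_spectral_measure M \<longleftrightarrow> sets M = sets borel \<and> emeasure M {0} = 0 \<and>
     (\<integral>\<^sup>+x. ennreal (min 1 ((norm x)\<^sup>2)) \<partial>M) < \<infinity>"

definition gaussian_covariance :: "('a::euclidean_space \<Rightarrow>\<^sub>L 'a) \<Rightarrow> bool" where
  "gaussian_covariance R \<longleftrightarrow>
     (\<forall>x y. blinfun_apply R x \<bullet> y = x \<bullet> blinfun_apply R y) \<and> (\<forall>x. 0 \<le> x \<bullet> blinfun_apply R x)"

definition levy_exponent ::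
    "'a::euclidean_space \<Rightarrow> ('a \<Rightarrow>\<^sub>L 'a) \<Rightarrow> 'a measure \<Rightarrow> 'a \<Rightarrow> complex" where
  "levy_exponent a R M y =
     \<i> * complex_of_real (y \<bullet> a) - complex_of_real (y \<bullet> blinfun_apply R y) / 2 +
     (CLINT x|M. iexp (y \<bullet> x) - 1 - \<i> * complex_of_real (y \<bullet> x) * indicator (cball 0 1) x)"

definition has_levy_triplet ::
    "'a::euclidean_space measure \<Rightarrow> 'a \<Rightarrow> ('a \<Rightarrow>\<^sub>L 'a) \<Rightarrow> 'a measure \<Rightarrow> bool" where
  "has_levy_triplet \<mu> a R M \<longleftrightarrow>
     \<mu> \<in> infinitely_divisible \<and> gaussian_covariance R \<and> levy_spectral_measure M \<and>
     (\<forall>y. char_fun \<mu> y = exp (levy_exponent a R M y))"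

definition levy_triplet ::
    "'a::euclidean_space measure \<Rightarrow> 'a \<times> ('a \<Rightarrow>\<^sub>L 'a) \<times> 'a measure" where
  "levy_triplet \<mu> = (THE (a, R, M). has_levy_triplet \<mu> a R M)"

definition dilate :: "real \<Rightarrow> 'a::euclidean_space measure \<Rightarrow> 'a measure" where
  "dilate c M = distr M borel (\<lambda>x. c *\<^sub>R x)"

section \<open>Levy processes\<close>

text \<open>The time index is \<open>real\<close>; only the values at nonnegative times matter.\<close>

definition levy_process ::
    "'w measure \<Rightarrow> (real \<Rightarrow> 'w \<Rightarrow> 'a::euclidean_space) \<Rightarrow> bool" where
  "levy_process P Y \<longleftrightarrow>
     prob_space P \<and>
     (\<forall>t\<ge>0. Y t \<in> borel_measurable P) \<and>
     (\<forall>\<omega>\<in>space P. Y 0 \<omega> = 0) \<and>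
     (\<forall>(n::nat) (\<tau>::nat \<Rightarrow> real). 0 \<le> \<tau> 0 \<and> (\<forall>i<n. \<tau> i \<le> \<tau> (Suc i)) \<longrightarrow>
        prob_space.indep_vars P (\<lambda>_. borel) (\<lambda>i \<omega>. Y (\<tau> (Suc i)) \<omega> - Y (\<tau> i) \<omega>) {..<n}) \<and>
     (\<forall>s\<ge>0. \<forall>t\<ge>0. distr P borel (\<lambda>\<omega>. Y (s + t) \<omega> - Y s \<omega>) = distr P borel (Y t)) \<and>
     (\<forall>\<omega>\<in>space P. \<forall>t\<ge>0. ((\<lambda>s. Y s \<omega>) \<longlongrightarrow> Y t \<omega>) (at_right t)) \<and>
     (\<forall>\<omega>\<in>space P. \<forall>t>0. \<exists>l. ((\<lambda>s. Y s \<omega>) \<longlongrightarrow> l) (at_left t))"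

text \<open>A choice, for every infinitely divisible law \<open>\<nu>\<close>, of a Levy process \<open>Y \<nu>\<close> on a probability
  space \<open>P \<nu>\<close> whose value at time 1 has law \<open>\<nu>\<close>.\<close>

definition levy_process_family ::
    "('a::euclidean_space measure \<Rightarrow> 'w measure) \<Rightarrow> ('a measure \<Rightarrow> real \<Rightarrow> 'w \<Rightarrow> 'a) \<Rightarrow> bool" where
  "levy_process_family P Y \<longleftrightarrow>
     (\<forall>\<nu>\<in>infinitely_divisible. levy_process (P \<nu>) (Y \<nu>) \<and> distr (P \<nu>) borel (Y \<nu> 1) = \<nu>)"

section \<open>Pathwise random integrals\<close>

definition variation_upto :: "(real \<Rightarrow> real) \<Rightarrow> real \<Rightarrow> real" where
  "variation_upto h s =
     Sup {\<Sum>i<n. \<bar>h (\<tau> (Suc i)) - h (\<tau> i)\<bar> | (n::nat) (\<tau>::nat \<Rightarrow> real). mono \<tau> \<and> range \<tau> \<subseteq> {0..s}}"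

text \<open>
  Lebesgue--Stieltjes integral over \<open>{0<..1}\<close> against a continuous \<open>h\<close> of bounded variation on
  \<open>{0..1}\<close>, through the Jordan decomposition of \<open>h\<close> into \<open>(V + h)/2\<close> and \<open>(V - h)/2\<close>, where \<open>V\<close> is
  the variation function. Both parts are continued by constants outside \<open>{0..1}\<close> because
  \<^const>\<open>interval_measure\<close> expects functions that are monotone on the whole line.
\<close>

definition stieltjes_integral ::
    "(real \<Rightarrow> 'a::euclidean_space) \<Rightarrow> (real \<Rightarrow> real) \<Rightarrow> 'a" where
  "stieltjes_integral f h =
     (let c = (\<lambda>t. max 0 (min 1 t)) in
      (LINT t:{0<..1}|interval_measure (\<lambda>t. (variation_upto h (c t) + h (c t)) / 2). f t) -
      (LINT t:{0<..1}|interval_measure (\<lambda>t. (variation_upto h (c t) - h (c t)) / 2). f t))"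

definition left_limit :: "(real \<Rightarrow> 'a::euclidean_space) \<Rightarrow> real \<Rightarrow> 'a" where
  "left_limit f s = (if s \<le> 0 then f 0 else Lim (at_left s) f)"

text \<open>The integral of \<open>h\<close> over \<open>{0..1}\<close> against \<open>Y (r t)\<close>, by formal integration by parts.\<close>

definition random_integral ::
    "(real \<Rightarrow> real) \<Rightarrow> (real \<Rightarrow> 'w \<Rightarrow> 'a::euclidean_space) \<Rightarrow> (real \<Rightarrow> real) \<Rightarrow> 'w \<Rightarrow> 'a" where
  "random_integral h Y r \<omega> =
     h 1 *\<^sub>R Y (r 1) \<omega> - h 0 *\<^sub>R Y (r 0) \<omega> -
     stieltjes_integral (\<lambda>t. left_limit (\<lambda>s. Y s \<omega>) (r t)) h"

definition J_map ::
    "('a::euclidean_space measure \<Rightarrow> 'w measure) \<Rightarrow> ('a measure \<Rightarrow> real \<Rightarrow> 'w \<Rightarrow> 'a) \<Rightarrow>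
     real \<Rightarrow> 'a measure \<Rightarrow> 'a measure" where
  "J_map P Y \<gamma> \<nu> = distr (P \<nu>) borel (random_integral (\<lambda>t. t powr (1 / \<gamma>)) (Y \<nu>) (\<lambda>t. t))"

end

theory Submission
  imports Defs
begin

text \<open>
  By summation by parts the pathwise integral is the limit of the sums of
  \<open>t\<^sub>k powr (1 / \<gamma>) *\<^sub>R (Y t\<^sub>k - Y t\<^sub>k\<^sub>-\<^sub>1)\<close>, so its characteristic exponent is the average of
  \<open>\<Phi> (c y)\<close> over the law of \<open>c = t powr (1 / \<gamma>)\<close>, \<open>t\<close> uniform on \<open>{0<..1}\<close>. By Fubini this average is
  the exponent of a triplet whose Levy measure is the mixture of the dilations of \<open>M\<close> by \<open>c\<close>, and
  since the exponent determines the triplet, this is the triplet of \<open>J_map\<close>. Two successive maps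
  mix over the product of two independent power laws, and for \<open>\<alpha> \<noteq> \<beta>\<close> the law of that product is the
  affine combination of the two power laws with weights \<open>\<beta> / (\<beta> - \<alpha>)\<close> and \<open>- \<alpha> / (\<beta> - \<alpha>)\<close>.
\<close>

section \<open>Characteristic functions determine finite measures\<close>

text \<open>The weights come from partial fractions. The scale \<open>t powr (1 / \<gamma>)\<close>
  has moment \<gamma> / (\<gamma> + p) of order p, so a product of two independent scales has moment
  \<alpha> \<beta> / ((\<alpha> + p) (\<beta> + p)), which is \<beta> / (\<beta> - \<alpha>) times
  \<alpha> / (\<alpha> + p) minus \<alpha> / (\<beta> - \<alpha>) times \<beta> / (\<beta> + p).
  Order 1 governs the coefficient of the shift and order 2 the Gaussian part; the relation between
  the laws themselves is read off their distribution functions. Two obstacles shape the rest. The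
  triplet is a definite description, so uniqueness must be proved before anything can be said about
  it; this rests on characteristic functions determining finite measures in every dimension, which
  is reached from the line by cutting out one coordinate slab at a time under the Fourier integral.
  Moreover Levy measures may be infinite near the origin while one of the weights is negative, so
  (iii) is carried in additive form with nonnegative coefficients, and subtraction enters only where
  one of the two masses is finite.\<close>

lemma real_finite_measure_eq_if_char_eq:
  fixes M N :: "real measure"
  assumes "finite_measure M" "finite_measure N" and sM[measurable_cong]: "sets M = sets borel"
    and sN[measurable_cong]: "sets N = sets borel"
    and eq: "\<And>t. (CLINT x|M. iexp (t * x)) = (CLINT x|N. iexp (t * x))"
  shows "M = N"
proof -
  interpret M: finite_measure M by fact
  interpret N: finite_measure N by fact
  have spM: "space M = UNIV" and spN: "space N = UNIV"
    using sets_eq_imp_space_eq[OF sM] sets_eq_imp_space_eq[OF sN] by auto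
  define c where "c = measure M UNIV"
  \<comment> \<open>At frequency 0 the transform is the total mass, so one normalising factor serves
    both measures; mass 0 is split off below because it cannot be normalised.\<close>
  have cN: "measure N UNIV = c"
  proof -
    have "complex_of_real (measure M UNIV) = complex_of_real (measure N UNIV)"
      using eq[of 0] by (simp add: spM spN scaleR_conv_of_real)
    thus ?thesis by (simp add: c_def)
  qed
  show ?thesis
  proof (cases "c = 0")
    case True
    have "emeasure M UNIV = 0" "emeasure N UNIV = 0"
      using True cN c_def by (simp_all add: M.emeasure_eq_measure N.emeasure_eq_measure)
    hence "emeasure M A = 0" "emeasure N A = 0" for A
      using emeasure_eq_0[of UNIV M A] emeasure_eq_0[of UNIV N A] sM sN by auto
    thus ?thesis by (intro measure_eqI) (auto simp: sM sN)
  next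
    case False
    hence c: "c > 0" by (simp add: c_def zero_less_measure_iff)
    let ?n = "\<lambda>M::real measure. density M (\<lambda>_. ennreal (1 / c))"
    have rd: "real_distribution (?n L)"
      if L: "sets L = sets borel" "finite_measure L" "measure L UNIV = c" for L :: "real measure"
    proof -
      have sp: "space L = UNIV" using sets_eq_imp_space_eq[OF L(1)] by simp
      interpret L: finite_measure L by fact
      have "emeasure (?n L) (space (?n L)) = ennreal (1/c) * emeasure L UNIV"
        using L sp by (simp add: emeasure_density nn_integral_cmult)
      also have "\<dots> = 1"
        using c L(3) by (simp add: L.emeasure_eq_measure flip: ennreal_mult)
      finally have "prob_space (?n L)" by (rule prob_spaceI)
      thus ?thesis using L sp by (simp add: real_distribution_def real_distribution_axioms_def)
    qed
    have ch: "char (?n L) t = (CLINT x|L. iexp (t * x)) / c"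
      if L[measurable_cong]: "sets L = sets borel" for L :: "real measure" and t
      unfolding char_def using c by (subst integral_density) (auto simp: scaleR_conv_of_real)
    have "?n M = ?n N"
      by (rule Levy_uniqueness) (use assms c_def cN rd ch eq in auto)
    show ?thesis
    proof (rule measure_eqI)
      fix A assume "A \<in> sets M"
      hence A[measurable]: "A \<in> sets borel" by (simp add: sM)
      have "emeasure (?n M) A = emeasure (?n N) A" using \<open>?n M = ?n N\<close> by simp
      hence "ennreal (1/c) * emeasure M A = ennreal (1/c) * emeasure N A"
        by (simp add: emeasure_density nn_integral_cmult)
      thus "emeasure M A = emeasure N A"
        using c by (simp add: ennreal_mult_cancel_left)
    qed (simp add: sM sN)
  qed
qed

lemma integrable_bounded_finite_measure:
  fixes f :: "'a \<Rightarrow> 'b::{banach, second_countable_topology}"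
  assumes "finite_measure M" "f \<in> borel_measurable M" "\<And>x. norm (f x) \<le> B"
  shows "integrable M f"
  by (rule finite_measure.integrable_const_bound[OF assms(1) AE_I2 assms(2)]) (rule assms(3))

lemma of_real_cos_iexp: "complex_of_real (cos u) = (iexp u + iexp (-u)) / 2"
  and of_real_sin_iexp: "complex_of_real (sin u) = (iexp u - iexp (-u)) / (2 * \<i>)"
  unfolding cos_of_real[symmetric] sin_of_real[symmetric] cos_exp_eq sin_exp_eq by simp_all

lemma iexp_add_diff:
  "iexp ((z + y) \<bullet> x) = iexp (z \<bullet> x) * iexp (y \<bullet> x)"
  "iexp ((z - y) \<bullet> x) = iexp (z \<bullet> x) * iexp (- (y \<bullet> x))"
  by (simp_all only: inner_add_left inner_diff_left diff_conv_add_uminus of_real_add inner_minus_left distrib_left exp_add)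

text \<open>The common weight is what makes an induction over coordinates possible: confining the
  mass to a slab only changes \<open>g\<close> and leaves every frequency available for the next
  coordinate.\<close>

definition fourier_eq :: "'a::euclidean_space measure \<Rightarrow> 'a measure \<Rightarrow> ('a \<Rightarrow> real) \<Rightarrow> bool" where
  "fourier_eq M N g \<longleftrightarrow> (\<forall>y. (CLINT x|M. g x * iexp (y \<bullet> x)) = (CLINT x|N. g x * iexp (y \<bullet> x)))"

text \<open>Multiplying by a cosine or sine combines the frequencies \<open>z + y\<close> and
  \<open>z - y\<close>, where the transforms already agree. The summand 1 keeps a nonnegative weight
  nonnegative, so that it can serve as a density.\<close>

lemma fourier_eq_trig:
  fixes M N :: "'a::euclidean_space measure" and g :: "'a \<Rightarrow> real"
  assumes fin: "finite_measure M" "finite_measure N" and sM[measurable_cong]: "sets M = sets borel"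
    and sN[measurable_cong]: "sets N = sets borel"
    and g[measurable]: "g \<in> borel_measurable borel" and gb: "\<And>x. \<bar>g x\<bar> \<le> 1"
    and eq: "fourier_eq M N g"
  shows "fourier_eq M N (\<lambda>x. g x * (1 + cos (y \<bullet> x)))" "fourier_eq M N (\<lambda>x. g x * (1 + sin (y \<bullet> x)))"
proof -
  have i: "integrable L (\<lambda>x. complex_of_real (g x) * iexp (z \<bullet> x))"
    if "finite_measure L" "sets L = sets borel" for L z
    using that gb by (intro integrable_bounded_finite_measure[where B=1]) (auto simp: norm_mult)
  have e: "(CLINT x|M. g x * iexp (z \<bullet> x)) = (CLINT x|N. g x * iexp (z \<bullet> x))" for z
    using eq by (simp add: fourier_eq_def)
  show "fourier_eq M N (\<lambda>x. g x * (1 + cos (y \<bullet> x)))"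
    unfolding fourier_eq_def
  proof
    fix z
    have *: "complex_of_real (g x * (1 + cos (y \<bullet> x))) * iexp (z \<bullet> x) =
       g x * iexp (z \<bullet> x) + (1/2) * (g x * iexp ((z + y) \<bullet> x)) + (1/2) * (g x * iexp ((z - y) \<bullet> x))" for x
      unfolding of_real_mult of_real_add of_real_1 of_real_cos_iexp iexp_add_diff by (simp add: field_simps)
    show "(CLINT x|M. (g x * (1 + cos (y \<bullet> x))) * iexp (z \<bullet> x)) = (CLINT x|N. (g x * (1 + cos (y \<bullet> x))) * iexp (z \<bullet> x))"
      unfolding * using i[OF fin(1) sM] i[OF fin(2) sN] by (simp add: e)
  qed
  show "fourier_eq M N (\<lambda>x. g x * (1 + sin (y \<bullet> x)))"
    unfolding fourier_eq_def
  proof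
    fix z
    have *: "complex_of_real (g x * (1 + sin (y \<bullet> x))) * iexp (z \<bullet> x) =
       g x * iexp (z \<bullet> x) + (1/(2*\<i>)) * (g x * iexp ((z + y) \<bullet> x)) - (1/(2*\<i>)) * (g x * iexp ((z - y) \<bullet> x))" for x
      unfolding of_real_mult of_real_add of_real_1 of_real_sin_iexp iexp_add_diff by (simp add: field_simps)
    show "(CLINT x|M. (g x * (1 + sin (y \<bullet> x))) * iexp (z \<bullet> x)) = (CLINT x|N. (g x * (1 + sin (y \<bullet> x))) * iexp (z \<bullet> x))"
      unfolding * using i[OF fin(1) sM] i[OF fin(2) sN] by (simp add: e)
  qed
qed

text \<open>The image of the \<open>g\<close>-weighted measure under \<open>x \<bullet> e\<close>
  lives on the line, and its characteristic function at \<open>t\<close> is the weighted transform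
  at \<open>t *\<^sub>R e\<close>; the one-dimensional theorem identifies the two images. The bound
  \<open>B\<close> keeps them finite and is a parameter because the trigonometric weights reach
  2.\<close>

lemma fourier_eq_imp_integral_slab_eq:
  fixes M N :: "'a::euclidean_space measure" and g :: "'a \<Rightarrow> real"
  assumes fin: "finite_measure M" "finite_measure N" and sM[measurable_cong]: "sets M = sets borel"
    and sN[measurable_cong]: "sets N = sets borel"
    and g[measurable]: "g \<in> borel_measurable borel" and gb: "\<And>x. 0 \<le> g x" "\<And>x. g x \<le> B"
    and eq: "fourier_eq M N g" and A[measurable]: "A \<in> sets borel"
  shows "(\<integral>x. g x * indicator A (x \<bullet> e) \<partial>M) = (\<integral>x. g x * indicator A (x \<bullet> e) \<partial>N)"
proof -
  define D where "D L = distr (density L (\<lambda>x. ennreal (g x))) borel (\<lambda>x. x \<bullet> e)" for L :: "'a measure"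
  have finD: "finite_measure (D L)" if L[measurable_cong]: "sets L = sets borel" and "finite_measure L" for L
  proof (rule finite_measureI)
    interpret L: finite_measure L by fact
    have "emeasure (D L) (space (D L)) = (\<integral>\<^sup>+x. ennreal (g x) \<partial>L)"
      unfolding D_def by (simp add: emeasure_distr emeasure_density)
    also have "\<dots> \<le> (\<integral>\<^sup>+x. ennreal B \<partial>L)" by (intro nn_integral_mono ennreal_leI gb)
    also have "\<dots> < \<infinity>" by (simp add: ennreal_mult_less_top L.emeasure_eq_measure)
    finally show "emeasure (D L) (space (D L)) \<noteq> \<infinity>" by simp
  qed
  have intD: "(CLINT u|D L. iexp (t * u)) = (CLINT x|L. g x * iexp ((t *\<^sub>R e) \<bullet> x))"
    if L[measurable_cong]: "sets L = sets borel" for L t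
    unfolding D_def by (subst integral_distr, simp, simp, subst integral_density)
      (auto simp: gb scaleR_conv_of_real inner_commute)
  have "D M = D N"
  proof (rule real_finite_measure_eq_if_char_eq[OF finD[OF sM fin(1)] finD[OF sN fin(2)]])
    show "sets (D M) = sets borel" "sets (D N) = sets borel" by (simp_all add: D_def)
    show "(CLINT u|D M. iexp (t * u)) = (CLINT u|D N. iexp (t * u))" for t
      using eq unfolding intD[OF sM] intD[OF sN] fourier_eq_def by blast
  qed
  have intA: "(\<integral>u. indicat_real A u \<partial>D L) = (\<integral>x. g x * indicat_real A (x \<bullet> e) \<partial>L)"
    if L[measurable_cong]: "sets L = sets borel" for L
  proof -
    have "(\<integral>u. indicat_real A u \<partial>D L) = (\<integral>x. indicat_real A (x \<bullet> e) \<partial>density L (\<lambda>x. ennreal (g x)))"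
      unfolding D_def by (rule integral_distr) measurable
    also have "\<dots> = (\<integral>x. g x *\<^sub>R indicat_real A (x \<bullet> e) \<partial>L)"
      by (rule integral_density) (auto simp: gb)
    finally show ?thesis by simp
  qed
  show ?thesis
    unfolding intA[OF sM, symmetric] intA[OF sN, symmetric] \<open>D M = D N\<close> ..
qed

text \<open>Equality of slab integrals carries no frequency, so the frequency \<open>y\<close> is
  brought in through the weights \<open>g x * (1 + cos (y \<bullet> x))\<close> and
  \<open>g x * (1 + sin (y \<bullet> x))\<close>. The new weight again lies between 0 and 1, hence
  the step can be repeated.\<close>

lemma fourier_eq_slab:
  fixes M N :: "'a::euclidean_space measure" and g :: "'a \<Rightarrow> real"
  assumes fin: "finite_measure M" "finite_measure N" and sM[measurable_cong]: "sets M = sets borel"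
    and sN[measurable_cong]: "sets N = sets borel"
    and g[measurable]: "g \<in> borel_measurable borel" and gb: "\<And>x. 0 \<le> g x" "\<And>x. g x \<le> 1"
    and eq: "fourier_eq M N g" and A[measurable]: "A \<in> sets borel"
  shows "fourier_eq M N (\<lambda>x. g x * indicator A (x \<bullet> e))"
  unfolding fourier_eq_def
proof
  fix y
  let ?g = "\<lambda>x. g x * indicator A (x \<bullet> e)"
  have gabs: "\<bar>g x\<bar> \<le> 1" for x using gb[of x] by simp
  note tr = fourier_eq_trig[OF fin sM sN g gabs eq, of y]
  have c: "g x * (1 + cos u) \<le> 2" "g x * (1 + sin u) \<le> 2" "0 \<le> g x * (1 + cos u)" "0 \<le> g x * (1 + sin u)" for x u
  proof -
    have "1 + cos u \<le> 2" "1 + sin u \<le> 2" "0 \<le> 1 + cos u" "0 \<le> 1 + sin u"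
      using sin_ge_minus_one[of u] cos_ge_minus_one[of u] by (simp, simp, linarith+)
    thus "g x * (1 + cos u) \<le> 2" "g x * (1 + sin u) \<le> 2" "0 \<le> g x * (1 + cos u)" "0 \<le> g x * (1 + sin u)"
      using mult_mono[of "g x" 1 "1 + cos u" 2] mult_mono[of "g x" 1 "1 + sin u" 2] gb[of x] by auto
  qed
  have 0: "(\<integral>x. ?g x \<partial>M) = (\<integral>x. ?g x \<partial>N)"
    by (rule fourier_eq_imp_integral_slab_eq[OF fin sM sN g gb eq A])
  have 1: "(\<integral>x. g x * (1 + cos (y \<bullet> x)) * indicator A (x \<bullet> e) \<partial>M) = (\<integral>x. g x * (1 + cos (y \<bullet> x)) * indicator A (x \<bullet> e) \<partial>N)"
    by (rule fourier_eq_imp_integral_slab_eq[OF fin sM sN _ _ _ tr(1) A, where B=2]) (auto simp: c)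
  have 2: "(\<integral>x. g x * (1 + sin (y \<bullet> x)) * indicator A (x \<bullet> e) \<partial>M) = (\<integral>x. g x * (1 + sin (y \<bullet> x)) * indicator A (x \<bullet> e) \<partial>N)"
    by (rule fourier_eq_imp_integral_slab_eq[OF fin sM sN _ _ _ tr(2) A, where B=2]) (auto simp: c)
  \<comment> \<open>Subtracting the integral of \<open>?g\<close> removes the summand 1 from the
    shifted cosine and sine, which leaves the real and imaginary parts of the transform.\<close>
  have split: "(CLINT x|L. ?g x * iexp (y \<bullet> x)) =
      complex_of_real ((\<integral>x. g x * (1 + cos (y \<bullet> x)) * indicator A (x \<bullet> e) \<partial>L) - (\<integral>x. ?g x \<partial>L))
     + \<i> * complex_of_real ((\<integral>x. g x * (1 + sin (y \<bullet> x)) * indicator A (x \<bullet> e) \<partial>L) - (\<integral>x. ?g x \<partial>L))"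
    if L: "finite_measure L" and [measurable_cong]: "sets L = sets borel" for L :: "'a measure"
  proof -
    have i: "integrable L ?g" "integrable L (\<lambda>x. ?g x * cos (y \<bullet> x))" "integrable L (\<lambda>x. ?g x * sin (y \<bullet> x))"
      using gabs by (auto intro!: integrable_bounded_finite_measure[OF L, where B=1] mult_le_one simp: abs_mult indicator_def)
    have "(\<integral>x. g x * (1 + cos (y \<bullet> x)) * indicator A (x \<bullet> e) \<partial>L) - (\<integral>x. ?g x \<partial>L) = (\<integral>x. ?g x * cos (y \<bullet> x) \<partial>L)"
      using i by (simp add: algebra_simps)
    moreover have "(\<integral>x. g x * (1 + sin (y \<bullet> x)) * indicator A (x \<bullet> e) \<partial>L) - (\<integral>x. ?g x \<partial>L) = (\<integral>x. ?g x * sin (y \<bullet> x) \<partial>L)"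
      using i by (simp add: algebra_simps)
    moreover have "(CLINT x|L. ?g x * iexp (y \<bullet> x)) = (CLINT x|L. complex_of_real (?g x * cos (y \<bullet> x)) + \<i> * complex_of_real (?g x * sin (y \<bullet> x)))"
      by (intro Bochner_Integration.integral_cong) (auto simp: cis_conv_exp[symmetric] cis.ctr complex_eq_iff)
    moreover have "\<dots> = complex_of_real (\<integral>x. ?g x * cos (y \<bullet> x) \<partial>L) + \<i> * complex_of_real (\<integral>x. ?g x * sin (y \<bullet> x) \<partial>L)"
      using i(2,3) by (subst Bochner_Integration.integral_add) (auto simp del: of_real_mult)
    ultimately show ?thesis by simp
  qed
  show "(CLINT x|M. ?g x * iexp (y \<bullet> x)) = (CLINT x|N. ?g x * iexp (y \<bullet> x))"
    unfolding split[OF fin(1) sM] split[OF fin(2) sN] 0 1 2 ..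
qed

text \<open>An open box is an intersection of coordinate slabs, so inserting one basis vector after
  another into the weight ends at the indicator of the box; frequency 0 then gives its measure.
  Boxes are stable under intersection and generate the Borel sets.\<close>

theorem finite_measure_eq_if_char_fun_eq:
  fixes M N :: "'a::euclidean_space measure"
  assumes fin: "finite_measure M" "finite_measure N" and sM[measurable_cong]: "sets M = sets borel"
    and sN[measurable_cong]: "sets N = sets borel"
    and eq: "\<And>y. char_fun M y = char_fun N y"
  shows "M = N"
proof (rule measure_eqI_generator_eq_countable)
  interpret M: finite_measure M by fact
  interpret N: finite_measure N by fact
  let ?E = "range (\<lambda> (a, b). box a b :: 'a set)"
  show "Int_stable ?E" by (auto simp: Int_stable_def box_Int_box)
  show "sets M = sigma_sets UNIV ?E" "sets N = sigma_sets UNIV ?E"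
    unfolding sM sN borel_eq_box by auto
  let ?A = "range (\<lambda>n::nat. box (- real n *\<^sub>R One) (real n *\<^sub>R One) :: 'a set)"
  show "?A \<subseteq> ?E" by force
  show "\<Union>?A = UNIV" using UN_box_eq_UNIV by auto
  show "countable ?A" by simp
  show "emeasure M a \<noteq> \<infinity>" for a by simp
  fix X assume "X \<in> ?E"
  then obtain a b where X: "X = box a b" by auto
  let ?g = "\<lambda>J x. \<Prod>i\<in>J. indicat_real {a \<bullet> i<..<b \<bullet> i} (x \<bullet> i)"
  have "fourier_eq M N (?g J)" if "finite J" for J :: "'a set"
    using that
  proof induction
    case empty
    show ?case using eq by (simp add: fourier_eq_def char_fun_def)
  next
    case (insert j J)
    have "fourier_eq M N (\<lambda>x. ?g J x * indicator {a \<bullet> j<..<b \<bullet> j} (x \<bullet> j))"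
      by (rule fourier_eq_slab[OF fin sM sN]) (auto intro!: prod_nonneg prod_le_1 insert.IH)
    thus ?case using insert.hyps by (simp add: mult.commute)
  qed
  from this[of Basis] have "(CLINT x|M. complex_of_real (?g Basis x)) = (CLINT x|N. complex_of_real (?g Basis x))"
    by (auto simp: fourier_eq_def dest: spec[of _ 0])
  moreover have "?g Basis x = indicator X x" for x
    by (auto simp: X box_def indicator_def prod.neutral intro!: prod_zero)
  ultimately have "measure M X = measure N X"
    by (simp add: sM sN X)
  thus "emeasure M X = emeasure N X"
    by (simp add: M.emeasure_eq_measure N.emeasure_eq_measure)
qed auto

section \<open>Levy exponents determine triplets\<close>

definition levy_kernel :: "'a::euclidean_space \<Rightarrow> 'a \<Rightarrow> complex" where
  "levy_kernel y x = iexp (y \<bullet> x) - 1 - \<i> * complex_of_real (y \<bullet> x) * indicator (cball 0 1) x"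

lemma norm_iexp_diff_le:
  "norm (iexp u - 1) \<le> 2" "norm (iexp u - 1 - \<i> * complex_of_real u) \<le> u\<^sup>2 / 2"
proof -
  show "norm (iexp u - 1) \<le> 2" using norm_triangle_ineq4[of "iexp u" 1] by simp
  show "norm (iexp u - 1 - \<i> * complex_of_real u) \<le> u\<^sup>2 / 2"
    using iexp_approx1[of u 1] by (simp add: diff_diff_eq power2_eq_square)
qed

text \<open>Inside the unit ball the compensated exponential is of second order, outside it is at
  most 2. Adding both bounds gives one constant, whose quadratic growth in \<open>y\<close> is just
  what division by \<open>n^2\<close> absorbs when the Gaussian part is extracted.\<close>

lemma norm_levy_kernel_le: "norm (levy_kernel y x) \<le> (2 + (norm y)\<^sup>2) * min 1 ((norm x)\<^sup>2)"
proof (cases "norm x \<le> 1")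
  case True
  have "norm (levy_kernel y x) \<le> (y \<bullet> x)\<^sup>2 / 2"
    using norm_iexp_diff_le(2)[of "y \<bullet> x"] True by (simp add: levy_kernel_def)
  also have "\<dots> \<le> (norm y * norm x)\<^sup>2 / 2"
    using Cauchy_Schwarz_ineq2[of y x] by (intro divide_right_mono power2_le_iff_abs_le[THEN iffD2]) auto
  also have "\<dots> \<le> (2 + (norm y)\<^sup>2) * (norm x)\<^sup>2"
    by (simp add: power_mult_distrib algebra_simps)
  also have "(norm x)\<^sup>2 = min 1 ((norm x)\<^sup>2)" using True by (simp add: power_le_one min_absorb2)
  finally show ?thesis .
next
  case False
  hence m: "min 1 ((norm x)\<^sup>2) = 1" by (simp add: one_le_power min_absorb1)
  have "norm (levy_kernel y x) \<le> 2"
    using norm_iexp_diff_le(1)[of "y \<bullet> x"] False by (simp add: levy_kernel_def)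
  thus ?thesis unfolding m by (simp add: add_increasing2)
qed

lemma borel_measurable_levy_kernel [measurable]:
  assumes [measurable]: "f \<in> borel_measurable M" "g \<in> borel_measurable M"
  shows "(\<lambda>x. levy_kernel (f x) (g x)) \<in> borel_measurable M"
  unfolding levy_kernel_def indicator_def mem_cball_0 by measurable

lemma levy_exponent_kernel:
  "levy_exponent a R M y =
     \<i> * complex_of_real (y \<bullet> a) - complex_of_real (y \<bullet> blinfun_apply R y) / 2 + (CLINT x|M. levy_kernel y x)"
  by (simp add: levy_exponent_def levy_kernel_def)

lemma sets_levy_spectral_measure: "levy_spectral_measure M \<Longrightarrow> sets M = sets borel"
  by (simp add: levy_spectral_measure_def)

lemma integrable_min_norm_sq:
  assumes "levy_spectral_measure M"
  shows "integrable M (\<lambda>x. min 1 ((norm x)\<^sup>2))"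
proof -
  note [measurable_cong] = sets_levy_spectral_measure[OF assms]
  show ?thesis using assms by (intro integrableI_nonneg) (auto simp: levy_spectral_measure_def)
qed

lemma integrable_levy_spectral_bound:
  fixes f :: "'a::euclidean_space \<Rightarrow> 'b::{banach, second_countable_topology}"
  assumes M: "levy_spectral_measure M" and f: "f \<in> borel_measurable borel"
    and b: "\<And>x. norm (f x) \<le> C * min 1 ((norm x)\<^sup>2)"
  shows "integrable M f"
proof (rule Bochner_Integration.integrable_bound)
  note [measurable_cong] = sets_levy_spectral_measure[OF M]
  show "integrable M (\<lambda>x. C * min 1 ((norm x)\<^sup>2))" using integrable_min_norm_sq[OF M] by simp
  show "f \<in> borel_measurable M" using f by measurable
  show "AE x in M. norm (f x) \<le> norm (C * min 1 ((norm x)\<^sup>2))"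
    using b by (intro AE_I2) (simp add: abs_le_iff order_trans[OF b])
qed

lemma integrable_levy_kernel: "levy_spectral_measure M \<Longrightarrow> integrable M (levy_kernel y)"
  by (rule integrable_levy_spectral_bound[OF _ _ norm_levy_kernel_le]) auto

text \<open>Fubini with \<open>M\<close> rests on this, since \<open>M\<close> may have infinite
  mass near 0. The sets where \<open>norm x\<close> is at least 1 / (n + 1) have finite mass by
  comparison with \<open>min 1 ((norm x)\<^sup>2)\<close>, and the origin is a null set.\<close>

lemma sigma_finite_levy_spectral_measure:
  assumes M: "levy_spectral_measure M"
  shows "sigma_finite_measure M"
proof
  note s[measurable_cong] = sets_levy_spectral_measure[OF M]
  let ?U = "\<lambda>n::nat. {x::'a. inverse (real (Suc n)) \<le> norm x}"
  let ?A = "insert {0} (range ?U)"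
  have 1: "?A \<subseteq> sets M" unfolding s by auto
  have 2: "\<Union>?A = space M"
  proof -
    have "x \<in> \<Union>?A" for x :: 'a
    proof (cases "x = 0")
      case False
      then obtain n where "inverse (real (Suc n)) < norm x" using reals_Archimedean[of "norm x"] by auto
      thus ?thesis by (auto intro: less_imp_le)
    qed auto
    thus ?thesis using sets_eq_imp_space_eq[OF s] by auto
  qed
  have 3: "emeasure M (?U n) \<noteq> \<infinity>" for n
  proof -
    let ?c = "ennreal ((inverse (real (Suc n)))\<^sup>2)"
    have "?c * emeasure M (?U n) = (\<integral>\<^sup>+x. ?c * indicator (?U n) x \<partial>M)"
      by (subst nn_integral_cmult_indicator) auto
    also have "\<dots> \<le> (\<integral>\<^sup>+x. ennreal (min 1 ((norm x)\<^sup>2)) \<partial>M)"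
      by (intro nn_integral_mono)
        (auto simp: indicator_def intro!: ennreal_leI power_mono min.boundedI power_le_one simp del: of_nat_Suc
          simp: inverse_le_1_iff)
    also have "\<dots> < \<infinity>" using M by (simp add: levy_spectral_measure_def)
    finally have "?c * emeasure M (?U n) \<noteq> \<infinity>" by simp
    thus ?thesis by (auto simp: ennreal_mult_eq_top_iff simp del: of_nat_Suc)
  qed
  show "\<exists>A. countable A \<and> A \<subseteq> sets M \<and> \<Union>A = space M \<and> (\<forall>a\<in>A. emeasure M a \<noteq> \<infinity>)"
    using 1 2 3 M by (intro exI[of _ ?A]) (auto simp: levy_spectral_measure_def)
qed

lemma levy_exponent_0 [simp]: "levy_exponent a R M 0 = 0"
  by (simp add: levy_exponent_kernel levy_kernel_def)

lemma continuous_on_levy_exponent: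
  assumes M: "levy_spectral_measure M"
  shows "continuous_on A (levy_exponent a R M)"
proof -
  note s[measurable_cong] = sets_levy_spectral_measure[OF M]
  have "continuous_on UNIV (\<lambda>y. CLINT x|M. levy_kernel y x)"
    unfolding continuous_on_sequentially
  proof (intro allI ballI impI; elim conjE)
    fix u :: "nat \<Rightarrow> 'a" and y assume u: "u \<longlonglongrightarrow> y"
    then obtain B where B: "\<And>n. norm (u n) \<le> B"
      using convergent_imp_Bseq[of u] by (auto simp: convergent_def Bseq_def)
    show "((\<lambda>y. CLINT x|M. levy_kernel y x) \<circ> u) \<longlonglongrightarrow> (CLINT x|M. levy_kernel y x)"
      unfolding comp_def
    proof (rule integral_dominated_convergence[where w="\<lambda>x. (2 + B\<^sup>2) * min 1 ((norm x)\<^sup>2)"])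
      show "AE x in M. (\<lambda>i. levy_kernel (u i) x) \<longlonglongrightarrow> levy_kernel y x"
        unfolding levy_kernel_def by (intro AE_I2 tendsto_intros u)
      show "AE x in M. norm (levy_kernel (u i) x) \<le> (2 + B\<^sup>2) * min 1 ((norm x)\<^sup>2)" for i
        using B[of i] by (intro AE_I2 order_trans[OF norm_levy_kernel_le] mult_right_mono add_left_mono power_mono) auto
    qed (use integrable_min_norm_sq[OF M] in auto)
  qed
  hence "continuous_on UNIV (levy_exponent a R M)"
    unfolding levy_exponent_kernel by (intro continuous_intros) auto
  thus ?thesis by (rule continuous_on_subset) auto
qed

text \<open>The values of \<open>h\<close> are multiples of 2 pi i, which lie more than 1 apart, so
  a continuous \<open>h\<close> on a connected space is constant.\<close>

lemma continuous_log_eq_0: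
  fixes h :: "'a::real_normed_vector \<Rightarrow> complex"
  assumes h: "continuous_on UNIV h" "h 0 = 0" and e: "\<And>y. exp (h y) = 1"
  shows "h y = 0"
proof -
  have "h constant_on UNIV"
  proof (rule continuous_discrete_range_constant[OF connected_UNIV h(1)])
    fix x :: 'a
    have "1 \<le> norm (h y - h x)" if "h y \<noteq> h x" for y
    proof -
      have "exp (h y - h x) = 1" by (simp add: exp_diff e)
      then obtain n :: int where n: "Re (h y - h x) = 0" "Im (h y - h x) = of_int (2 * n) * pi"
        by (auto simp: exp_eq_1)
      have "n \<noteq> 0" using that n by (auto simp: complex_eq_iff)
      hence "1 * 1 \<le> \<bar>real_of_int (2 * n)\<bar> * pi" using pi_gt3 by (intro mult_mono) auto
      also have "\<dots> \<le> norm (h y - h x)" using abs_Im_le_cmod[of "h y - h x"] unfolding n by (simp add: abs_mult)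
      finally show ?thesis by simp
    qed
    thus "\<exists>e>0. \<forall>y. y \<in> UNIV \<and> h y \<noteq> h x \<longrightarrow> e \<le> norm (h y - h x)" by (intro exI[of _ 1]) auto
  qed
  thus ?thesis using h(2) by (auto simp: constant_on_def)
qed

text \<open>Along the ray through \<open>y\<close> the drift grows linearly, and the jump part grows
  more slowly than the square although it is only bounded by it. Division by the square of the scale
  therefore leaves the quadratic form of \<open>R\<close>.\<close>

lemma gaussian_part_tendsto:
  assumes M: "levy_spectral_measure M"
  shows "(\<lambda>n. levy_exponent a R M (real (Suc n) *\<^sub>R y) / (real (Suc n))\<^sup>2) \<longlonglongrightarrow>
     - complex_of_real (y \<bullet> blinfun_apply R y) / 2"
proof -
  note s[measurable_cong] = sets_levy_spectral_measure[OF M]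
  define r where "r n = real (Suc n)" for n
  have r: "r n \<ge> 1" for n by (simp add: r_def)
  have lim: "(\<lambda>n. 1 / r n) \<longlonglongrightarrow> 0" unfolding r_def by (rule LIMSEQ_Suc[OF lim_1_over_n])
  have eq: "levy_exponent a R M (r n *\<^sub>R y) / (r n)\<^sup>2 = \<i> * complex_of_real (y \<bullet> a) * complex_of_real (1 / r n)
      - complex_of_real (y \<bullet> blinfun_apply R y) / 2 + (CLINT x|M. levy_kernel (r n *\<^sub>R y) x / (r n)\<^sup>2)" for n
    using r[of n] by (simp add: levy_exponent_kernel blinfun.scaleR_right field_simps power2_eq_square)
  have "(\<lambda>n. CLINT x|M. levy_kernel (r n *\<^sub>R y) x / (r n)\<^sup>2) \<longlonglongrightarrow> (CLINT x|M. 0)"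
  proof (rule integral_dominated_convergence[where w="\<lambda>x. (2 + (norm y)\<^sup>2) * min 1 ((norm x)\<^sup>2)"])
    show "AE x in M. norm (levy_kernel (r i *\<^sub>R y) x / (r i)\<^sup>2) \<le> (2 + (norm y)\<^sup>2) * min 1 ((norm x)\<^sup>2)" for i
    proof (rule AE_I2)
      fix x
      have "norm (levy_kernel (r i *\<^sub>R y) x) \<le> (2 + (norm (r i *\<^sub>R y))\<^sup>2) * min 1 ((norm x)\<^sup>2)"
        by (rule norm_levy_kernel_le)
      \<comment> \<open>Since \<open>r i\<close> is at least 1, it may be pulled out of the sum;
        after division the dominating function does not depend on \<open>i\<close>.\<close>
      also have "\<dots> \<le> ((r i)\<^sup>2 * (2 + (norm y)\<^sup>2)) * min 1 ((norm x)\<^sup>2)"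
        using one_le_power[OF r, of i 2] r[of i] by (intro mult_right_mono) (auto simp: power_mult_distrib algebra_simps)
      finally show "norm (levy_kernel (r i *\<^sub>R y) x / (r i)\<^sup>2) \<le> (2 + (norm y)\<^sup>2) * min 1 ((norm x)\<^sup>2)"
        using r[of i] by (simp add: norm_divide norm_power divide_le_eq mult_ac)
    qed
    show "AE x in M. (\<lambda>i. levy_kernel (r i *\<^sub>R y) x / (r i)\<^sup>2) \<longlonglongrightarrow> 0"
    proof (rule AE_I2, rule Lim_null_comparison)
      fix x
      show "(\<lambda>i. (2 + \<bar>y \<bullet> x\<bar>) * (1 / r i)) \<longlonglongrightarrow> 0" by (rule tendsto_mult_right_zero[OF lim])
      show "\<forall>\<^sub>F i in sequentially. norm (levy_kernel (r i *\<^sub>R y) x / (r i)\<^sup>2) \<le> (2 + \<bar>y \<bullet> x\<bar>) * (1 / r i)"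
      proof (rule always_eventually, rule allI)
        fix i
        have "norm (levy_kernel (r i *\<^sub>R y) x) \<le> 2 + norm (\<i> * complex_of_real ((r i *\<^sub>R y) \<bullet> x) * indicator (cball 0 1) x)"
          unfolding levy_kernel_def by (rule order_trans[OF norm_triangle_ineq4 add_right_mono[OF norm_iexp_diff_le(1)]])
        also have "\<dots> \<le> 2 + r i * \<bar>y \<bullet> x\<bar>" using r[of i] by (auto simp: norm_mult abs_mult indicator_def)
        also have "\<dots> \<le> r i * (2 + \<bar>y \<bullet> x\<bar>)" using r[of i] by (simp add: distrib_left)
        finally show "norm (levy_kernel (r i *\<^sub>R y) x / (r i)\<^sup>2) \<le> (2 + \<bar>y \<bullet> x\<bar>) * (1 / r i)"
          using r[of i] unfolding norm_divide norm_power norm_of_real by (simp add: field_simps power2_eq_square)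
      qed
    qed
  qed (use integrable_min_norm_sq[OF M] in auto)
  hence "(\<lambda>n. levy_exponent a R M (r n *\<^sub>R y) / (r n)\<^sup>2) \<longlonglongrightarrow>
     \<i> * complex_of_real (y \<bullet> a) * complex_of_real 0 - complex_of_real (y \<bullet> blinfun_apply R y) / 2 + (CLINT x|M. 0)"
    unfolding eq by (intro tendsto_intros lim)
  thus ?thesis by (simp add: r_def)
qed

text \<open>Polarisation: a symmetric operator is determined by its quadratic form.\<close>

lemma gaussian_covariance_eqI:
  assumes "gaussian_covariance R" "gaussian_covariance R'"
    and q: "\<And>y. y \<bullet> blinfun_apply R y = y \<bullet> blinfun_apply R' y"
  shows "R = R'"
proof (rule blinfun_eqI)
  fix y
  have "x \<bullet> blinfun_apply R y = x \<bullet> blinfun_apply R' y" for x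
  proof -
    have "y \<bullet> blinfun_apply R x = x \<bullet> blinfun_apply R y" "y \<bullet> blinfun_apply R' x = x \<bullet> blinfun_apply R' y"
      using assms(1,2) by (auto simp: gaussian_covariance_def inner_commute)
    thus ?thesis using q[of "x + y"] q[of x] q[of y] by (simp add: blinfun.add_right inner_add_left inner_add_right)
  qed
  thus "blinfun_apply R y = blinfun_apply R' y" by (metis vector_eq_rdot inner_commute)
qed

text \<open>A second difference in \<open>y\<close> annihilates the constant and the compensator,
  which is linear in \<open>y\<close>, and multiplies the exponential by a nonnegative weight of
  second order at \<open>x = 0\<close>. This turns a possibly infinite Levy measure into a finite
  one.\<close>

lemma levy_kernel_second_difference:
  "2 * levy_kernel y x - levy_kernel (y + z) x - levy_kernel (y - z) x =
    complex_of_real (2 * (1 - cos (z \<bullet> x))) * iexp (y \<bullet> x)"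
  unfolding levy_kernel_def iexp_add_diff of_real_mult of_real_diff of_real_cos_iexp
  unfolding inner_add_left inner_diff_left of_real_add of_real_diff
  by (simp add: algebra_simps add_divide_distrib)

text \<open>The weight is the second difference at \<open>y = 0\<close>, so the bound on the kernel
  applies and makes it integrable against every Levy measure.\<close>

lemma cos_weight_le:
  fixes x z :: "'a::euclidean_space"
  shows "2 * (1 - cos (z \<bullet> x)) \<le> (6 + 2 * (norm z)\<^sup>2) * min 1 ((norm x)\<^sup>2)"
proof -
  have "complex_of_real (2 * (1 - cos (z \<bullet> x))) = 2 * levy_kernel 0 x - levy_kernel z x - levy_kernel (- z) x"
    using levy_kernel_second_difference[of 0 x z] by simp
  also have "norm \<dots> \<le> norm (2 * levy_kernel 0 x) + norm (levy_kernel z x) + norm (levy_kernel (- z) x)"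
    by (intro order_trans[OF norm_triangle_ineq4] add_right_mono) simp
  also have "\<dots> \<le> 0 + (2 + (norm z)\<^sup>2) * min 1 ((norm x)\<^sup>2) + (2 + (norm (-z))\<^sup>2) * min 1 ((norm x)\<^sup>2)"
    by (intro add_mono norm_levy_kernel_le) (simp add: levy_kernel_def)
  also have "\<dots> \<le> (6 + 2 * (norm z)\<^sup>2) * min 1 ((norm x)\<^sup>2)"
    by (simp add: algebra_simps)
  finally show ?thesis unfolding norm_of_real by linarith
qed

text \<open>The second difference of the exponent is, up to the Gaussian part, the Fourier transform of
  the finite measure \<open>2 (1 - cos (z \<bullet> x)) M(dx)\<close>.\<close>

lemma levy_spectral_density_eq:
  assumes M: "levy_spectral_measure M" and M': "levy_spectral_measure M'"
    and eq: "\<And>y. (CLINT x|M. levy_kernel y x) + c y = (CLINT x|M'. levy_kernel y x) + c' y"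
    and c: "\<And>y. 2 * c y - c (y + z) - c (y - z) = 2 * c' y - c' (y + z) - c' (y - z)"
  shows "density M (\<lambda>x. ennreal (2 * (1 - cos (z \<bullet> x)))) = density M' (\<lambda>x. ennreal (2 * (1 - cos (z \<bullet> x))))"
proof (rule finite_measure_eq_if_char_fun_eq)
  let ?w = "\<lambda>x. 2 * (1 - cos (z \<bullet> x))"
  have fin: "finite_measure (density L (\<lambda>x. ennreal (?w x)))" if L: "levy_spectral_measure L" for L
  proof (rule finite_measureI)
    note s[measurable_cong] = sets_levy_spectral_measure[OF L]
    have sp: "space L = UNIV" using sets_eq_imp_space_eq[OF s] by simp
    have "integrable L ?w"
      by (rule integrable_levy_spectral_bound[OF L _, where C="6 + 2 * (norm z)\<^sup>2"])
        (use cos_weight_le[of z] in auto)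
    thus "emeasure (density L (\<lambda>x. ennreal (?w x))) (space (density L (\<lambda>x. ennreal (?w x)))) \<noteq> \<infinity>"
      using sp by (auto simp: emeasure_density integrable_iff_bounded top.not_eq_extremum)
  qed
  show "finite_measure (density M (\<lambda>x. ennreal (?w x)))" "finite_measure (density M' (\<lambda>x. ennreal (?w x)))"
    using fin M M' by auto
  show "sets (density M (\<lambda>x. ennreal (?w x))) = sets borel" "sets (density M' (\<lambda>x. ennreal (?w x))) = sets borel"
    using sets_levy_spectral_measure M M' by auto
  have ch: "char_fun (density L (\<lambda>x. ennreal (?w x))) y = 2 * (CLINT x|L. levy_kernel y x)
     - (CLINT x|L. levy_kernel (y + z) x) - (CLINT x|L. levy_kernel (y - z) x)"
    if L: "levy_spectral_measure L" for L y
  proof -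
    note s[measurable_cong] = sets_levy_spectral_measure[OF L]
    have "char_fun (density L (\<lambda>x. ennreal (?w x))) y = (CLINT x|L. ?w x *\<^sub>R iexp (y \<bullet> x))"
      unfolding char_fun_def by (rule integral_density) auto
    also have "\<dots> = (CLINT x|L. 2 * levy_kernel y x - levy_kernel (y + z) x - levy_kernel (y - z) x)"
      unfolding levy_kernel_second_difference by (simp add: scaleR_conv_of_real)
    also have "\<dots> = 2 * (CLINT x|L. levy_kernel y x)
     - (CLINT x|L. levy_kernel (y + z) x) - (CLINT x|L. levy_kernel (y - z) x)"
      using integrable_levy_kernel[OF L] by simp
    finally show ?thesis .
  qed
  show "char_fun (density M (\<lambda>x. ennreal (?w x))) y = char_fun (density M' (\<lambda>x. ennreal (?w x))) y" for y
    unfolding ch[OF M] ch[OF M'] using eq[of y] eq[of "y + z"] eq[of "y - z"] c[of y] by algebra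
qed

text \<open>Where \<open>cos (z \<bullet> x) \<noteq> 1\<close> the weight can be divided out.
  Countably many \<open>z\<close> suffice for every nonzero \<open>x\<close> to lie in one of these
  regions; the regions are made disjoint so that masses add up, and 0 carries no mass.\<close>

lemma levy_spectral_measure_eqI:
  assumes M: "levy_spectral_measure M" and M': "levy_spectral_measure M'"
    and eq: "\<And>z. density M (\<lambda>x. ennreal (2 * (1 - cos (z \<bullet> x)))) = density M' (\<lambda>x. ennreal (2 * (1 - cos (z \<bullet> x))))"
  shows "M = M'"
proof (rule measure_eqI)
  note s[measurable_cong] = sets_levy_spectral_measure[OF M]
  note s'[measurable_cong] = sets_levy_spectral_measure[OF M']
  show "sets M = sets M'" using s s' by simp
  fix A assume "A \<in> sets M"
  hence A[measurable]: "A \<in> sets borel" by (simp add: s)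
  let ?w = "\<lambda>z x. 2 * (1 - cos (z \<bullet> x))"
  have sub: "emeasure M B = emeasure M' B" if B[measurable]: "B \<in> sets borel" and Bz: "\<And>x. x \<in> B \<Longrightarrow> cos (z \<bullet> x) \<noteq> 1" for B z
  proof -
    have "emeasure L B = (\<integral>\<^sup>+x. ennreal (1 / ?w z x) * indicator B x \<partial>density L (\<lambda>x. ennreal (?w z x)))"
      if L[measurable_cong]: "sets L = sets borel" for L
    proof -
      have "ennreal (?w z x) * (ennreal (1 / ?w z x) * indicator B x) = indicator B x" for x
        using Bz[of x] by (auto simp: indicator_def simp flip: ennreal_mult)
      thus ?thesis using L by (subst nn_integral_density) auto
    qed
    thus ?thesis using eq[of z] s s' by metis
  qed
  \<comment> \<open>Dividing a basis vector \<open>b\<close> with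
    \<open>b \<bullet> x \<noteq> 0\<close> by m + 1, for \<open>m\<close> above
    \<open>\<bar>b \<bullet> x\<bar>\<close>, makes the inner product with \<open>x\<close> nonzero
    and smaller than 1 in absolute value, well within the range where the cosine is below 1.\<close>
  define D where "D = (\<lambda>(b, m). b /\<^sub>R real (Suc m)) ` ((Basis :: 'a set) \<times> (UNIV :: nat set))"
  have D: "countable D" unfolding D_def by (intro countable_image countable_SIGMA countable_finite[OF finite_Basis]) auto
  define U where "U k = {x :: 'a. cos (from_nat_into D k \<bullet> x) \<noteq> 1}" for k
  have U[measurable]: "U k \<in> sets borel" for k unfolding U_def by measurable
  have "range U \<subseteq> sets borel" using U by auto
  from sets.range_disjointed_sets[OF this] have d[measurable]: "disjointed U k \<in> sets borel" for k by auto
  have cover: "x \<in> (\<Union>k. U k)" if "x \<noteq> 0" for x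
  proof -
    from that obtain b where b: "b \<in> Basis" "b \<bullet> x \<noteq> 0" using euclidean_all_zero_iff[of x] by (auto simp: inner_commute)
    obtain m where m: "\<bar>b \<bullet> x\<bar> < real m" using reals_Archimedean2 by blast
    let ?z = "b /\<^sub>R real (Suc m)"
    have "0 < \<bar>?z \<bullet> x\<bar>" "\<bar>?z \<bullet> x\<bar> < 1" using b m by (auto simp: abs_mult divide_simps)
    hence "cos \<bar>?z \<bullet> x\<bar> < cos 0" using pi_gt3 by (intro cos_monotone_0_pi) auto
    hence "cos (?z \<bullet> x) \<noteq> 1" by simp
    moreover have "?z \<in> D" unfolding D_def using b(1) by (intro image_eqI[of _ _ "(b, m)"]) auto
    then obtain k where "from_nat_into D k = ?z" using from_nat_into_surj[OF D] by blast
    ultimately show ?thesis by (auto simp: U_def intro!: exI[of _ k])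
  qed
  have "emeasure L A = (\<Sum>k. emeasure L (A \<inter> disjointed U k))" if L: "levy_spectral_measure L" for L
  proof -
    note t[measurable_cong] = sets_levy_spectral_measure[OF L]
    have "(\<Union>k. U k) = - {0}" using cover by (auto simp: U_def)
    hence "(\<Union>k. A \<inter> disjointed U k) = A - {0}" using UN_disjointed_eq[of U] by blast
    moreover have "emeasure L (A - {0}) = emeasure L A"
      using L t by (intro emeasure_Diff_null_set) (auto simp: null_sets_def levy_spectral_measure_def)
    moreover have "(\<Sum>k. emeasure L (A \<inter> disjointed U k)) = emeasure L (\<Union>k. A \<inter> disjointed U k)"
      by (rule suminf_emeasure) (use disjoint_family_disjointed[of U] t in \<open>auto simp: disjoint_family_on_def\<close>)
    ultimately show ?thesis by simp
  qed
  moreover have "emeasure M (A \<inter> disjointed U k) = emeasure M' (A \<inter> disjointed U k)" for k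
  proof (rule sub[of _ "from_nat_into D k"])
    show "A \<inter> disjointed U k \<in> sets borel" by auto
  qed (use disjointed_subset[of U k] in \<open>auto simp: U_def\<close>)
  ultimately show "emeasure M A = emeasure M' A" using M M' by simp
qed

text \<open>The components become visible at different scales: quadratic growth at infinity shows
  \<open>R\<close>; once \<open>R\<close> cancels, second differences show \<open>M\<close>, because
  the drift is linear; the remaining linear term is \<open>a\<close>.\<close>

lemma levy_exponent_inject:
  assumes R: "gaussian_covariance R" "gaussian_covariance R'"
    and M: "levy_spectral_measure M" "levy_spectral_measure M'"
    and eq: "\<And>y. levy_exponent a R M y = levy_exponent a' R' M' y"
  shows "a = a' \<and> R = R' \<and> M = M'"
proof -
  have "y \<bullet> blinfun_apply R y = y \<bullet> blinfun_apply R' y" for y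
    using LIMSEQ_unique[OF gaussian_part_tendsto[OF M(1), of a R y]
        gaussian_part_tendsto[OF M(2), of a' R' y, folded eq]] by simp
  hence RR: "R = R'" by (rule gaussian_covariance_eqI[OF R])
  have "density M (\<lambda>x. ennreal (2 * (1 - cos (z \<bullet> x)))) = density M' (\<lambda>x. ennreal (2 * (1 - cos (z \<bullet> x))))" for z
  proof (rule levy_spectral_density_eq[OF M])
    show "(CLINT x|M. levy_kernel y x) + \<i> * complex_of_real (y \<bullet> a) =
        (CLINT x|M'. levy_kernel y x) + \<i> * complex_of_real (y \<bullet> a')" for y
      using eq[of y] unfolding levy_exponent_kernel RR by (simp add: algebra_simps)
  qed (simp add: inner_add_left inner_diff_left algebra_simps)
  hence MM: "M = M'" by (rule levy_spectral_measure_eqI[OF M])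
  have "y \<bullet> a = y \<bullet> a'" for y
    using eq[of y] unfolding levy_exponent_kernel RR MM by simp
  hence "a = a'" by (metis vector_eq_rdot inner_commute)
  with RR MM show ?thesis by simp
qed

text \<open>Two continuous logarithms of one characteristic function that both vanish at 0 coincide,
  which reduces uniqueness of triplets to equality of exponents.\<close>

theorem has_levy_triplet_unique:
  assumes "has_levy_triplet \<mu> a R M" "has_levy_triplet \<mu> a' R' M'"
  shows "a = a' \<and> R = R' \<and> M = M'"
proof (rule levy_exponent_inject)
  fix y
  note M = assms[unfolded has_levy_triplet_def]
  have "levy_exponent a R M y - levy_exponent a' R' M' y = 0"
  proof (rule continuous_log_eq_0[where h="\<lambda>y. levy_exponent a R M y - levy_exponent a' R' M' y"])
    show "continuous_on UNIV (\<lambda>y. levy_exponent a R M y - levy_exponent a' R' M' y)"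
      using M by (intro continuous_on_diff continuous_on_levy_exponent) auto
    show "exp (levy_exponent a R M y - levy_exponent a' R' M' y) = 1" for y
    proof -
      have "exp (levy_exponent a R M y) = exp (levy_exponent a' R' M' y)" using M by (auto dest!: spec[of _ y])
      thus ?thesis by (simp add: exp_diff)
    qed
  qed simp
  thus "levy_exponent a R M y = levy_exponent a' R' M' y" by simp
qed (use assms in \<open>auto simp: has_levy_triplet_def\<close>)

lemma levy_triplet_eqI:
  assumes "has_levy_triplet \<mu> a R M"
  shows "levy_triplet \<mu> = (a, R, M)"
  unfolding levy_triplet_def
proof (rule the_equality)
  fix t assume t: "case t of (a, R, M) \<Rightarrow> has_levy_triplet \<mu> a R M"
  obtain a' R' M' where "t = (a', R', M')" by (cases t)
  thus "t = (a, R, M)" using t has_levy_triplet_unique[OF assms, of a' R' M'] by simp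
qed (simp add: assms)

section \<open>Riemann sums for the random integral\<close>

text \<open>Cells are open on the left and closed on the right, like the intervals whose Stieltjes
  measure is an increment. The cell of \<open>t\<close> ends at
  \<open>\<lceil>real n * t\<rceil>\<close> over \<open>n\<close>, hence the \<open>- 1\<close> in
  its index.\<close>

lemma mem_grid_interval_iff:
  fixes t :: real
  assumes "n > 0" "t > 0"
  shows "t \<in> {real k / real n<..real (Suc k) / real n} \<longleftrightarrow> k = nat \<lceil>real n * t\<rceil> - 1"
proof -
  have p: "real n * t > 0" using assms by simp
  have "t \<in> {real k / real n<..real (Suc k) / real n} \<longleftrightarrow> \<lceil>real n * t\<rceil> = int (Suc k)"
    using assms(1) unfolding ceiling_eq_iff by (simp add: field_simps)
  also have "\<dots> \<longleftrightarrow> k = nat \<lceil>real n * t\<rceil> - 1"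
    using p[folded zero_less_ceiling] by linarith
  finally show ?thesis .
qed

text \<open>The sums are integrals of step functions bounded by \<open>B\<close>, so dominated
  convergence applies. The values \<open>v n k\<close> are abstract because two cases are covered:
  path values at left endpoints against an increasing power, where the limit is a left limit, and
  exponent values at right endpoints against Lebesgue measure.\<close>

lemma step_sum_tendsto_set_integral:
  fixes F :: "real \<Rightarrow> real" and v :: "nat \<Rightarrow> nat \<Rightarrow> 'b::{banach, second_countable_topology}"
  assumes F: "mono F" "\<And>a. continuous (at_right a) F"
    and B: "\<And>n k. k < n \<Longrightarrow> norm (v n k) \<le> B"
    and lim: "\<And>t. 0 < t \<Longrightarrow> t \<le> 1 \<Longrightarrow> (\<lambda>n. v n (nat \<lceil>real n * t\<rceil> - 1)) \<longlonglongrightarrow> G t"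
  shows "(\<lambda>n. \<Sum>k<n. (F (real (Suc k) / real n) - F (real k / real n)) *\<^sub>R v n k)
     \<longlonglongrightarrow> (LINT t:{0<..1}|interval_measure F. G t)"
proof -
  let ?M = "interval_measure F"
  let ?I = "\<lambda>n k. {real k / real n<..real (Suc k) / real n}"
  define s where "s n t = (\<Sum>k<n. indicat_real (?I n k) t *\<^sub>R v n k)" for n t
  have em: "emeasure ?M {a<..b} = ennreal (F b - F a)" if "a \<le> b" for a b
    using that F by (intro emeasure_interval_measure_Ioc) (auto dest: monoD)
  have me: "measure ?M {a<..b} = F b - F a" if "a \<le> b" for a b
    using that F by (intro measure_interval_measure_Ioc) (auto dest: monoD)
  have B0: "0 \<le> B" using order_trans[OF norm_ge_zero B[of 0 1]] by simp
  have le1: "nat \<lceil>real n * t\<rceil> - 1 < n" if "0 < t" "t \<le> 1" "n > 0" for n t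
  proof -
    have "real n * t \<le> real n * 1" using that by (intro mult_left_mono) auto
    hence "\<lceil>real n * t\<rceil> \<le> int n" by (simp add: ceiling_le_iff)
    thus ?thesis using that by auto
  qed
  have s_eq: "s n t = v n (nat \<lceil>real n * t\<rceil> - 1)" if "0 < t" "t \<le> 1" "n > 0" for n t
  proof -
    have "s n t = (\<Sum>k<n. if k = nat \<lceil>real n * t\<rceil> - 1 then v n k else 0)"
      unfolding s_def using that mem_grid_interval_iff[OF that(3,1)] by (intro sum.cong) (auto simp: indicator_def)
    also have "\<dots> = v n (nat \<lceil>real n * t\<rceil> - 1)" using le1[OF that] by (simp add: sum.delta)
    finally show ?thesis .
  qed
  have s_0: "s n t = 0" if "t \<notin> {0<..1}" for n t
  proof -
    have "t \<notin> ?I n k" if "k < n" for k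
    proof
      assume t: "t \<in> ?I n k"
      have "0 \<le> real k / real n" "real (Suc k) / real n \<le> 1" using that by auto
      moreover have "real k / real n < t" "t \<le> real (Suc k) / real n" using t by auto
      ultimately have "t \<in> {0<..1}" unfolding greaterThanAtMost_iff by linarith
      thus False using \<open>t \<notin> {0<..1}\<close> by simp
    qed
    thus ?thesis unfolding s_def by (intro sum.neutral) (auto simp: indicator_def)
  qed
  have s_B: "norm (s n t) \<le> B * indicator {0<..1} t" for n t
  proof (cases "t \<in> {0<..1} \<and> n > 0")
    case True
    thus ?thesis using B[OF le1[of t n]] s_eq[of t n] by auto
  next
    case False
    hence "s n t = 0" using s_0 by (cases "n = 0") (auto simp: s_def)
    thus ?thesis using B0 by simp
  qed
  have [measurable]: "s n \<in> borel_measurable borel" for n unfolding s_def by measurable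
  have slim: "(\<lambda>n. s n t) \<longlonglongrightarrow> indicat_real {0<..1} t *\<^sub>R G t" for t
  proof (cases "t \<in> {0<..1}")
    case True
    have "eventually (\<lambda>n. v n (nat \<lceil>real n * t\<rceil> - 1) = s n t) sequentially"
      using eventually_gt_at_top[of 0] by eventually_elim (use True s_eq in auto)
    from Lim_transform_eventually[OF lim this] True show ?thesis by simp
  qed (simp add: s_0)
  \<comment> \<open>Measurability of the limit is inherited from the step functions.\<close>
  have Gm: "(\<lambda>t. indicat_real {0<..1} t *\<^sub>R G t) \<in> borel_measurable ?M"
    by (rule borel_measurable_LIMSEQ_metric[OF _ slim]) simp
  have "(\<lambda>n. \<integral>t. s n t \<partial>?M) \<longlonglongrightarrow> (\<integral>t. indicat_real {0<..1} t *\<^sub>R G t \<partial>?M)"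
  proof (rule integral_dominated_convergence[where w="\<lambda>t. B * indicator {0<..1} t"])
    show "integrable ?M (\<lambda>t. B * indicator {0<..1} t)"
      by (intro integrable_mult_right integrable_real_indicator) (auto simp: em)
  qed (use Gm slim s_B in auto)
  moreover have "(\<integral>t. s n t \<partial>?M) = (\<Sum>k<n. (F (real (Suc k) / real n) - F (real k / real n)) *\<^sub>R v n k)" for n
  proof -
    have le: "real k / real n \<le> real (Suc k) / real n" for k by (simp add: divide_right_mono)
    have "has_bochner_integral ?M (\<lambda>t. indicat_real (?I n k) t *\<^sub>R v n k) (measure ?M (?I n k) *\<^sub>R v n k)" for k
      by (rule has_bochner_integral_indicator) (auto simp: em[OF le] simp del: of_nat_Suc)
    hence "has_bochner_integral ?M (s n) (\<Sum>k<n. measure ?M (?I n k) *\<^sub>R v n k)"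
      unfolding s_def by (intro has_bochner_integral_sum) auto
    thus ?thesis by (simp only: has_bochner_integral_integral_eq me[OF le])
  qed
  ultimately show ?thesis by (simp add: set_lebesgue_integral_def)
qed

text \<open>The left endpoint of the cell stays strictly below \<open>t\<close>, so path values
  there pick up the left limit. The right endpoint may coincide with \<open>t\<close>; plain
  convergence is enough for a continuous exponent.\<close>

lemma grid_tendsto:
  fixes t :: real
  assumes "t > 0"
  shows "filterlim (\<lambda>n. real (nat \<lceil>real n * t\<rceil> - 1) / real n) (at_left t) sequentially"
    and "(\<lambda>n. real (Suc (nat \<lceil>real n * t\<rceil> - 1)) / real n) \<longlonglongrightarrow> t"
proof -
  have *: "t - 1 / real n \<le> real (nat \<lceil>real n * t\<rceil> - 1) / real n \<and> real (nat \<lceil>real n * t\<rceil> - 1) / real n < t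
     \<and> real (Suc (nat \<lceil>real n * t\<rceil> - 1)) / real n = real (nat \<lceil>real n * t\<rceil> - 1) / real n + 1 / real n" if "n > 0" for n
  proof -
    have "t \<in> {real (nat \<lceil>real n * t\<rceil> - 1) / real n<..real (Suc (nat \<lceil>real n * t\<rceil> - 1)) / real n}"
      using mem_grid_interval_iff[OF that assms] by blast
    thus ?thesis by (auto simp: add_divide_distrib)
  qed
  have l: "(\<lambda>n. 1 / real n) \<longlonglongrightarrow> 0" by (rule lim_1_over_n)
  have a: "(\<lambda>n. real (nat \<lceil>real n * t\<rceil> - 1) / real n) \<longlonglongrightarrow> t"
  proof (rule tendsto_sandwich)
    show "(\<lambda>n. t - 1 / real n) \<longlonglongrightarrow> t" using tendsto_diff[OF tendsto_const l, of t] by simp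
    show "eventually (\<lambda>n. t - 1 / real n \<le> real (nat \<lceil>real n * t\<rceil> - 1) / real n) sequentially"
      using eventually_gt_at_top[of 0] by eventually_elim (use * in auto)
    show "eventually (\<lambda>n. real (nat \<lceil>real n * t\<rceil> - 1) / real n \<le> t) sequentially"
      using eventually_gt_at_top[of 0] by eventually_elim (use * in \<open>auto intro: less_imp_le\<close>)
  qed simp
  show "filterlim (\<lambda>n. real (nat \<lceil>real n * t\<rceil> - 1) / real n) (at_left t) sequentially"
    unfolding filterlim_at
  proof
    show "eventually (\<lambda>n. real (nat \<lceil>real n * t\<rceil> - 1) / real n \<in> {..<t}
        \<and> real (nat \<lceil>real n * t\<rceil> - 1) / real n \<noteq> t) sequentially"
      using eventually_gt_at_top[of 0]
    proof eventually_elim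
      case (elim n)
      thus ?case using *[OF elim] by simp
    qed
  qed (rule a)
  have "(\<lambda>n. real (nat \<lceil>real n * t\<rceil> - 1) / real n + 1 / real n) \<longlonglongrightarrow> t"
    using tendsto_add[OF a l] by simp
  thus "(\<lambda>n. real (Suc (nat \<lceil>real n * t\<rceil> - 1)) / real n) \<longlonglongrightarrow> t"
  proof (rule Lim_transform_eventually)
    show "eventually (\<lambda>n. real (nat \<lceil>real n * t\<rceil> - 1) / real n + 1 / real n
        = real (Suc (nat \<lceil>real n * t\<rceil> - 1)) / real n) sequentially"
      using eventually_gt_at_top[of 0]
    proof eventually_elim
      case (elim n)
      show ?case using *[OF elim] by presburger
    qed
  qed
qed

lemma left_limit_tendsto:
  assumes "t > 0" "\<exists>l. (f \<longlongrightarrow> l) (at_left t)"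
  shows "(f \<longlongrightarrow> left_limit f t) (at_left t)"
proof -
  obtain l where l: "(f \<longlongrightarrow> l) (at_left t)" using assms(2) by blast
  hence "Lim (at_left t) f = l" by (intro tendsto_Lim) auto
  thus ?thesis using l assms(1) by (simp add: left_limit_def)
qed

text \<open>One-sided limits bound the function near each point, and compactness makes the bound
  uniform. The guard \<open>0 \<le> s\<close> in the local bound takes care of \<open>t = 0\<close>,
  where nothing is known on the left.\<close>

lemma cadlag_bounded:
  fixes f :: "real \<Rightarrow> 'a::real_normed_vector"
  assumes rc: "\<And>t. t \<ge> 0 \<Longrightarrow> (f \<longlongrightarrow> f t) (at_right t)" and ll: "\<And>t. t > 0 \<Longrightarrow> \<exists>l. (f \<longlongrightarrow> l) (at_left t)"
  obtains B where "\<And>s. 0 \<le> s \<Longrightarrow> s \<le> b \<Longrightarrow> norm (f s) \<le> B"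
proof -
  have loc: "\<exists>U B. open U \<and> t \<in> U \<and> (\<forall>s\<in>U. 0 \<le> s \<longrightarrow> norm (f s) \<le> B)" if t: "t \<ge> 0" for t
  proof -
    have near: "\<exists>B. eventually (\<lambda>s. norm (f s) \<le> B) G" if "(f \<longlongrightarrow> l) G" for l and G :: "real filter"
    proof -
      have "eventually (\<lambda>s. dist (f s) l < 1) G" using that by (rule tendstoD) simp
      hence "eventually (\<lambda>s. norm (f s) \<le> norm l + 1) G"
      proof (rule eventually_mono)
        fix s assume "dist (f s) l < 1"
        thus "norm (f s) \<le> norm l + 1" using norm_triangle_ineq2[of "f s" l] by (simp add: dist_norm)
      qed
      thus ?thesis by blast
    qed
    obtain B1 where B1: "eventually (\<lambda>s. norm (f s) \<le> B1) (at_right t)" using near[OF rc[OF t]] by blast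
    have "\<exists>B. eventually (\<lambda>s. 0 \<le> s \<longrightarrow> norm (f s) \<le> B) (at_left t)"
    proof (cases "t = 0")
      case True
      have "eventually (\<lambda>s::real. s < 0) (at_left 0)" by (simp add: eventually_at_filter)
      thus ?thesis using True by (intro exI[of _ 0]) (auto elim!: eventually_mono)
    next
      case False
      then obtain l where "(f \<longlongrightarrow> l) (at_left t)" using ll[of t] t by auto
      then obtain B where "eventually (\<lambda>s. norm (f s) \<le> B) (at_left t)" using near by blast
      thus ?thesis by (intro exI[of _ B]) (auto elim!: eventually_mono)
    qed
    then obtain B2 where B2: "eventually (\<lambda>s. 0 \<le> s \<longrightarrow> norm (f s) \<le> B2) (at_left t)" by blast
    let ?B = "max (norm (f t)) (max B1 B2)"
    have "eventually (\<lambda>s. 0 \<le> s \<longrightarrow> norm (f s) \<le> ?B) (at t)"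
      unfolding eventually_at_split using B1 B2 by (auto elim!: eventually_mono)
    hence "eventually (\<lambda>s. 0 \<le> s \<longrightarrow> norm (f s) \<le> ?B) (nhds t)"
      by (auto simp: eventually_nhds_conv_at)
    thus ?thesis unfolding eventually_nhds by blast
  qed
  then obtain U B where UB: "\<And>t. t \<ge> 0 \<Longrightarrow> open (U t) \<and> t \<in> U t \<and> (\<forall>s\<in>U t. 0 \<le> s \<longrightarrow> norm (f s) \<le> B t)"
    by metis
  have "compact {0..b}" by simp
  then obtain C where C: "C \<subseteq> {0..b}" "finite C" "{0..b} \<subseteq> (\<Union>c\<in>C. U c)"
    by (rule compactE_image[where C="{0..b}" and f=U]) (use UB in auto)
  show ?thesis
  proof (rule that[of "Max (insert 0 (B ` C))"])
    fix s assume s: "0 \<le> s" "s \<le> b"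
    then obtain c where c: "c \<in> C" "s \<in> U c" using C(3) by auto
    hence "norm (f s) \<le> B c" using UB[of c] C(1) s by auto
    also have "B c \<le> Max (insert 0 (B ` C))" using c C(2) by (intro Max_ge) auto
    finally show "norm (f s) \<le> Max (insert 0 (B ` C))" .
  qed
qed

lemma variation_upto_powr:
  assumes "p > 0" "s \<ge> 0"
  shows "variation_upto (\<lambda>t. t powr p) s = s powr p"
  unfolding variation_upto_def
proof (rule cSup_eq_maximum)
  \<comment> \<open>One step from 0 to \<open>s\<close> realises the whole variation of an
    increasing function; staying at \<open>s\<close> afterwards keeps the sequence monotone and in
    range.\<close>
  define \<tau> where "\<tau> k = (if k = 0 then 0 else s)" for k :: nat
  have "mono \<tau>" "range \<tau> \<subseteq> {0..s}" using assms by (auto simp: mono_def \<tau>_def)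
  moreover have "s powr p = (\<Sum>i<1. \<bar>\<tau> (Suc i) powr p - \<tau> i powr p\<bar>)" using assms by (simp add: \<tau>_def)
  ultimately show "s powr p \<in> {\<Sum>i<n. \<bar>\<tau> (Suc i) powr p - \<tau> i powr p\<bar> |n \<tau>. mono \<tau> \<and> range \<tau> \<subseteq> {0..s}}"
    by blast
next
  fix x assume "x \<in> {\<Sum>i<n. \<bar>\<tau> (Suc i) powr p - \<tau> i powr p\<bar> |n \<tau>. mono \<tau> \<and> range \<tau> \<subseteq> {0..s}}"
  then obtain n and \<tau> :: "nat \<Rightarrow> real" where \<tau>: "mono \<tau>" "range \<tau> \<subseteq> {0..s}"
    and x: "x = (\<Sum>i<n. \<bar>\<tau> (Suc i) powr p - \<tau> i powr p\<bar>)" by blast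
  have \<tau>b: "0 \<le> \<tau> i" "\<tau> i \<le> s" for i using \<tau>(2) by (auto simp: image_subset_iff)
  have "\<tau> i powr p \<le> \<tau> (Suc i) powr p" for i
    using \<tau>b \<tau>(1) assms by (intro powr_mono2) (auto simp: mono_def)
  hence "x = (\<Sum>i<n. \<tau> (Suc i) powr p - \<tau> i powr p)" unfolding x by simp
  also have "\<dots> = \<tau> n powr p - \<tau> 0 powr p" by (rule sum_lessThan_telescope)
  also have "\<dots> \<le> \<tau> n powr p" by simp
  also have "\<dots> \<le> s powr p" using \<tau>b assms by (intro powr_mono2) auto
  finally show "x \<le> s powr p" .
qed

text \<open>For the increasing integrator \<open>t powr p\<close> the negative part of the Jordan decomposition vanishes.\<close>

lemma stieltjes_sum_tendsto:
  fixes f :: "real \<Rightarrow> 'a::euclidean_space"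
  assumes rc: "\<And>t. t \<ge> 0 \<Longrightarrow> (f \<longlongrightarrow> f t) (at_right t)" and ll: "\<And>t. t > 0 \<Longrightarrow> \<exists>l. (f \<longlongrightarrow> l) (at_left t)"
    and p: "p > 0"
  shows "(\<lambda>n. \<Sum>k<n. ((real (Suc k) / real n) powr p - (real k / real n) powr p) *\<^sub>R f (real k / real n))
    \<longlonglongrightarrow> stieltjes_integral (left_limit f) (\<lambda>t. t powr p)"
proof -
  define c where "c t = max 0 (min 1 t)" for t :: real
  define F where "F = (\<lambda>t. c t powr p)"
  have c0: "0 \<le> c t" "c t \<le> 1" for t by (auto simp: c_def)
  have "continuous_on UNIV F" unfolding F_def c_def using p
    by (intro continuous_on_powr' continuous_intros) auto
  hence Fc: "continuous (at_right a) F" for a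
    using continuous_at_imp_continuous_within continuous_on_eq_continuous_at open_UNIV by blast
  have Fm: "mono F" unfolding F_def mono_def c_def using p by (auto intro!: powr_mono2)
  obtain B where B: "\<And>s. 0 \<le> s \<Longrightarrow> s \<le> 1 \<Longrightarrow> norm (f s) \<le> B" using cadlag_bounded[OF rc ll, where b=1] by metis
  have "emeasure (interval_measure (\<lambda>t::real. 0)) {0<..1} = ennreal (0 - 0)"
    by (rule emeasure_interval_measure_Ioc) auto
  hence "AE t in interval_measure (\<lambda>t::real. 0). t \<notin> {0<..1}"
    by (intro AE_not_in) (auto simp: null_sets_def)
  hence "(LINT t|interval_measure (\<lambda>t. 0). indicat_real {0<..1} t *\<^sub>R left_limit f t) = 0"
    by (intro integral_eq_zero_AE) (auto elim!: eventually_mono)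
  hence "stieltjes_integral (left_limit f) (\<lambda>t. t powr p) = (LINT t:{0<..1}|interval_measure F. left_limit f t)"
    using c0 p by (simp add: stieltjes_integral_def variation_upto_powr F_def set_lebesgue_integral_def flip: c_def)
  moreover have "(\<lambda>n. \<Sum>k<n. (F (real (Suc k) / real n) - F (real k / real n)) *\<^sub>R f (real k / real n))
    \<longlonglongrightarrow> (LINT t:{0<..1}|interval_measure F. left_limit f t)"
  proof (rule step_sum_tendsto_set_integral[OF Fm Fc])
    show "norm (f (real k / real n)) \<le> B" if "k < n" for k n using that by (intro B) auto
    show "(\<lambda>n. f (real (nat \<lceil>real n * t\<rceil> - 1) / real n)) \<longlonglongrightarrow> left_limit f t" if "0 < t" "t \<le> 1" for t
      by (rule filterlim_compose[OF left_limit_tendsto[OF that(1) ll[OF that(1)]] grid_tendsto(1)[OF that(1)]])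
  qed
  moreover have "(\<Sum>k<n. (F (real (Suc k) / real n) - F (real k / real n)) *\<^sub>R f (real k / real n))
    = (\<Sum>k<n. ((real (Suc k) / real n) powr p - (real k / real n) powr p) *\<^sub>R f (real k / real n))" for n
  proof -
    have "F (real k / real n) = (real k / real n) powr p" if "k \<le> n" for k
      using that by (simp add: F_def c_def divide_le_eq)
    thus ?thesis by (intro sum.cong) (simp_all del: of_nat_Suc)
  qed
  ultimately show ?thesis by simp
qed

lemma random_integral_tendsto:
  fixes Z :: "real \<Rightarrow> 'w \<Rightarrow> 'a::euclidean_space"
  assumes Z: "levy_process P Z" and \<omega>: "\<omega> \<in> space P" and p: "p > 0"
  shows "(\<lambda>n. \<Sum>k<n. ((real (Suc k) / real n) powr p) *\<^sub>R (Z (real (Suc k) / real n) \<omega> - Z (real k / real n) \<omega>))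
     \<longlonglongrightarrow> random_integral (\<lambda>t. t powr p) Z (\<lambda>t. t) \<omega>"
proof -
  let ?f = "\<lambda>s. Z s \<omega>" and ?h = "\<lambda>t::real. t powr p"
  have "(\<lambda>n. \<Sum>k<n. (?h (real (Suc k) / real n) - ?h (real k / real n)) *\<^sub>R ?f (real k / real n))
    \<longlonglongrightarrow> stieltjes_integral (left_limit ?f) ?h"
    using Z \<omega> p by (intro stieltjes_sum_tendsto) (auto simp: levy_process_def)
  hence "(\<lambda>n. ?f 1 - (\<Sum>k<n. (?h (real (Suc k) / real n) - ?h (real k / real n)) *\<^sub>R ?f (real k / real n)))
    \<longlonglongrightarrow> random_integral ?h Z (\<lambda>t. t) \<omega>" (is "?L \<longlonglongrightarrow> _")
    unfolding random_integral_def using p by (simp add: tendsto_diff)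
  \<comment> \<open>For \<open>n = 0\<close> the left side is \<open>?f 1\<close> and the right side
    an empty sum, so positive \<open>n\<close> is required. The boundary term at 0 drops out because
    \<open>0 powr p = 0\<close>.\<close>
  moreover have "eventually (\<lambda>n. ?L n = (\<Sum>k<n. ?h (real (Suc k) / real n) *\<^sub>R (?f (real (Suc k) / real n) - ?f (real k / real n)))) sequentially"
    using eventually_gt_at_top[of 0]
  proof eventually_elim
    case (elim n)
    let ?g = "\<lambda>k. ?h (real k / real n) *\<^sub>R ?f (real k / real n)"
    have "(\<Sum>k<n. ?g (Suc k) - ?g k) = ?g n - ?g 0" by (rule sum_lessThan_telescope)
    also have "\<dots> = ?f 1" using elim p by simp
    finally have "?f 1 = (\<Sum>k<n. ?g (Suc k) - ?g k)" ..
    thus ?case by (simp add: sum_subtractf[symmetric] algebra_simps del: of_nat_Suc)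
  qed
  ultimately show ?thesis by (rule Lim_transform_eventually)
qed

section \<open>The law of the random integral\<close>

lemma char_fun_distr:
  assumes "X \<in> borel_measurable P"
  shows "char_fun (distr P borel X) y = (CLINT \<omega>|P. iexp (y \<bullet> X \<omega>))"
  unfolding char_fun_def using assms by (subst integral_distr) auto

lemma continuous_on_char_fun:
  assumes "finite_measure M" and s[measurable_cong]: "sets M = sets borel"
  shows "continuous_on UNIV (char_fun M)"
  unfolding continuous_on_sequentially
proof (intro allI ballI impI; elim conjE)
  interpret finite_measure M by fact
  fix u and y :: 'a assume u: "u \<longlonglongrightarrow> y"
  show "(char_fun M \<circ> u) \<longlonglongrightarrow> char_fun M y"
    unfolding comp_def char_fun_def
  proof (rule integral_dominated_convergence[where w="\<lambda>_. 1"])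
    show "AE x in M. (\<lambda>i. iexp (u i \<bullet> x)) \<longlonglongrightarrow> iexp (y \<bullet> x)" by (intro AE_I2 tendsto_intros u)
  qed auto
qed

lemma levy_processD:
  assumes "levy_process P Z"
  shows "prob_space P" "\<And>t. t \<ge> 0 \<Longrightarrow> Z t \<in> borel_measurable P" "\<And>\<omega>. \<omega> \<in> space P \<Longrightarrow> Z 0 \<omega> = 0"
    "\<And>s t. s \<ge> 0 \<Longrightarrow> t \<ge> 0 \<Longrightarrow> distr P borel (\<lambda>\<omega>. Z (s + t) \<omega> - Z s \<omega>) = distr P borel (Z t)"
  using assms unfolding levy_process_def by auto

text \<open>Independence gives the product and stationarity makes all factors characteristic
  functions of \<open>Z (1 / n)\<close>. Constant coefficients \<open>c k\<close> yield the roots of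
  the law at time 1, varying ones the Riemann sums of the integral.\<close>

lemma integral_iexp_increments:
  fixes Z :: "real \<Rightarrow> 'w \<Rightarrow> 'a::euclidean_space"
  assumes Z: "levy_process P Z" and n: "n > 0"
  shows "(CLINT \<omega>|P. iexp (\<Sum>k<n. c k \<bullet> (Z (real (Suc k) / real n) \<omega> - Z (real k / real n) \<omega>)))
     = (\<Prod>k<n. char_fun (distr P borel (Z (1 / real n))) (c k))"
proof -
  interpret prob_space P by (rule levy_processD[OF Z])
  note [measurable] = levy_processD(2)[OF Z]
  let ?D = "\<lambda>k \<omega>. Z (real (Suc k) / real n) \<omega> - Z (real k / real n) \<omega>"
  have [measurable]: "?D k \<in> borel_measurable P" for k by measurable
  have "\<forall>(n::nat) (\<tau>::nat \<Rightarrow> real). 0 \<le> \<tau> 0 \<and> (\<forall>i<n. \<tau> i \<le> \<tau> (Suc i)) \<longrightarrow>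
        indep_vars (\<lambda>_. borel) (\<lambda>i \<omega>. Z (\<tau> (Suc i)) \<omega> - Z (\<tau> i) \<omega>) {..<n}"
    using Z unfolding levy_process_def by blast
  from this[rule_format, of "\<lambda>k. real k / real n" n] have "indep_vars (\<lambda>_. borel) ?D {..<n}"
    by (simp add: divide_right_mono)
  hence ind: "indep_vars (\<lambda>_. borel) (\<lambda>k \<omega>. iexp (c k \<bullet> ?D k \<omega>)) {..<n}"
    by (rule indep_vars_compose2) measurable
  have "(CLINT \<omega>|P. iexp (\<Sum>k<n. c k \<bullet> ?D k \<omega>)) = (CLINT \<omega>|P. (\<Prod>k<n. iexp (c k \<bullet> ?D k \<omega>)))"
    by (simp only: of_real_sum sum_distrib_left exp_sum finite_lessThan)
  also have "\<dots> = (\<Prod>k<n. CLINT \<omega>|P. iexp (c k \<bullet> ?D k \<omega>))"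
    by (rule indep_vars_lebesgue_integral[OF _ ind]) (auto intro!: integrable_const_bound[where B=1])
  also have "\<dots> = (\<Prod>k<n. char_fun (distr P borel (Z (1 / real n))) (c k))"
  proof (rule prod.cong[OF refl])
    fix k
    have eq: "real (Suc k) / real n = real k / real n + 1 / real n" by (simp add: add_divide_distrib)
    have "distr P borel (?D k) = distr P borel (Z (1 / real n))"
      unfolding eq by (rule levy_processD(4)[OF Z]) auto
    thus "(CLINT \<omega>|P. iexp (c k \<bullet> ?D k \<omega>)) = char_fun (distr P borel (Z (1 / real n))) (c k)"
      using char_fun_distr[of "?D k" P "c k"] by simp
  qed
  finally show ?thesis .
qed

text \<open>The quotient of the characteristic function by \<open>exp (\<Phi> / n)\<close> is a continuous function with
  values in the finite set of \<open>n\<close>-th roots of unity.\<close>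

lemma char_fun_levy_process_inverse:
  fixes Z :: "real \<Rightarrow> 'w \<Rightarrow> 'a::euclidean_space"
  assumes Z: "levy_process P Z" and n: "n > 0"
    and ch: "\<And>y. char_fun (distr P borel (Z 1)) y = exp (\<Phi> y)" and \<Phi>: "continuous_on UNIV \<Phi>" "\<Phi> 0 = 0"
  shows "char_fun (distr P borel (Z (1 / real n))) y = exp (\<Phi> y / of_nat n)"
proof -
  interpret prob_space P by (rule levy_processD[OF Z])
  note [measurable] = levy_processD(2)[OF Z]
  let ?\<phi> = "char_fun (distr P borel (Z (1 / real n)))"
  interpret D: prob_space "distr P borel (Z (1 / real n))" by (rule prob_space_distr) measurable
  have pow: "?\<phi> y ^ n = exp (\<Phi> y)" for y
  proof -
    have "?\<phi> y ^ n = (CLINT \<omega>|P. iexp (\<Sum>k<n. y \<bullet> (Z (real (Suc k) / real n) \<omega> - Z (real k / real n) \<omega>)))"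
      by (simp only: integral_iexp_increments[OF Z n] prod_constant card_lessThan)
    also have "\<dots> = (CLINT \<omega>|P. iexp (y \<bullet> Z 1 \<omega>))"
    proof (rule Bochner_Integration.integral_cong[OF refl])
      fix \<omega> assume \<omega>: "\<omega> \<in> space P"
      have "(\<Sum>k<n. Z (real (Suc k) / real n) \<omega> - Z (real k / real n) \<omega>) = Z (real n / real n) \<omega> - Z (real 0 / real n) \<omega>"
        by (rule sum_lessThan_telescope)
      thus "iexp (\<Sum>k<n. y \<bullet> (Z (real (Suc k) / real n) \<omega> - Z (real k / real n) \<omega>)) = iexp (y \<bullet> Z 1 \<omega>)"
        using n levy_processD(3)[OF Z \<omega>] by (simp add: inner_sum_right[symmetric] del: of_nat_Suc)
    qed
    also have "\<dots> = exp (\<Phi> y)" using ch[of y] by (simp add: char_fun_distr)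
    finally show ?thesis .
  qed
  let ?u = "\<lambda>y. ?\<phi> y * exp (- \<Phi> y / of_nat n)"
  have u: "?u y ^ n = 1" for y
  proof -
    have "exp (- \<Phi> y / of_nat n) ^ n = exp (- \<Phi> y)" using n by (simp flip: exp_of_nat_mult)
    thus ?thesis by (simp only: power_mult_distrib pow exp_add_commuting[symmetric]) (simp add: exp_minus)
  qed
  have "?u constant_on UNIV"
  proof (rule continuous_finite_range_constant)
    show "continuous_on UNIV ?u"
      by (intro continuous_intros continuous_on_char_fun \<Phi>) (use n in \<open>auto intro: D.finite_measure_axioms\<close>)
    have "?u ` UNIV \<subseteq> {z. z ^ n = 1}" using u by blast
    thus "finite (range ?u)" by (rule finite_subset) (use finite_roots_unity[of n] n in auto)
  qed (rule connected_UNIV)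
  moreover have "?u 0 = 1" using \<Phi>(2) D.prob_space by (simp add: char_fun_def)
  ultimately have "?u y = 1" unfolding constant_on_def by (metis UNIV_I)
  thus ?thesis by (simp add: exp_minus field_simps)
qed

text \<open>\<open>\<Phi>\<close> is any continuous logarithm vanishing at 0 rather than the
  exponent of a triplet, so that \<open>\<Phi> / n\<close> for a slowed-down process is covered as
  well. Each increment contributes \<open>exp (v n k / n)\<close>, and the exponents add up to a
  Riemann sum.\<close>

lemma char_fun_random_integral:
  fixes Z :: "real \<Rightarrow> 'w \<Rightarrow> 'a::euclidean_space"
  assumes Z: "levy_process P Z" and p: "p > 0"
    and ch: "\<And>y. char_fun (distr P borel (Z 1)) y = exp (\<Phi> y)" and \<Phi>: "continuous_on UNIV \<Phi>" "\<Phi> 0 = 0"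
  defines "X \<equiv> random_integral (\<lambda>t. t powr p) Z (\<lambda>t. t)"
  shows "X \<in> borel_measurable P"
    and "char_fun (distr P borel X) y = exp (LINT t:{0<..1}|lborel. \<Phi> ((t powr p) *\<^sub>R y))"
proof -
  interpret prob_space P by (rule levy_processD[OF Z])
  note [measurable] = levy_processD(2)[OF Z]
  define S where "S n \<omega> = (\<Sum>k<n. ((real (Suc k) / real n) powr p) *\<^sub>R (Z (real (Suc k) / real n) \<omega> - Z (real k / real n) \<omega>))" for n \<omega>
  have [measurable]: "S n \<in> borel_measurable P" for n unfolding S_def by measurable
  have lim: "(\<lambda>n. S n \<omega>) \<longlonglongrightarrow> X \<omega>" if "\<omega> \<in> space P" for \<omega>
    unfolding S_def X_def by (rule random_integral_tendsto[OF Z that p])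
  show X[measurable]: "X \<in> borel_measurable P"
    by (rule borel_measurable_LIMSEQ_metric[OF _ lim]) auto
  have "(\<lambda>n. CLINT \<omega>|P. iexp (y \<bullet> S n \<omega>)) \<longlonglongrightarrow> (CLINT \<omega>|P. iexp (y \<bullet> X \<omega>))"
  proof (rule integral_dominated_convergence[where w="\<lambda>_. 1"])
    show "AE \<omega> in P. (\<lambda>n. iexp (y \<bullet> S n \<omega>)) \<longlonglongrightarrow> iexp (y \<bullet> X \<omega>)" by (intro AE_I2 tendsto_intros lim)
  qed auto
  moreover have "(\<lambda>n. CLINT \<omega>|P. iexp (y \<bullet> S n \<omega>)) \<longlonglongrightarrow> exp (LINT t:{0<..1}|lborel. \<Phi> ((t powr p) *\<^sub>R y))"
  proof (rule Lim_transform_eventually)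
    define v where "v n k = \<Phi> ((real (Suc k) / real n) powr p *\<^sub>R y)" for n k
    have "compact ((\<lambda>t. \<Phi> (t *\<^sub>R y)) ` {0..1})"
      by (intro compact_continuous_image continuous_on_compose2[OF \<Phi>(1)] continuous_intros) auto
    from compact_imp_bounded[OF this]
    obtain B where "\<forall>z\<in>(\<lambda>t. \<Phi> (t *\<^sub>R y)) ` {0..1}. norm z \<le> B" unfolding bounded_iff by blast
    hence B: "norm (\<Phi> (t *\<^sub>R y)) \<le> B" if "t \<in> {0..1}" for t using that by blast
    have "(\<lambda>n. \<Sum>k<n. (real (Suc k) / real n - real k / real n) *\<^sub>R v n k)
      \<longlonglongrightarrow> (LINT t:{0<..1}|interval_measure (\<lambda>x. x). \<Phi> ((t powr p) *\<^sub>R y))"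
    proof (rule step_sum_tendsto_set_integral)
      show "norm (v n k) \<le> B" if "k < n" for k n
        unfolding v_def using that p by (intro B) (auto intro: powr_le1)
      show "(\<lambda>n. v n (nat \<lceil>real n * t\<rceil> - 1)) \<longlonglongrightarrow> \<Phi> ((t powr p) *\<^sub>R y)" if "0 < t" "t \<le> 1" for t
        unfolding v_def using that
        by (intro continuous_on_tendsto_compose[OF \<Phi>(1)] tendsto_intros grid_tendsto(2)) auto
    qed (auto simp: mono_def)
    thus "(\<lambda>n. exp (\<Sum>k<n. (real (Suc k) / real n - real k / real n) *\<^sub>R v n k))
       \<longlonglongrightarrow> exp (LINT t:{0<..1}|lborel. \<Phi> ((t powr p) *\<^sub>R y))"
      unfolding lborel_eq_real by (rule tendsto_exp)
    show "eventually (\<lambda>n. exp (\<Sum>k<n. (real (Suc k) / real n - real k / real n) *\<^sub>R v n k)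
       = (CLINT \<omega>|P. iexp (y \<bullet> S n \<omega>))) sequentially"
      using eventually_gt_at_top[of 0]
    proof eventually_elim
      case (elim n)
      have "(CLINT \<omega>|P. iexp (y \<bullet> S n \<omega>)) = (CLINT \<omega>|P. iexp (\<Sum>k<n. ((real (Suc k) / real n) powr p *\<^sub>R y) \<bullet> (Z (real (Suc k) / real n) \<omega> - Z (real k / real n) \<omega>)))"
        by (simp only: S_def inner_sum_right inner_scaleR_left inner_scaleR_right)
      also have "\<dots> = (\<Prod>k<n. exp (v n k / of_nat n))"
        unfolding integral_iexp_increments[OF Z elim] char_fun_levy_process_inverse[OF Z elim ch \<Phi>] v_def ..
      also have "\<dots> = exp (\<Sum>k<n. v n k / of_nat n)" by (simp add: exp_sum)
      also have "(\<Sum>k<n. v n k / of_nat n) = (\<Sum>k<n. (real (Suc k) / real n - real k / real n) *\<^sub>R v n k)"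
        by (intro sum.cong refl) (simp add: scaleR_conv_of_real add_divide_distrib)
      finally show ?case ..
    qed
  qed
  ultimately show "char_fun (distr P borel X) y = exp (LINT t:{0<..1}|lborel. \<Phi> ((t powr p) *\<^sub>R y))"
    unfolding char_fun_distr[OF X] by (rule LIMSEQ_unique)
qed

section \<open>Infinite divisibility of the law of the random integral\<close>

lemma levy_process_rescale:
  fixes Z :: "real \<Rightarrow> 'w \<Rightarrow> 'a::euclidean_space"
  assumes Z: "levy_process P Z" and c: "c > 0"
  shows "levy_process P (\<lambda>t. Z (c * t))"
  unfolding levy_process_def
proof (intro conjI allI impI ballI)
  note D = Z[unfolded levy_process_def]
  show "prob_space P" using D by blast
  show "Z (c * t) \<in> borel_measurable P" if "t \<ge> 0" for t using D c that by simp
  show "Z (c * 0) \<omega> = 0" if "\<omega> \<in> space P" for \<omega> using D that by simp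
  show "prob_space.indep_vars P (\<lambda>_. borel) (\<lambda>i \<omega>. Z (c * \<tau> (Suc i)) \<omega> - Z (c * \<tau> i) \<omega>) {..<n}"
    if "0 \<le> \<tau> 0 \<and> (\<forall>i<n. \<tau> i \<le> \<tau> (Suc i))" for n :: nat and \<tau>
  proof -
    have "0 \<le> c * \<tau> 0 \<and> (\<forall>i<n. c * \<tau> i \<le> c * \<tau> (Suc i))" using that c by simp
    thus ?thesis using D by (elim conjE) (drule spec2[of _ n "\<lambda>i. c * \<tau> i"], simp)
  qed
  show "distr P borel (\<lambda>\<omega>. Z (c * (s + t)) \<omega> - Z (c * s) \<omega>) = distr P borel (Z (c * t))" if "s \<ge> 0" "t \<ge> 0" for s t
    using D c that by (simp add: distrib_left)
  have right: "filterlim (\<lambda>s. c * s) (at_right (c * t)) (at_right t)" and left: "filterlim (\<lambda>s. c * s) (at_left (c * t)) (at_left t)" for t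
    unfolding filterlim_at using c by (auto intro!: tendsto_intros simp: eventually_at_filter)
  show "((\<lambda>s. Z (c * s) \<omega>) \<longlongrightarrow> Z (c * t) \<omega>) (at_right t)" if "\<omega> \<in> space P" "t \<ge> 0" for t \<omega>
    using filterlim_compose[OF _ right, of "\<lambda>s. Z s \<omega>" "nhds (Z (c * t) \<omega>)" t] D that c by simp
  show "\<exists>l. ((\<lambda>s. Z (c * s) \<omega>) \<longlongrightarrow> l) (at_left t)" if "\<omega> \<in> space P" "t > 0" for t \<omega>
  proof -
    have "\<exists>l. ((\<lambda>s. Z s \<omega>) \<longlongrightarrow> l) (at_left (c * t))" using D that c by simp
    thus ?thesis using filterlim_compose[OF _ left, of "\<lambda>s. Z s \<omega>" _ t] by blast
  qed
qed

lemma char_fun_sum_PiM: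
  fixes \<nu> :: "'a::euclidean_space measure"
  assumes "prob_space \<nu>" and s[measurable_cong]: "sets \<nu> = sets borel"
  shows "char_fun (distr (Pi\<^sub>M {..<n} (\<lambda>_. \<nu>)) borel (\<lambda>x. \<Sum>i<n. x i)) y = char_fun \<nu> y ^ n"
proof -
  interpret \<nu>: prob_space \<nu> by fact
  interpret product_sigma_finite "\<lambda>_. \<nu>" by standard
  have "(\<lambda>x. \<Sum>i<n. x i) \<in> borel_measurable (Pi\<^sub>M {..<n} (\<lambda>_. \<nu>))"
    by (intro borel_measurable_sum measurable_compose[OF measurable_component_singleton]) auto
  hence "char_fun (distr (Pi\<^sub>M {..<n} (\<lambda>_. \<nu>)) borel (\<lambda>x. \<Sum>i<n. x i)) y = (CLINT x|Pi\<^sub>M {..<n} (\<lambda>_. \<nu>). iexp (y \<bullet> (\<Sum>i<n. x i)))"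
    by (rule char_fun_distr)
  also have "\<dots> = (CLINT x|Pi\<^sub>M {..<n} (\<lambda>_. \<nu>). (\<Prod>i<n. iexp (y \<bullet> x i)))"
    by (simp only: inner_sum_right of_real_sum sum_distrib_left exp_sum finite_lessThan)
  also have "\<dots> = (\<Prod>i<n. char_fun \<nu> y)"
    unfolding char_fun_def by (rule product_integral_prod) (auto intro!: \<nu>.integrable_const_bound[where B=1])
  finally show ?thesis by simp
qed

text \<open>The \<open>n\<close>-th convolution root of the law of the integral is the law of the same integral
  over the slowed-down process \<open>Z (t / n)\<close>.\<close>

lemma random_integral_infinitely_divisible:
  fixes Z :: "real \<Rightarrow> 'w \<Rightarrow> 'a::euclidean_space"
  assumes Z: "levy_process P Z" and p: "p > 0"
    and ch: "\<And>y. char_fun (distr P borel (Z 1)) y = exp (\<Phi> y)" and \<Phi>: "continuous_on UNIV \<Phi>" "\<Phi> 0 = 0"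
  shows "distr P borel (random_integral (\<lambda>t. t powr p) Z (\<lambda>t. t)) \<in> infinitely_divisible"
proof -
  let ?X = "\<lambda>Z. random_integral (\<lambda>t. t powr p) Z (\<lambda>t. t)"
  interpret prob_space P by (rule levy_processD[OF Z])
  note X = char_fun_random_integral[OF Z p ch \<Phi>]
  have "\<exists>\<nu> :: 'a measure. prob_space \<nu> \<and> sets \<nu> = sets borel \<and>
        distr P borel (?X Z) = distr (Pi\<^sub>M {..<n} (\<lambda>_. \<nu>)) borel (\<lambda>x. \<Sum>i<n. x i)" if "n \<ge> 1" for n :: nat
  proof -
    have n: "n > 0" using that by simp
    define W where "W t = Z (1 / real n * t)" for t
    have W: "levy_process P W" unfolding W_def using n by (intro levy_process_rescale[OF Z]) simp
    have chW: "char_fun (distr P borel (W 1)) y = exp (\<Phi> y / of_nat n)" for y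
      using char_fun_levy_process_inverse[OF Z n ch \<Phi>] by (simp add: W_def)
    have XW: "?X W \<in> borel_measurable P"
      "char_fun (distr P borel (?X W)) y = exp (LINT t:{0<..1}|lborel. \<Phi> ((t powr p) *\<^sub>R y) / of_nat n)" for y
      using n \<Phi> by (intro char_fun_random_integral[OF W p chW] continuous_intros; simp)+
    let ?\<nu> = "distr P borel (?X W)"
    have \<nu>: "prob_space ?\<nu>" by (rule prob_space_distr[OF XW(1)])
    let ?S = "distr (Pi\<^sub>M {..<n} (\<lambda>_. ?\<nu>)) borel (\<lambda>x. \<Sum>i<n. x i)"
    interpret \<nu>: prob_space ?\<nu> by fact
    interpret PM: prob_space "Pi\<^sub>M {..<n} (\<lambda>_. ?\<nu>)" by (intro prob_space_PiM \<nu>)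
    \<comment> \<open>Equality of the laws is checked on characteristic functions: the exponent of
      the root is that of the integral divided by \<open>n\<close>, and the \<open>n\<close>-th
      power undoes the division.\<close>
    have "distr P borel (?X Z) = ?S"
    proof (rule finite_measure_eq_if_char_fun_eq)
      show "finite_measure (distr P borel (?X Z))" using prob_space_distr[OF X(1)] by (rule prob_space.axioms)
      show "finite_measure ?S"
        by (rule PM.finite_measure_distr)
          (intro borel_measurable_sum measurable_compose[OF measurable_component_singleton], auto)
      show "char_fun (distr P borel (?X Z)) y = char_fun ?S y" for y
      proof -
        have "char_fun ?S y = exp (LINT t:{0<..1}|lborel. \<Phi> ((t powr p) *\<^sub>R y) / of_nat n) ^ n"
          by (subst char_fun_sum_PiM[OF \<nu>]) (simp_all add: XW)
        also have "\<dots> = exp (LINT t:{0<..1}|lborel. \<Phi> ((t powr p) *\<^sub>R y))"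
          using n by (simp add: set_lebesgue_integral_def flip: exp_of_nat_mult)
        finally show ?thesis using X(2) by simp
      qed
    qed simp_all
    thus ?thesis using \<nu> by (intro exI[of _ ?\<nu>]) simp
  qed
  thus ?thesis using prob_space_distr[OF X(1)] by (simp add: infinitely_divisible_def)
qed

section \<open>Mixtures of dilated Levy measures\<close>

text \<open>A multiplicative convolution: for probability laws on the line it is the law of a
  product of independent factors, which is how two successive scales are combined. As the image of a
  product measure it can be evaluated by Fubini in either order.\<close>

definition scale_mixture :: "real measure \<Rightarrow> 'a::euclidean_space measure \<Rightarrow> 'a measure" where
  "scale_mixture \<kappa> M = distr (\<kappa> \<Otimes>\<^sub>M M) borel (\<lambda>(c, x). c *\<^sub>R x)"

text \<open>Scales in the half-open unit interval preserve Levy measures: positivity keeps mass off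
  the origin, and \<open>c \<le> 1\<close> does not increase
  \<open>min 1 ((norm x)\<^sup>2)\<close>.\<close>

locale levy_scale_mixture = prob_space \<kappa> for \<kappa> :: "real measure" +
  fixes M :: "'a::euclidean_space measure"
  assumes sets_\<kappa>[measurable_cong]: "sets \<kappa> = sets borel" and scale: "AE c in \<kappa>. 0 < c \<and> c \<le> 1"
    and levy: "levy_spectral_measure M"
begin

lemma sets_M[measurable_cong]: "sets M = sets borel"
  by (rule sets_levy_spectral_measure[OF levy])

sublocale M: sigma_finite_measure M
  by (rule sigma_finite_levy_spectral_measure[OF levy])

sublocale pair_sigma_finite \<kappa> M ..

lemma nn_integral_scale_mixture:
  assumes [measurable]: "f \<in> borel_measurable borel"
  shows "(\<integral>\<^sup>+x. f x \<partial>scale_mixture \<kappa> M) = (\<integral>\<^sup>+c. (\<integral>\<^sup>+x. f (c *\<^sub>R x) \<partial>M) \<partial>\<kappa>)"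
proof -
  have "(\<integral>\<^sup>+x. f x \<partial>scale_mixture \<kappa> M) = (\<integral>\<^sup>+p. f (case p of (c, x) \<Rightarrow> c *\<^sub>R x) \<partial>(\<kappa> \<Otimes>\<^sub>M M))"
    unfolding scale_mixture_def by (rule nn_integral_distr) measurable
  also have "\<dots> = (\<integral>\<^sup>+c. (\<integral>\<^sup>+x. f (c *\<^sub>R x) \<partial>M) \<partial>\<kappa>)"
    using M.nn_integral_fst[of "\<lambda>p. f (case p of (c, x) \<Rightarrow> c *\<^sub>R x)" \<kappa>] by simp
  finally show ?thesis .
qed

lemma emeasure_scale_mixture:
  assumes [measurable]: "A \<in> sets borel"
  shows "emeasure (scale_mixture \<kappa> M) A = (\<integral>\<^sup>+c. emeasure (dilate c M) A \<partial>\<kappa>)"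
proof -
  have "emeasure (scale_mixture \<kappa> M) A = (\<integral>\<^sup>+x. indicator A x \<partial>scale_mixture \<kappa> M)"
    by (simp add: scale_mixture_def)
  also have "\<dots> = (\<integral>\<^sup>+c. (\<integral>\<^sup>+x. indicator A (c *\<^sub>R x) \<partial>M) \<partial>\<kappa>)"
    by (rule nn_integral_scale_mixture) measurable
  finally have 1: "emeasure (scale_mixture \<kappa> M) A = (\<integral>\<^sup>+c. (\<integral>\<^sup>+x. indicator A (c *\<^sub>R x) \<partial>M) \<partial>\<kappa>)" .
  have 2: "(\<integral>\<^sup>+x. indicator A (c *\<^sub>R x) \<partial>M) = emeasure (dilate c M) A" for c
  proof -
    have "emeasure (dilate c M) A = (\<integral>\<^sup>+x. indicator A x \<partial>dilate c M)" by (simp add: dilate_def)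
    also have "\<dots> = (\<integral>\<^sup>+x. indicator A (c *\<^sub>R x) \<partial>M)"
      unfolding dilate_def by (rule nn_integral_distr) measurable
    finally show ?thesis ..
  qed
  show ?thesis unfolding 1 2 ..
qed

lemma integrable_pair_bound:
  fixes f :: "real \<times> 'a \<Rightarrow> 'b::{banach, second_countable_topology}"
  assumes f: "f \<in> borel_measurable (\<kappa> \<Otimes>\<^sub>M M)" and b: "\<And>c x. norm (f (c, x)) \<le> min 1 ((norm x)\<^sup>2)"
  shows "integrable (\<kappa> \<Otimes>\<^sub>M M) f"
proof (rule integrableI_bounded[OF f])
  have "(\<integral>\<^sup>+p. ennreal (norm (f p)) \<partial>(\<kappa> \<Otimes>\<^sub>M M)) \<le> (\<integral>\<^sup>+p. ennreal (min 1 ((norm (snd p))\<^sup>2)) \<partial>(\<kappa> \<Otimes>\<^sub>M M))"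
    by (intro nn_integral_mono) (use b in \<open>auto intro!: ennreal_leI\<close>)
  also have "\<dots> = (\<integral>\<^sup>+c. (\<integral>\<^sup>+x. ennreal (min 1 ((norm x)\<^sup>2)) \<partial>M) \<partial>\<kappa>)"
    using M.nn_integral_fst[of "\<lambda>p. ennreal (min 1 ((norm (snd p))\<^sup>2))" \<kappa>] by simp
  also have "\<dots> < \<infinity>"
    using levy by (simp add: emeasure_space_1 levy_spectral_measure_def)
  finally show "(\<integral>\<^sup>+p. ennreal (norm (f p)) \<partial>(\<kappa> \<Otimes>\<^sub>M M)) < \<infinity>" .
qed

lemma levy_spectral_scale_mixture: "levy_spectral_measure (scale_mixture \<kappa> M)"
  unfolding levy_spectral_measure_def
proof (intro conjI)
  show "sets (scale_mixture \<kappa> M) = sets borel" by (simp add: scale_mixture_def)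
  have "emeasure (scale_mixture \<kappa> M) {0} = (\<integral>\<^sup>+c. (\<integral>\<^sup>+x. indicator {0} (c *\<^sub>R x) \<partial>M) \<partial>\<kappa>)"
    by (subst nn_integral_scale_mixture[symmetric]) (auto simp: scale_mixture_def)
  also have "\<dots> = (\<integral>\<^sup>+c. 0 \<partial>\<kappa>)"
  proof (intro nn_integral_cong_AE, use scale in eventually_elim)
    fix c :: real assume "0 < c \<and> c \<le> 1"
    hence "(\<integral>\<^sup>+x. indicator {0} (c *\<^sub>R x) \<partial>M) = (\<integral>\<^sup>+x. indicator {0} x \<partial>M)"
      by (intro nn_integral_cong) (auto simp: indicator_def)
    thus "(\<integral>\<^sup>+x. indicator {0} (c *\<^sub>R x) \<partial>M) = 0" using levy by (simp add: levy_spectral_measure_def)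
  qed
  finally show "emeasure (scale_mixture \<kappa> M) {0} = 0" by simp
  have "(\<integral>\<^sup>+x. ennreal (min 1 ((norm x)\<^sup>2)) \<partial>scale_mixture \<kappa> M) = (\<integral>\<^sup>+c. (\<integral>\<^sup>+x. ennreal (min 1 ((norm (c *\<^sub>R x))\<^sup>2)) \<partial>M) \<partial>\<kappa>)"
    by (rule nn_integral_scale_mixture) measurable
  also have "\<dots> \<le> (\<integral>\<^sup>+c. (\<integral>\<^sup>+x. ennreal (min 1 ((norm x)\<^sup>2)) \<partial>M) \<partial>\<kappa>)"
  proof (intro nn_integral_mono_AE, use scale in eventually_elim, intro nn_integral_mono ennreal_leI)
    fix c :: real and x :: 'a assume "0 < c \<and> c \<le> 1"
    hence "(norm (c *\<^sub>R x))\<^sup>2 \<le> (norm x)\<^sup>2" by (intro power_mono) (auto simp: mult_left_le_one_le)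
    thus "min 1 ((norm (c *\<^sub>R x))\<^sup>2) \<le> min 1 ((norm x)\<^sup>2)" by (rule min.mono[OF order_refl])
  qed
  also have "\<dots> < \<infinity>"
    using levy by (simp add: emeasure_space_1 levy_spectral_measure_def)
  finally show "(\<integral>\<^sup>+x. ennreal (min 1 ((norm x)\<^sup>2)) \<partial>scale_mixture \<kappa> M) < \<infinity>" .
qed

lemma scale_integral_fst_snd:
  fixes f :: "real \<times> 'a \<Rightarrow> 'b::{banach, second_countable_topology}"
  assumes "integrable (\<kappa> \<Otimes>\<^sub>M M) f"
  shows "(\<integral>c. (\<integral>x. f (c, x) \<partial>M) \<partial>\<kappa>) = (\<integral>x. (\<integral>c. f (c, x) \<partial>\<kappa>) \<partial>M)"
  using Fubini_integral[of "\<lambda>c x. f (c, x)"] assms by simp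

lemma integral_scale_mixture:
  fixes f :: "'a \<Rightarrow> 'b::{banach, second_countable_topology}"
  assumes f: "integrable (scale_mixture \<kappa> M) f"
  shows "integrable (\<kappa> \<Otimes>\<^sub>M M) (\<lambda>(c, x). f (c *\<^sub>R x))"
    and "(\<integral>x. f x \<partial>scale_mixture \<kappa> M) = (\<integral>c. (\<integral>x. f (c *\<^sub>R x) \<partial>M) \<partial>\<kappa>)"
proof -
  have [measurable]: "f \<in> borel_measurable borel"
    using borel_measurable_integrable[OF f] by (simp add: scale_mixture_def)
  show i: "integrable (\<kappa> \<Otimes>\<^sub>M M) (\<lambda>(c, x). f (c *\<^sub>R x))"
    using integrable_distr[of "\<lambda>(c, x). c *\<^sub>R x" "\<kappa> \<Otimes>\<^sub>M M" borel f] f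
    by (simp add: scale_mixture_def case_prod_beta')
  have "(\<integral>x. f x \<partial>scale_mixture \<kappa> M) = (\<integral>p. f (case p of (c, x) \<Rightarrow> c *\<^sub>R x) \<partial>(\<kappa> \<Otimes>\<^sub>M M))"
    unfolding scale_mixture_def by (rule integral_distr) measurable
  also have "\<dots> = (\<integral>c. (\<integral>x. f (c *\<^sub>R x) \<partial>M) \<partial>\<kappa>)"
    using integral_fst'[OF i] by (simp add: case_prod_beta')
  finally show "(\<integral>x. f x \<partial>scale_mixture \<kappa> M) = (\<integral>c. (\<integral>x. f (c *\<^sub>R x) \<partial>M) \<partial>\<kappa>)" .
qed

text \<open>Dilating by \<open>c \<le> 1\<close> moves a jump \<open>x\<close> with \<open>norm x > 1\<close> into the unit ball when
  \<open>norm (c x) \<le> 1\<close>; the compensator of such jumps goes into the shift.\<close>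

definition entering :: "real \<Rightarrow> 'a \<Rightarrow> 'a" where
  "entering c x = (indicator {x. norm x > 1} x * indicator {x. norm x \<le> 1} (c *\<^sub>R x) * c) *\<^sub>R x"

text \<open>The left side compensates where \<open>norm x\<close> is at most 1, the kernel on the
  right where \<open>norm (c *\<^sub>R x)\<close> is at most 1. For \<open>c \<le> 1\<close> the
  second region contains the first, and the surplus is exactly the entering jumps.\<close>

lemma levy_kernel_dilate:
  assumes "0 \<le> c" "c \<le> 1"
  shows "levy_kernel (c *\<^sub>R y) x = levy_kernel y (c *\<^sub>R x) + \<i> * complex_of_real (y \<bullet> entering c x)"
proof -
  have "norm (c *\<^sub>R x) \<le> norm x" using assms by (simp add: mult_left_le_one_le)
  thus ?thesis by (auto simp: levy_kernel_def entering_def indicator_def)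
qed

text \<open>An entering vector has norm at most 1 and arises only from \<open>norm x > 1\<close>,
  where the Levy weight equals 1; so these compensators are integrable although \<open>M\<close> may
  lack a first moment.\<close>

lemma integrable_entering: "integrable (\<kappa> \<Otimes>\<^sub>M M) (\<lambda>(c, x). entering c x)"
proof (rule integrable_pair_bound)
  have [measurable]: "Measurable.pred borel (\<lambda>x::'a. norm x > 1)" "Measurable.pred borel (\<lambda>x::'a. norm x \<le> 1)" by auto
  show "(\<lambda>(c, x). entering c x) \<in> borel_measurable (\<kappa> \<Otimes>\<^sub>M M)"
    unfolding entering_def indicator_def by measurable
  show "norm (case (c, x) of (c, x) \<Rightarrow> entering c x) \<le> min 1 ((norm x)\<^sup>2)" for c and x :: 'a
    using one_le_power[of "norm x" 2] by (auto simp: entering_def indicator_def min_def)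
qed

text \<open>The drift scales with \<open>c\<close> and the Gaussian part with its square, hence the
  first two moments of \<open>\<kappa>\<close>. The jump integral splits into kernel and entering
  drift only for almost every \<open>c\<close>, which is what Fubini provides and what the outer
  integral sees.\<close>

lemma integral_levy_exponent_dilate:
  "(\<integral>c. levy_exponent a R M (c *\<^sub>R y) \<partial>\<kappa>) =
    levy_exponent ((\<integral>c. c \<partial>\<kappa>) *\<^sub>R a + (\<integral>x. (\<integral>c. entering c x \<partial>\<kappa>) \<partial>M)) ((\<integral>c. c\<^sup>2 \<partial>\<kappa>) *\<^sub>R R) (scale_mixture \<kappa> M) y"
proof -
  have ic: "integrable \<kappa> (\<lambda>c. c)" "integrable \<kappa> (\<lambda>c. c\<^sup>2)"
    by (rule integrable_const_bound[where B=1], use scale in eventually_elim, auto simp: power_le_one)+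
  have iK: "integrable (scale_mixture \<kappa> M) (levy_kernel y)"
    by (rule integrable_levy_kernel[OF levy_spectral_scale_mixture])
  note K = integral_scale_mixture[OF iK]
  have icK: "integrable \<kappa> (\<lambda>c. CLINT x|M. levy_kernel y (c *\<^sub>R x))"
    using integrable_fst'[OF K(1)] by simp
  have icD: "integrable \<kappa> (\<lambda>c. LINT x|M. entering c x)"
    using integrable_fst'[OF integrable_entering] by simp
  have inner: "AE c in \<kappa>. (CLINT x|M. levy_kernel (c *\<^sub>R y) x) = (CLINT x|M. levy_kernel y (c *\<^sub>R x)) + \<i> * complex_of_real (y \<bullet> (LINT x|M. entering c x))"
    using AE_integrable_fst'[OF K(1)] AE_integrable_fst'[OF integrable_entering] scale
  proof eventually_elim
    case (elim c)
    have "(CLINT x|M. levy_kernel (c *\<^sub>R y) x) = (CLINT x|M. levy_kernel y (c *\<^sub>R x) + \<i> * complex_of_real (y \<bullet> entering c x))"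
      using elim by (simp add: levy_kernel_dilate)
    also have "\<dots> = (CLINT x|M. levy_kernel y (c *\<^sub>R x)) + \<i> * complex_of_real (y \<bullet> (LINT x|M. entering c x))"
      using elim by simp
    finally show ?case .
  qed
  have "(\<integral>c. levy_exponent a R M (c *\<^sub>R y) \<partial>\<kappa>) =
     (\<integral>c. complex_of_real c * (\<i> * complex_of_real (y \<bullet> a)) - complex_of_real (c\<^sup>2) * (complex_of_real (y \<bullet> blinfun_apply R y) / 2)
      + ((CLINT x|M. levy_kernel y (c *\<^sub>R x)) + \<i> * complex_of_real (y \<bullet> (LINT x|M. entering c x))) \<partial>\<kappa>)"
  proof (rule integral_cong_AE)
    show "(\<lambda>c. levy_exponent a R M (c *\<^sub>R y)) \<in> borel_measurable \<kappa>"
      unfolding levy_exponent_kernel blinfun.scaleR_right by measurable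
    show "AE c in \<kappa>. levy_exponent a R M (c *\<^sub>R y) = complex_of_real c * (\<i> * complex_of_real (y \<bullet> a)) - complex_of_real (c\<^sup>2) * (complex_of_real (y \<bullet> blinfun_apply R y) / 2)
      + ((CLINT x|M. levy_kernel y (c *\<^sub>R x)) + \<i> * complex_of_real (y \<bullet> (LINT x|M. entering c x)))"
      using inner
      by eventually_elim (simp add: levy_exponent_kernel blinfun.scaleR_right power2_eq_square)
  qed (use icK icD in measurable)
  also have "\<dots> = complex_of_real (\<integral>c. c \<partial>\<kappa>) * (\<i> * complex_of_real (y \<bullet> a)) - complex_of_real (\<integral>c. c\<^sup>2 \<partial>\<kappa>) * (complex_of_real (y \<bullet> blinfun_apply R y) / 2)
      + ((\<integral>c. (CLINT x|M. levy_kernel y (c *\<^sub>R x)) \<partial>\<kappa>) + \<i> * complex_of_real (y \<bullet> (\<integral>c. (LINT x|M. entering c x) \<partial>\<kappa>)))"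
    using ic icK icD by (simp del: of_real_power)
  also have "(\<integral>c. (LINT x|M. entering c x) \<partial>\<kappa>) = (\<integral>x. (\<integral>c. entering c x \<partial>\<kappa>) \<partial>M)"
    using scale_integral_fst_snd[OF integrable_entering] by simp
  also have "(\<integral>c. (CLINT x|M. levy_kernel y (c *\<^sub>R x)) \<partial>\<kappa>) = (CLINT x|scale_mixture \<kappa> M. levy_kernel y x)"
    using K(2) by simp
  finally show ?thesis
    by (simp add: levy_exponent_kernel blinfun.scaleR_left inner_add_right algebra_simps)
qed

end

section \<open>Power laws and their truncated moments\<close>

text \<open>For \<gamma> > 0 this is the law with distribution function
  \<open>b powr \<gamma>\<close> on the unit interval. Writing it as an image of the uniform law
  makes averages over it the \<open>t\<close>-integrals of the statement.\<close>

definition power_law :: "real \<Rightarrow> real measure" where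
  "power_law \<gamma> = distr (density lborel (indicator {0<..1})) borel (\<lambda>t. t powr (1 / \<gamma>))"

lemma sets_power_law [simp, measurable_cong]: "sets (power_law \<gamma>) = sets borel"
  by (simp add: power_law_def)

lemma prob_space_power_law: "prob_space (power_law \<gamma>)"
  unfolding power_law_def
proof (rule prob_space.prob_space_distr)
  show "prob_space (density lborel (indicator {0<..1::real}))"
    by (rule prob_spaceI) (simp add: emeasure_density)
qed simp

lemma nn_integral_power_law:
  assumes [measurable]: "f \<in> borel_measurable borel"
  shows "(\<integral>\<^sup>+c. f c \<partial>power_law \<gamma>) = (\<integral>\<^sup>+t\<in>{0<..1}. f (t powr (1 / \<gamma>)) \<partial>lborel)"
  unfolding power_law_def by (subst nn_integral_distr, simp, simp, subst nn_integral_density) (auto simp: mult.commute)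

lemma integral_power_law:
  fixes f :: "real \<Rightarrow> 'b::{banach, second_countable_topology}"
  assumes [measurable]: "f \<in> borel_measurable borel"
  shows "(\<integral>c. f c \<partial>power_law \<gamma>) = (LINT t:{0<..1}|lborel. f (t powr (1 / \<gamma>)))"
proof -
  have "density lborel (indicator {0<..1::real}) = density lborel (\<lambda>t. ennreal (indicat_real {0<..1} t))"
    by (simp add: ennreal_indicator)
  thus ?thesis
    unfolding power_law_def set_lebesgue_integral_def
    by (subst integral_distr, simp, simp, simp only:, subst integral_density) auto
qed

lemma AE_power_law:
  assumes "\<gamma> > 0"
  shows "AE c in power_law \<gamma>. 0 < c \<and> c \<le> 1"
  unfolding power_law_def using assms
  by (subst AE_distr_iff) (auto simp: AE_density indicator_def powr_le1 intro!: AE_I2)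

lemma levy_scale_mixture_power_law:
  "\<gamma> > 0 \<Longrightarrow> levy_spectral_measure M \<Longrightarrow> levy_scale_mixture (power_law \<gamma>) M"
  unfolding levy_scale_mixture_def levy_scale_mixture_axioms_def
  using prob_space_power_law AE_power_law sets_power_law by blast

text \<open>Substituting \<open>c = t powr (1 / \<gamma>)\<close> turns a truncated moment into the
  integral of a power of \<open>t\<close> from \<open>l\<close> to \<open>u\<close>. Leaving out the
  null point \<open>t = l\<close> in the membership condition lets one lemma treat
  \<open>{..b}\<close> and \<open>{b<..}\<close> alike.\<close>

lemma power_law_partial_moment:
  fixes l u p \<gamma> :: real
  assumes [measurable]: "S \<in> sets borel" and "0 \<le> l" "u \<le> 1"
    and S: "\<And>t. 0 < t \<Longrightarrow> t \<le> 1 \<Longrightarrow> t \<noteq> l \<Longrightarrow> t powr (1 / \<gamma>) \<in> S \<longleftrightarrow> l \<le> t \<and> t \<le> u"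
    and I: "((\<lambda>t. t powr (p / \<gamma>)) has_integral I) {l..u}"
  shows "has_bochner_integral (power_law \<gamma>) (\<lambda>c. c powr p * indicator S c) I"
proof (rule has_bochner_integral_nn_integral)
  have "(\<integral>\<^sup>+c. ennreal (c powr p * indicator S c) \<partial>power_law \<gamma>)
     = (\<integral>\<^sup>+t\<in>{0<..1}. ennreal ((t powr (1 / \<gamma>)) powr p * indicator S (t powr (1 / \<gamma>))) \<partial>lborel)"
    by (rule nn_integral_power_law) measurable
  also have "\<dots> = (\<integral>\<^sup>+t. ennreal (indicator {l..u} t * t powr (p / \<gamma>)) \<partial>lborel)"
  proof (rule nn_integral_cong_AE)
    show "AE t in lborel. ennreal ((t powr (1 / \<gamma>)) powr p * indicator S (t powr (1 / \<gamma>))) * indicator {0<..1} t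
        = ennreal (indicator {l..u} t * t powr (p / \<gamma>))"
      using AE_lborel_singleton[of l] AE_lborel_singleton[of 0]
    proof eventually_elim
      case (elim t)
      thus ?case using S[of t] assms(2,3) by (auto simp: indicator_def powr_powr)
    qed
  qed
  also have "\<dots> = ennreal I"
    by (rule nn_integral_has_integral_lebesgue[OF _ I]) simp
  finally show "(\<integral>\<^sup>+c. ennreal (c powr p * indicator S c) \<partial>power_law \<gamma>) = ennreal I" .
  show "0 \<le> I" by (rule has_integral_nonneg[OF I]) auto
qed (auto intro!: AE_I2)

lemma powr_inverse_le_iff:
  fixes t :: real
  assumes "\<gamma> > 0" "0 \<le> b" "0 < t"
  shows "t powr (1 / \<gamma>) \<le> b \<longleftrightarrow> t \<le> b powr \<gamma>"
proof
  assume "t powr (1 / \<gamma>) \<le> b"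
  hence "(t powr (1 / \<gamma>)) powr \<gamma> \<le> b powr \<gamma>" using assms by (intro powr_mono2) auto
  thus "t \<le> b powr \<gamma>" using assms by (simp add: powr_powr)
next
  assume "t \<le> b powr \<gamma>"
  hence "t powr (1 / \<gamma>) \<le> (b powr \<gamma>) powr (1 / \<gamma>)" using assms by (intro powr_mono2) auto
  thus "t powr (1 / \<gamma>) \<le> b" using assms by (simp add: powr_powr)
qed

lemma power_law_moment_le:
  assumes "\<gamma> > 0" "p + \<gamma> > 0" "0 \<le> b" "b \<le> 1"
  shows "has_bochner_integral (power_law \<gamma>) (\<lambda>c. c powr p * indicator {..b} c) (\<gamma> / (p + \<gamma>) * b powr (p + \<gamma>))"
proof (rule power_law_partial_moment[where l=0 and u="b powr \<gamma>"])
  have "p / \<gamma> > -1" using assms by (simp add: field_simps)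
  from has_integral_powr_from_0[OF this, of "b powr \<gamma>"]
  have "((\<lambda>t. t powr (p / \<gamma>)) has_integral (b powr \<gamma>) powr (p / \<gamma> + 1) / (p / \<gamma> + 1)) {0..b powr \<gamma>}" by simp
  also have "(b powr \<gamma>) powr (p / \<gamma> + 1) / (p / \<gamma> + 1) = \<gamma> / (p + \<gamma>) * b powr (p + \<gamma>)"
    using assms by (simp add: powr_powr distrib_left) (simp add: field_simps)
  finally show "((\<lambda>t. t powr (p / \<gamma>)) has_integral \<gamma> / (p + \<gamma>) * b powr (p + \<gamma>)) {0..b powr \<gamma>}" .
  show "t powr (1 / \<gamma>) \<in> {..b} \<longleftrightarrow> 0 \<le> t \<and> t \<le> b powr \<gamma>" if "0 < t" for t
    using powr_inverse_le_iff[of \<gamma> b t] assms that by auto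
qed (use assms in \<open>auto intro: powr_le1\<close>)

text \<open>Away from 0 negative orders \<open>p\<close> are harmless; the value
  \<open>p = - \<gamma>\<close> is excluded because its primitive is a logarithm. The lemma is used
  with \<open>p = - \<alpha>\<close> for the \<beta>-law and vice versa, which is where \<alpha>
  \<noteq> \<beta> enters.\<close>

lemma power_law_moment_gt:
  assumes "\<gamma> > 0" "p + \<gamma> \<noteq> 0" "0 < b" "b \<le> 1"
  shows "has_bochner_integral (power_law \<gamma>) (\<lambda>c. c powr p * indicator {b<..} c) (\<gamma> / (p + \<gamma>) * (1 - b powr (p + \<gamma>)))"
proof (rule power_law_partial_moment[where l="b powr \<gamma>" and u=1])
  have e: "p / \<gamma> + 1 = (p + \<gamma>) / \<gamma>" using assms by (simp add: field_simps)
  hence q: "p / \<gamma> + 1 \<noteq> 0" using assms by simp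
  have "((\<lambda>t. t powr (p / \<gamma>)) has_integral 1 powr (p / \<gamma> + 1) / (p / \<gamma> + 1) - (b powr \<gamma>) powr (p / \<gamma> + 1) / (p / \<gamma> + 1)) {b powr \<gamma>..1}"
  proof (rule fundamental_theorem_of_calculus)
    show "b powr \<gamma> \<le> 1" using assms by (auto intro: powr_le1)
    fix t assume t: "t \<in> {b powr \<gamma>..1}"
    have "0 < b powr \<gamma>" using assms by simp
    also have "b powr \<gamma> \<le> t" using t by simp
    finally have "t > 0" .
    hence "((\<lambda>t. t powr (p / \<gamma> + 1) / (p / \<gamma> + 1)) has_real_derivative t powr (p / \<gamma>)) (at t within {b powr \<gamma>..1})"
      using q by (auto intro!: derivative_eq_intros)
    thus "((\<lambda>t. t powr (p / \<gamma> + 1) / (p / \<gamma> + 1)) has_vector_derivative t powr (p / \<gamma>)) (at t within {b powr \<gamma>..1})"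
      by (simp add: has_real_derivative_iff_has_vector_derivative)
  qed
  also have "1 powr (p / \<gamma> + 1) / (p / \<gamma> + 1) - (b powr \<gamma>) powr (p / \<gamma> + 1) / (p / \<gamma> + 1) = \<gamma> / (p + \<gamma>) * (1 - b powr (p + \<gamma>))"
    unfolding e using assms by (simp add: powr_powr right_diff_distrib)
  finally show "((\<lambda>t. t powr (p / \<gamma>)) has_integral \<gamma> / (p + \<gamma>) * (1 - b powr (p + \<gamma>))) {b powr \<gamma>..1}" .
  show "t powr (1 / \<gamma>) \<in> {b<..} \<longleftrightarrow> b powr \<gamma> \<le> t \<and> t \<le> 1" if "0 < t" "t \<le> 1" "t \<noteq> b powr \<gamma>" for t
    using powr_inverse_le_iff[of \<gamma> b t] assms that by auto
qed (use assms in auto)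

section \<open>The triplet of the image measure\<close>

text \<open>Lets a power law take the place of the Levy measure in the mixture construction, so that
  the product of two scales is itself a mixture.\<close>

lemma levy_spectral_power_law: "\<gamma> > 0 \<Longrightarrow> levy_spectral_measure (power_law \<gamma>)"
  unfolding levy_spectral_measure_def
proof (intro conjI)
  assume \<gamma>: "\<gamma> > 0"
  interpret prob_space "power_law \<gamma>" by (rule prob_space_power_law)
  have "AE c in power_law \<gamma>. c \<notin> {0}" using AE_power_law[OF \<gamma>] by eventually_elim simp
  hence "{0} \<in> null_sets (power_law \<gamma>)" by (subst AE_iff_null_sets) auto
  thus "emeasure (power_law \<gamma>) {0} = 0" by blast
  have "(\<integral>\<^sup>+ x. ennreal (min 1 ((norm x)\<^sup>2)) \<partial>power_law \<gamma>) \<le> (\<integral>\<^sup>+ x. 1 \<partial>power_law \<gamma>)"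
    by (intro nn_integral_mono) (auto simp: min_def)
  also have "\<dots> < \<infinity>" by (simp add: emeasure_space_1)
  finally show "(\<integral>\<^sup>+ x. ennreal (min 1 ((norm x)\<^sup>2)) \<partial>power_law \<gamma>) < \<infinity>" .
qed simp

lemma power_law_mean:
  assumes "\<gamma> > 0"
  shows "(\<integral>c. c \<partial>power_law \<gamma>) = \<gamma> / (\<gamma> + 1)" "(\<integral>c. c\<^sup>2 \<partial>power_law \<gamma>) = \<gamma> / (2 + \<gamma>)"
proof -
  have "(\<integral>c. c \<partial>power_law \<gamma>) = (\<integral>c. c powr 1 * indicator {..1} c \<partial>power_law \<gamma>)"
    by (rule integral_cong_AE, simp, simp, use AE_power_law[OF assms] in eventually_elim, simp)
  also have "\<dots> = \<gamma> / (\<gamma> + 1)"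
    using power_law_moment_le[of \<gamma> 1 1] assms by (simp add: has_bochner_integral_iff add.commute)
  finally show "(\<integral>c. c \<partial>power_law \<gamma>) = \<gamma> / (\<gamma> + 1)" .
  have "(\<integral>c. c\<^sup>2 \<partial>power_law \<gamma>) = (\<integral>c. c powr 2 * indicator {..1} c \<partial>power_law \<gamma>)"
    by (rule integral_cong_AE, simp, simp, use AE_power_law[OF assms] in eventually_elim, simp add: powr_numeral)
  also have "\<dots> = \<gamma> / (2 + \<gamma>)"
    using power_law_moment_le[of \<gamma> 2 1] assms by (simp add: has_bochner_integral_iff)
  finally show "(\<integral>c. c\<^sup>2 \<partial>power_law \<gamma>) = \<gamma> / (2 + \<gamma>)" .
qed

definition tail_shift :: "real \<Rightarrow> 'a::euclidean_space measure \<Rightarrow> 'a" where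
  "tail_shift \<gamma> M = (LINT x:{x. norm x > 1}|M. (norm x powr (- 1 - \<gamma>)) *\<^sub>R x)"

text \<open>For \<open>norm x > 1\<close> the integrand has norm
  \<open>norm x powr (- \<gamma>)\<close>, which is at most 1, so the tail integral exists for every
  Levy measure.\<close>

lemma integrable_tail_shift:
  assumes M: "levy_spectral_measure M" and \<gamma>: "\<gamma> > 0"
  shows "integrable M (\<lambda>x. indicat_real {x. norm x > 1} x *\<^sub>R ((norm x powr (- 1 - \<gamma>)) *\<^sub>R x))"
proof (rule integrable_levy_spectral_bound[OF M, where C=1])
  show "(\<lambda>x::'a. indicat_real {x. norm x > 1} x *\<^sub>R ((norm x powr (- 1 - \<gamma>)) *\<^sub>R x)) \<in> borel_measurable borel"
    by measurable
  show "norm (indicat_real {x. norm x > 1} x *\<^sub>R ((norm x powr (- 1 - \<gamma>)) *\<^sub>R x)) \<le> 1 * min 1 ((norm x)\<^sup>2)" for x :: 'a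
  proof (cases "norm x > 1")
    case True
    have "norm x powr (- 1 - \<gamma>) * norm x = norm x powr (- 1 - \<gamma>) * norm x powr 1" using True by simp
    also have "\<dots> = norm x powr (- \<gamma>)" by (simp only: powr_add[symmetric]) simp
    also have "\<dots> \<le> norm x powr 0" using True \<gamma> by (intro powr_mono) auto
    also have "\<dots> = 1" using True by auto
    also have "1 = min 1 ((norm x)\<^sup>2)" using True by (simp add: one_le_power min_absorb1)
    finally show ?thesis using True by simp
  qed simp
qed

text \<open>A jump \<open>x\<close> outside the unit ball enters it exactly for
  \<open>c \<le> 1 / norm x\<close>. The first moment of the power law truncated there is \<gamma> /
  (\<gamma> + 1) times \<open>norm x powr (- 1 - \<gamma>)\<close>, the origin of the exponent in
  the shift formula.\<close>

lemma integral_entering_power_law: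
  assumes \<gamma>: "\<gamma> > 0" and M: "levy_spectral_measure M"
  shows "(\<integral>x. (\<integral>c. levy_scale_mixture.entering c x \<partial>power_law \<gamma>) \<partial>M) = (\<gamma> / (\<gamma> + 1)) *\<^sub>R tail_shift \<gamma> M"
proof -
  interpret levy_scale_mixture "power_law \<gamma>" M by (rule levy_scale_mixture_power_law[OF \<gamma> M])
  have inner: "(\<integral>c. entering c x \<partial>power_law \<gamma>)
      = (\<gamma> / (\<gamma> + 1)) *\<^sub>R (indicator {x. norm x > 1} x *\<^sub>R ((norm x powr (- 1 - \<gamma>)) *\<^sub>R x))" for x :: 'a
  proof (cases "norm x > 1")
    case True
    hence nx: "norm x > 0" by linarith
    have b: "0 \<le> 1 / norm x" "1 / norm x \<le> 1" using True nx by (simp_all add: pos_divide_le_eq)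
    have [measurable]: "Measurable.pred borel (\<lambda>x::'a. norm x \<le> 1)" by auto
    have "(\<integral>c. entering c x \<partial>power_law \<gamma>) = (\<integral>c. (c powr 1 * indicator {..1 / norm x} c) *\<^sub>R x \<partial>power_law \<gamma>)"
    proof (rule integral_cong_AE)
      show "AE c in power_law \<gamma>. entering c x = (c powr 1 * indicator {..1 / norm x} c) *\<^sub>R x"
        using scale
      proof eventually_elim
        case (elim c)
        hence "norm (c *\<^sub>R x) \<le> 1 \<longleftrightarrow> c \<le> 1 / norm x" using nx by (simp add: pos_le_divide_eq)
        thus ?case using elim True by (simp add: entering_def indicator_def)
      qed
    qed (auto simp: entering_def indicator_def)
    also have "\<dots> = (\<integral>c. c powr 1 * indicator {..1 / norm x} c \<partial>power_law \<gamma>) *\<^sub>R x"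
      using power_law_moment_le[of \<gamma> 1 "1 / norm x"] \<gamma> b by (subst integral_scaleR_left) (auto simp: has_bochner_integral_iff)
    also have "(\<integral>c. c powr 1 * indicator {..1 / norm x} c \<partial>power_law \<gamma>) = \<gamma> / (1 + \<gamma>) * (1 / norm x) powr (1 + \<gamma>)"
      using power_law_moment_le[of \<gamma> 1 "1 / norm x"] \<gamma> b by (simp add: has_bochner_integral_iff)
    also have "(1 / norm x) powr (1 + \<gamma>) = norm x powr (- 1 - \<gamma>)"
      using True by (simp add: powr_divide powr_minus_divide[symmetric])
    finally show ?thesis using True by (simp add: add.commute)
  next
    case False
    thus ?thesis by (simp add: entering_def)
  qed
  show ?thesis
    unfolding inner tail_shift_def set_lebesgue_integral_def
    by (rule integral_scaleR_right)
qed

definition J_shift :: "real \<Rightarrow> 'a::euclidean_space \<Rightarrow> 'a measure \<Rightarrow> 'a" where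
  "J_shift \<gamma> a M = (\<gamma> / (\<gamma> + 1)) *\<^sub>R (a + tail_shift \<gamma> M)"

text \<open>The conclusion is a full \<open>has_levy_triplet\<close>, infinite divisibility
  included, so the theorem applies to its own output; the family then supplies a Levy process for
  the image law.\<close>

theorem has_levy_triplet_J_map:
  fixes P :: "'a::euclidean_space measure \<Rightarrow> 'w measure"
  assumes fam: "levy_process_family P Y" and \<gamma>: "\<gamma> > 0" and \<nu>: "has_levy_triplet \<nu> a R M"
  shows "has_levy_triplet (J_map P Y \<gamma> \<nu>) (J_shift \<gamma> a M) ((\<gamma> / (2 + \<gamma>)) *\<^sub>R R) (scale_mixture (power_law \<gamma>) M)"
proof -
  let ?\<Phi> = "levy_exponent a R M"
  have D: "\<nu> \<in> infinitely_divisible" "gaussian_covariance R" "levy_spectral_measure M"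
    "\<And>y. char_fun \<nu> y = exp (?\<Phi> y)"
    using \<nu> by (auto simp: has_levy_triplet_def)
  interpret levy_scale_mixture "power_law \<gamma>" M by (rule levy_scale_mixture_power_law[OF \<gamma> D(3)])
  have Y: "levy_process (P \<nu>) (Y \<nu>)" "distr (P \<nu>) borel (Y \<nu> 1) = \<nu>"
    using fam D(1) by (auto simp: levy_process_family_def)
  have cont: "continuous_on UNIV ?\<Phi>" by (rule continuous_on_levy_exponent[OF D(3)])
  have ch: "char_fun (distr (P \<nu>) borel (Y \<nu> 1)) y = exp (?\<Phi> y)" for y using Y(2) D(4) by simp
  have p: "1 / \<gamma> > 0" using \<gamma> by simp
  have "J_map P Y \<gamma> \<nu> \<in> infinitely_divisible"
    unfolding J_map_def by (rule random_integral_infinitely_divisible[OF Y(1) p ch cont]) simp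
  moreover have "gaussian_covariance ((\<gamma> / (2 + \<gamma>)) *\<^sub>R R)"
    using D(2) \<gamma> by (simp add: gaussian_covariance_def blinfun.scaleR_left)
  moreover have "char_fun (J_map P Y \<gamma> \<nu>) y =
    exp (levy_exponent (J_shift \<gamma> a M) ((\<gamma> / (2 + \<gamma>)) *\<^sub>R R) (scale_mixture (power_law \<gamma>) M) y)" for y
  proof -
    have "(\<lambda>c. ?\<Phi> (c *\<^sub>R y)) \<in> borel_measurable borel"
      by (intro borel_measurable_continuous_onI continuous_on_compose2[OF cont] continuous_intros) auto
    hence "char_fun (J_map P Y \<gamma> \<nu>) y = exp (\<integral>c. ?\<Phi> (c *\<^sub>R y) \<partial>power_law \<gamma>)"
      unfolding J_map_def by (subst char_fun_random_integral[OF Y(1) p ch cont]) (simp_all add: integral_power_law)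
    also have "(\<integral>c. ?\<Phi> (c *\<^sub>R y) \<partial>power_law \<gamma>) =
        levy_exponent (J_shift \<gamma> a M) ((\<gamma> / (2 + \<gamma>)) *\<^sub>R R) (scale_mixture (power_law \<gamma>) M) y"
      unfolding integral_levy_exponent_dilate power_law_mean[OF \<gamma>] integral_entering_power_law[OF \<gamma> D(3)]
      by (simp add: J_shift_def scaleR_right_distrib)
    finally show ?thesis .
  qed
  ultimately show ?thesis using levy_spectral_scale_mixture by (simp add: has_levy_triplet_def)
qed

text \<open>With the scale integrated first, a jump of norm above 1 contributes for
  \<open>c > 1 / norm x\<close>, and \<open>c powr (- 1 - \<alpha>) * c\<close> leaves a truncated
  moment of order \<open>- \<alpha>\<close> of the \<beta>-law. Its boundary term turns
  \<open>norm x powr (- 1 - \<alpha>)\<close> into \<open>norm x powr (- 1 - \<beta>)\<close>, hence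
  the difference of two tails.\<close>

lemma tail_shift_power_law_mixture:
  assumes \<alpha>: "\<alpha> > 0" and \<beta>: "\<beta> > 0" and ne: "\<alpha> \<noteq> \<beta>" and M: "levy_spectral_measure M"
  shows "tail_shift \<alpha> (scale_mixture (power_law \<beta>) M) = (\<beta> / (\<beta> - \<alpha>)) *\<^sub>R (tail_shift \<alpha> M - tail_shift \<beta> M)"
proof -
  interpret levy_scale_mixture "power_law \<beta>" M by (rule levy_scale_mixture_power_law[OF \<beta> M])
  define f where "f \<gamma> x = indicat_real {x. norm x > 1} x *\<^sub>R ((norm x powr (- 1 - \<gamma>)) *\<^sub>R x)" for \<gamma> and x :: 'a
  have t: "tail_shift \<gamma> L = (\<integral>x. f \<gamma> x \<partial>L)" for \<gamma> L
    by (simp add: tail_shift_def f_def set_lebesgue_integral_def)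
  have f[measurable]: "f \<gamma> \<in> borel_measurable borel" for \<gamma> unfolding f_def by measurable
  have int: "integrable L (f \<gamma>)" if "levy_spectral_measure L" "\<gamma> > 0" for L \<gamma>
    unfolding f_def by (rule integrable_tail_shift[OF that])
  note mix = integral_scale_mixture[OF int[OF levy_spectral_scale_mixture \<alpha>]]
  have inner: "(\<integral>c. f \<alpha> (c *\<^sub>R x) \<partial>power_law \<beta>) = (\<beta> / (\<beta> - \<alpha>)) *\<^sub>R (f \<alpha> x - f \<beta> x)" for x
  proof (cases "norm x > 1")
    case True
    let ?b = "1 / norm x"
    have nx: "norm x > 0" using True by linarith
    have b: "0 < ?b" "?b \<le> 1" using True nx by (simp_all add: pos_divide_le_eq)
    note mom = power_law_moment_gt[of \<beta> "- \<alpha>" ?b]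
    have "(\<integral>c. f \<alpha> (c *\<^sub>R x) \<partial>power_law \<beta>) = (\<integral>c. (c powr (- \<alpha>) * indicator {?b<..} c) *\<^sub>R (norm x powr (- 1 - \<alpha>)) *\<^sub>R x \<partial>power_law \<beta>)"
    proof (rule integral_cong_AE)
      have pw: "f \<alpha> (c *\<^sub>R x) = (c powr (- \<alpha>) * indicator {?b<..} c) *\<^sub>R (norm x powr (- 1 - \<alpha>)) *\<^sub>R x" if "0 < c" for c
      proof -
        have "c powr (- 1 - \<alpha>) * c = c powr (- 1 - \<alpha>) * c powr 1" using that by simp
        also have "\<dots> = c powr (- \<alpha>)" by (simp only: powr_add[symmetric]) simp
        finally have "c powr (- 1 - \<alpha>) * c = c powr (- \<alpha>)" .
        moreover have "norm (c *\<^sub>R x) > 1 \<longleftrightarrow> c > ?b" using that nx by (simp add: pos_divide_less_eq)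
        ultimately show ?thesis using that True by (auto simp: f_def indicator_def powr_mult mult_ac)
      qed
      show "AE c in power_law \<beta>. f \<alpha> (c *\<^sub>R x) = (c powr (- \<alpha>) * indicator {?b<..} c) *\<^sub>R (norm x powr (- 1 - \<alpha>)) *\<^sub>R x"
        using scale by eventually_elim (simp only: pw)
    qed auto
    also have "\<dots> = (\<integral>c. c powr (- \<alpha>) * indicator {?b<..} c \<partial>power_law \<beta>) *\<^sub>R (norm x powr (- 1 - \<alpha>)) *\<^sub>R x"
      using mom \<beta> ne b by (subst integral_scaleR_left) (auto simp: has_bochner_integral_iff)
    also have "(\<integral>c. c powr (- \<alpha>) * indicator {?b<..} c \<partial>power_law \<beta>) = \<beta> / (\<beta> - \<alpha>) * (1 - ?b powr (\<beta> - \<alpha>))"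
      using mom \<beta> ne b by (simp add: has_bochner_integral_iff)
    also have "(\<dots>) *\<^sub>R (norm x powr (- 1 - \<alpha>)) *\<^sub>R x = (\<beta> / (\<beta> - \<alpha>)) *\<^sub>R (f \<alpha> x - f \<beta> x)"
    proof -
      have "?b powr (\<beta> - \<alpha>) = norm x powr (- (\<beta> - \<alpha>))"
        using powr_divide[of 1 "norm x" "\<beta> - \<alpha>"] powr_minus_divide[of "norm x" "\<beta> - \<alpha>"] by simp
      hence "?b powr (\<beta> - \<alpha>) * norm x powr (- 1 - \<alpha>) = norm x powr (- (\<beta> - \<alpha>)) * norm x powr (- 1 - \<alpha>)"
        by simp
      also have "\<dots> = norm x powr (- 1 - \<beta>)" by (simp only: powr_add[symmetric]) (simp add: algebra_simps)
      finally have "(1 - ?b powr (\<beta> - \<alpha>)) * norm x powr (- 1 - \<alpha>) = norm x powr (- 1 - \<alpha>) - norm x powr (- 1 - \<beta>)"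
        by (simp add: left_diff_distrib)
      hence "(\<beta> / (\<beta> - \<alpha>) * (1 - ?b powr (\<beta> - \<alpha>))) *\<^sub>R (norm x powr (- 1 - \<alpha>)) *\<^sub>R x
          = (\<beta> / (\<beta> - \<alpha>)) *\<^sub>R (norm x powr (- 1 - \<alpha>) - norm x powr (- 1 - \<beta>)) *\<^sub>R x"
        by (simp only: scaleR_scaleR mult.assoc)
      thus ?thesis using True by (simp add: f_def scaleR_left_diff_distrib)
    qed
    finally show ?thesis .
  next
    case False
    have "(\<integral>c. f \<alpha> (c *\<^sub>R x) \<partial>power_law \<beta>) = (\<integral>c. 0 \<partial>power_law \<beta>)"
    proof (rule integral_cong_AE)
      have pw: "f \<alpha> (c *\<^sub>R x) = 0" if "0 < c" "c \<le> 1" for c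
        using mult_mono[of c 1 "norm x" 1] False that by (auto simp: f_def)
      show "AE c in power_law \<beta>. f \<alpha> (c *\<^sub>R x) = 0" using scale by eventually_elim (simp add: pw)
    qed auto
    thus ?thesis using False by (simp add: f_def)
  qed
  have "tail_shift \<alpha> (scale_mixture (power_law \<beta>) M) = (\<integral>x. (\<integral>c. f \<alpha> (c *\<^sub>R x) \<partial>power_law \<beta>) \<partial>M)"
    unfolding t mix(2) using scale_integral_fst_snd[OF mix(1)] by simp
  also have "\<dots> = (\<beta> / (\<beta> - \<alpha>)) *\<^sub>R (tail_shift \<alpha> M - tail_shift \<beta> M)"
    unfolding inner t using int[OF M \<alpha>] int[OF M \<beta>] by simp
  finally show ?thesis .
qed

section \<open>Products of power laws\<close>

lemma (in levy_scale_mixture) nn_integral_scale_mixture_swap: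
  assumes [measurable]: "f \<in> borel_measurable borel"
  shows "(\<integral>\<^sup>+x. f x \<partial>scale_mixture \<kappa> M) = (\<integral>\<^sup>+x. (\<integral>\<^sup>+c. f (c *\<^sub>R x) \<partial>\<kappa>) \<partial>M)"
  unfolding nn_integral_scale_mixture[OF assms]
  using Fubini'[of "\<lambda>c x. f (c *\<^sub>R x)"] by simp

lemma measure_power_law_atMost:
  assumes "\<gamma> > 0" "0 \<le> b" "b \<le> 1"
  shows "measure (power_law \<gamma>) {..b} = b powr \<gamma>"
proof -
  interpret prob_space "power_law \<gamma>" by (rule prob_space_power_law)
  have "measure (power_law \<gamma>) {..b} = (\<integral>c. indicator {..b} c \<partial>power_law \<gamma>)" by simp
  also have "\<dots> = (\<integral>c. c powr 0 * indicator {..b} c \<partial>power_law \<gamma>)"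
    by (rule integral_cong_AE, simp, simp, use AE_power_law[OF assms(1)] in eventually_elim, simp)
  also have "\<dots> = b powr \<gamma>"
    using power_law_moment_le[of \<gamma> 0 b] assms by (simp add: has_bochner_integral_iff)
  finally show ?thesis .
qed

text \<open>The half-open unit interval is closed under products, so a product of two scales is
  again an admissible scale.\<close>

lemma levy_scale_mixture_compose:
  assumes "levy_scale_mixture \<kappa> \<eta>" "levy_scale_mixture \<eta> M" "levy_spectral_measure \<eta>"
  shows "levy_scale_mixture (scale_mixture \<kappa> \<eta>) M"
proof -
  interpret \<kappa>\<eta>: levy_scale_mixture \<kappa> \<eta> by fact
  interpret \<eta>: levy_scale_mixture \<eta> M by fact
  interpret mix: prob_space "scale_mixture \<kappa> \<eta>"
  proof (rule prob_spaceI)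
    have "emeasure (scale_mixture \<kappa> \<eta>) (space (scale_mixture \<kappa> \<eta>)) = (\<integral>\<^sup>+x. 1 \<partial>scale_mixture \<kappa> \<eta>)" by simp
    also have "\<dots> = 1"
      by (subst \<kappa>\<eta>.nn_integral_scale_mixture) (simp_all add: \<eta>.emeasure_space_1 \<kappa>\<eta>.emeasure_space_1)
    finally show "emeasure (scale_mixture \<kappa> \<eta>) (space (scale_mixture \<kappa> \<eta>)) = 1" .
  qed
  have s[measurable_cong]: "sets (scale_mixture \<kappa> \<eta>) = sets borel" by (simp add: scale_mixture_def)
  have "(\<integral>\<^sup>+c. indicator (- {0<..1}) c \<partial>scale_mixture \<kappa> \<eta>) = (\<integral>\<^sup>+c. (\<integral>\<^sup>+u. indicator (- {0<..1}) (c *\<^sub>R u) \<partial>\<eta>) \<partial>\<kappa>)"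
    by (rule \<kappa>\<eta>.nn_integral_scale_mixture) measurable
  also have "\<dots> = (\<integral>\<^sup>+c. 0 \<partial>\<kappa>)"
  proof (intro nn_integral_cong_AE, use \<kappa>\<eta>.scale in eventually_elim)
    fix c :: real assume c: "0 < c \<and> c \<le> 1"
    have "(\<integral>\<^sup>+u. indicator (- {0<..1}) (c *\<^sub>R u) \<partial>\<eta>) = (\<integral>\<^sup>+u. 0 \<partial>\<eta>)"
    proof (intro nn_integral_cong_AE, use \<eta>.scale in eventually_elim)
      fix u :: real assume "0 < u \<and> u \<le> 1"
      thus "indicator (- {0<..1}) (c *\<^sub>R u) = (0::ennreal)" using c by (auto simp: mult_le_one)
    qed
    thus "(\<integral>\<^sup>+u. indicator (- {0<..1}) (c *\<^sub>R u) \<partial>\<eta>) = 0" by simp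
  qed
  finally have "- {0<..1} \<in> null_sets (scale_mixture \<kappa> \<eta>)"
    by (subst (asm) nn_integral_indicator) (auto simp: s null_sets_def)
  from AE_not_in[OF this] have "AE c in scale_mixture \<kappa> \<eta>. 0 < c \<and> c \<le> 1"
    by eventually_elim auto
  thus ?thesis
    unfolding levy_scale_mixture_def levy_scale_mixture_axioms_def
    using mix.prob_space_axioms s \<eta>.levy by blast
qed

text \<open>Dilating by \<open>u\<close> and by \<open>c\<close> is dilating by their product. Two
  mixtures thus collapse to one, and the comparison of Levy measures becomes a question about laws
  on the line.\<close>

lemma scale_mixture_assoc:
  assumes "levy_scale_mixture \<kappa> \<eta>" "levy_scale_mixture \<eta> M" "levy_spectral_measure \<eta>"
  shows "scale_mixture \<kappa> (scale_mixture \<eta> M) = scale_mixture (scale_mixture \<kappa> \<eta>) M"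
proof (rule measure_eqI)
  interpret \<kappa>\<eta>: levy_scale_mixture \<kappa> \<eta> by fact
  interpret \<eta>: levy_scale_mixture \<eta> M by fact
  interpret \<kappa>\<eta>M: levy_scale_mixture "scale_mixture \<kappa> \<eta>" M by (rule levy_scale_mixture_compose[OF assms])
  interpret o: levy_scale_mixture \<kappa> "scale_mixture \<eta> M"
    unfolding levy_scale_mixture_def levy_scale_mixture_axioms_def
    by (intro conjI \<kappa>\<eta>.prob_space_axioms \<kappa>\<eta>.sets_\<kappa> \<kappa>\<eta>.scale \<eta>.levy_spectral_scale_mixture)
  show "sets (scale_mixture \<kappa> (scale_mixture \<eta> M)) = sets (scale_mixture (scale_mixture \<kappa> \<eta>) M)"
    by (simp add: scale_mixture_def)
  fix A assume "A \<in> sets (scale_mixture \<kappa> (scale_mixture \<eta> M))"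
  hence A[measurable]: "A \<in> sets borel" by (simp add: scale_mixture_def)
  have "emeasure (scale_mixture \<kappa> (scale_mixture \<eta> M)) A = (\<integral>\<^sup>+x. indicator A x \<partial>scale_mixture \<kappa> (scale_mixture \<eta> M))"
    using A by (simp add: scale_mixture_def)
  also have "\<dots> = (\<integral>\<^sup>+c. (\<integral>\<^sup>+u. (\<integral>\<^sup>+x. indicator A (c *\<^sub>R (u *\<^sub>R x)) \<partial>M) \<partial>\<eta>) \<partial>\<kappa>)"
    by (subst o.nn_integral_scale_mixture, measurable, subst \<eta>.nn_integral_scale_mixture) auto
  also have "\<dots> = (\<integral>\<^sup>+c. (\<integral>\<^sup>+u. (\<integral>\<^sup>+x. indicator A ((c *\<^sub>R u) *\<^sub>R x) \<partial>M) \<partial>\<eta>) \<partial>\<kappa>)"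
    by simp
  also have "\<dots> = (\<integral>\<^sup>+c. (\<integral>\<^sup>+x. indicator A (c *\<^sub>R x) \<partial>M) \<partial>scale_mixture \<kappa> \<eta>)"
    by (rule \<kappa>\<eta>.nn_integral_scale_mixture[symmetric]) measurable
  also have "\<dots> = (\<integral>\<^sup>+x. indicator A x \<partial>scale_mixture (scale_mixture \<kappa> \<eta>) M)"
    by (rule \<kappa>\<eta>M.nn_integral_scale_mixture[symmetric]) measurable
  also have "\<dots> = emeasure (scale_mixture (scale_mixture \<kappa> \<eta>) M) A"
    using A by (simp add: scale_mixture_def)
  finally show "emeasure (scale_mixture \<kappa> (scale_mixture \<eta> M)) A = emeasure (scale_mixture (scale_mixture \<kappa> \<eta>) M) A" .
qed

text \<open>Given the first factor \<open>c\<close>, the second is at most \<open>b / c\<close> with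
  probability 1 if \<open>c \<le> b\<close> and \<open>(b / c) powr \<beta>\<close> otherwise.
  Averaging gives \<open>b powr \<alpha>\<close> plus \<open>b powr \<beta>\<close> times a
  truncated moment of order \<open>- \<beta>\<close> of the \<alpha>-law.\<close>

lemma measure_power_law_mixture_atMost:
  assumes \<alpha>: "\<alpha> > 0" and \<beta>: "\<beta> > 0" and ne: "\<alpha> \<noteq> \<beta>" and b: "0 < b" "b \<le> 1"
  shows "measure (scale_mixture (power_law \<alpha>) (power_law \<beta>)) {..b} = (\<beta> * b powr \<alpha> - \<alpha> * b powr \<beta>) / (\<beta> - \<alpha>)"
proof -
  let ?S = "scale_mixture (power_law \<alpha>) (power_law \<beta>)"
  interpret levy_scale_mixture "power_law \<alpha>" "power_law \<beta>"
    by (rule levy_scale_mixture_power_law[OF \<alpha> levy_spectral_power_law[OF \<beta>]])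
  interpret \<beta>: prob_space "power_law \<beta>" by (rule prob_space_power_law)
  interpret S: prob_space ?S
    using levy_scale_mixture_compose[OF levy_scale_mixture_axioms
        levy_scale_mixture_power_law[OF \<beta> levy_spectral_power_law[OF \<beta>]] levy_spectral_power_law[OF \<beta>]]
    by (simp add: levy_scale_mixture_def)
  have sS: "sets ?S = sets borel" by (simp add: scale_mixture_def)
  have int: "integrable ?S (indicat_real {..b})" using sS by (intro integrable_real_indicator) (auto simp: S.emeasure_eq_measure)
  have cdf: "(\<integral>u. indicat_real {..b} (c *\<^sub>R u) \<partial>power_law \<beta>) = c powr 0 * indicator {..b} c + b powr \<beta> * (c powr (- \<beta>) * indicator {b<..} c)"
    if c: "0 < c" "c \<le> 1" for c
  proof -
    have "indicat_real {..b} (c *\<^sub>R u) = indicator {..b / c} u" for u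
      using c by (auto simp: indicator_def field_simps)
    hence I: "(\<integral>u. indicat_real {..b} (c *\<^sub>R u) \<partial>power_law \<beta>) = measure (power_law \<beta>) {..b / c}" by simp
    show ?thesis
    proof (cases "c \<le> b")
      case True
      have "measure (power_law \<beta>) {..b / c} = measure (power_law \<beta>) {..1}"
      proof (rule \<beta>.finite_measure_eq_AE)
        show "AE u in power_law \<beta>. u \<in> {..b / c} \<longleftrightarrow> u \<in> {..1}"
          using AE_power_law[OF \<beta>]
        proof eventually_elim
          case (elim u)
          have "1 \<le> b / c" using True c by (simp add: pos_le_divide_eq)
          thus ?case using elim by auto
        qed
      qed auto
      thus ?thesis using I True c measure_power_law_atMost[OF \<beta>, of 1] by simp
    next
      case False
      hence "measure (power_law \<beta>) {..b / c} = (b / c) powr \<beta>"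
        using b c by (intro measure_power_law_atMost[OF \<beta>]) (auto simp: divide_le_eq)
      thus ?thesis using I False c b powr_divide[of b c \<beta>] powr_minus_divide[of c \<beta>] by simp
    qed
  qed
  have m: "has_bochner_integral (power_law \<alpha>) (\<lambda>c. c powr 0 * indicator {..b} c) (b powr \<alpha>)"
    "has_bochner_integral (power_law \<alpha>) (\<lambda>c. c powr (- \<beta>) * indicator {b<..} c) (\<alpha> / (\<alpha> - \<beta>) * (1 - b powr (\<alpha> - \<beta>)))"
    using power_law_moment_le[of \<alpha> 0 b] power_law_moment_gt[of \<alpha> "- \<beta>" b] \<alpha> ne b by auto
  have "measure ?S {..b} = (\<integral>x. indicat_real {..b} x \<partial>?S)" using sS by simp
  also have "\<dots> = (\<integral>c. (\<integral>u. indicat_real {..b} (c *\<^sub>R u) \<partial>power_law \<beta>) \<partial>power_law \<alpha>)"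
    by (rule integral_scale_mixture(2)[OF int])
  also have "\<dots> = (\<integral>c. c powr 0 * indicator {..b} c + b powr \<beta> * (c powr (- \<beta>) * indicator {b<..} c) \<partial>power_law \<alpha>)"
  proof (rule integral_cong_AE)
    show "(\<lambda>c. \<integral>u. indicat_real {..b} (c *\<^sub>R u) \<partial>power_law \<beta>) \<in> borel_measurable (power_law \<alpha>)"
      by measurable
    show "AE c in power_law \<alpha>. (\<integral>u. indicat_real {..b} (c *\<^sub>R u) \<partial>power_law \<beta>) = c powr 0 * indicator {..b} c + b powr \<beta> * (c powr (- \<beta>) * indicator {b<..} c)"
      using scale by eventually_elim (simp only: cdf)
  qed auto
  also have "\<dots> = b powr \<alpha> + b powr \<beta> * (\<alpha> / (\<alpha> - \<beta>) * (1 - b powr (\<alpha> - \<beta>)))"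
    by (intro has_bochner_integral_integral_eq has_bochner_integral_add has_bochner_integral_mult_right m)
  also have "\<dots> = (\<beta> * b powr \<alpha> - \<alpha> * b powr \<beta>) / (\<beta> - \<alpha>)"
  proof -
    have "b powr \<beta> * b powr (\<alpha> - \<beta>) = b powr \<alpha>" by (simp add: powr_add[symmetric])
    hence "b powr \<beta> * (\<alpha> / (\<alpha> - \<beta>) * (1 - b powr (\<alpha> - \<beta>))) = \<alpha> / (\<alpha> - \<beta>) * (b powr \<beta> - b powr \<alpha>)"
      by (simp add: algebra_simps)
    also have "\<dots> = \<alpha> / (\<beta> - \<alpha>) * (b powr \<alpha> - b powr \<beta>)" using ne by (simp add: divide_simps) (simp add: algebra_simps)
    finally have "b powr \<beta> * (\<alpha> / (\<alpha> - \<beta>) * (1 - b powr (\<alpha> - \<beta>))) = \<alpha> / (\<beta> - \<alpha>) * (b powr \<alpha> - b powr \<beta>)" .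
    hence "b powr \<alpha> + b powr \<beta> * (\<alpha> / (\<alpha> - \<beta>) * (1 - b powr (\<alpha> - \<beta>)))
        = ((\<beta> - \<alpha>) * b powr \<alpha> + \<alpha> * (b powr \<alpha> - b powr \<beta>)) / (\<beta> - \<alpha>)"
      using ne by (simp add: add_divide_distrib)
    thus ?thesis by (simp add: algebra_simps)
  qed
  finally show ?thesis .
qed

text \<open>Both sides are linear in finite measures, so agreement on half-lines extends to all
  Borel sets by a pi-lambda argument. Real-valued measures are used because
  \<open>\<beta> - \<alpha>\<close> may be negative.\<close>

lemma measure_power_law_mixture:
  assumes \<alpha>: "\<alpha> > 0" and \<beta>: "\<beta> > 0" and ne: "\<alpha> \<noteq> \<beta>" and A: "A \<in> sets borel"
  shows "(\<beta> - \<alpha>) * measure (scale_mixture (power_law \<alpha>) (power_law \<beta>)) A + \<alpha> * measure (power_law \<beta>) A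
     = \<beta> * measure (power_law \<alpha>) A"
proof -
  let ?S = "scale_mixture (power_law \<alpha>) (power_law \<beta>)"
  interpret levy_scale_mixture "power_law \<alpha>" "power_law \<beta>"
    by (rule levy_scale_mixture_power_law[OF \<alpha> levy_spectral_power_law[OF \<beta>]])
  interpret \<beta>: prob_space "power_law \<beta>" by (rule prob_space_power_law)
  interpret SM: levy_scale_mixture ?S "power_law \<beta>"
    by (rule levy_scale_mixture_compose[OF levy_scale_mixture_axioms
        levy_scale_mixture_power_law[OF \<beta> levy_spectral_power_law[OF \<beta>]] levy_spectral_power_law[OF \<beta>]])
  have sets: "sets ?S = sets borel" "sets (power_law \<alpha>) = sets borel" "sets (power_law \<beta>) = sets borel"
    by (simp_all add: scale_mixture_def)
  note spaces = sets_eq_imp_space_eq[OF sets(1)] sets_eq_imp_space_eq[OF sets(2)] sets_eq_imp_space_eq[OF sets(3)]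
  have "Int_stable (range atMost :: real set set)" by (auto simp: Int_stable_def)
  moreover have "range atMost \<subseteq> Pow (UNIV :: real set)" by simp
  moreover have "A \<in> sigma_sets UNIV (range atMost)" using A by (simp add: borel_eq_atMost)
  ultimately show ?thesis
  proof (induction rule: sigma_sets_induct_disjoint)
    case (basic B)
    then obtain b where B: "B = {..b}" by auto
    consider "b \<le> 0" | "0 < b" "b \<le> 1" | "1 < b" by linarith
    thus ?case
    proof cases
      case 1
      have "measure L B = 0" if "AE c in L. 0 < c \<and> c \<le> 1" "sets L = sets borel" for L
      proof -
        have "AE c in L. c \<notin> B" using that(1) by eventually_elim (use 1 B in auto)
        hence "B \<in> null_sets L" using that(2) B by (subst AE_iff_null_sets) auto
        thus ?thesis by (simp add: measure_def null_setsD1)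
      qed
      thus ?thesis using SM.scale scale AE_power_law[OF \<beta>] sets by simp
    next
      case 2
      thus ?thesis unfolding B measure_power_law_mixture_atMost[OF \<alpha> \<beta> ne 2]
        using ne by (simp add: measure_power_law_atMost \<alpha> \<beta>)
    next
      case 3
      have "measure L B = 1" if "AE c in L. 0 < c \<and> c \<le> 1" "sets L = sets borel" "prob_space L" for L
      proof -
        have "AE c in L. c \<in> B" using that(1) by eventually_elim (use 3 B in auto)
        thus ?thesis using that(2) B by (subst prob_space.prob_eq_1[OF that(3)]) auto
      qed
      thus ?thesis using SM.scale scale AE_power_law[OF \<beta>] sets SM.prob_space_axioms prob_space_axioms \<beta>.prob_space_axioms
        by simp
    qed
  next
    case empty
    show ?case by simp
  next
    case (compl B)
    have B: "B \<in> sets borel" using compl(1) by (simp add: borel_eq_atMost)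
    have c: "measure ?S (UNIV - B) = 1 - measure ?S B" "measure (power_law \<alpha>) (UNIV - B) = 1 - measure (power_law \<alpha>) B"
      "measure (power_law \<beta>) (UNIV - B) = 1 - measure (power_law \<beta>) B"
      using SM.prob_compl[of B] prob_compl[of B] \<beta>.prob_compl[of B] B sets spaces by simp_all
    \<comment> \<open>Complements preserve the identity because the coefficients balance:
      \<open>(\<beta> - \<alpha>) + \<alpha> = \<beta>\<close>.\<close>
    show ?case unfolding c using compl.IH by (simp add: algebra_simps)
  next
    case (union D)
    have D: "range D \<subseteq> sets borel" using union(2) by (auto simp: borel_eq_atMost)
    have "(\<lambda>i. (\<beta> - \<alpha>) * measure ?S (D i) + \<alpha> * measure (power_law \<beta>) (D i)) sums
        ((\<beta> - \<alpha>) * measure ?S (\<Union>i. D i) + \<alpha> * measure (power_law \<beta>) (\<Union>i. D i))"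
      using SM.finite_measure_UNION[of D] \<beta>.finite_measure_UNION[of D] D union(1) sets
      by (intro sums_add sums_mult) auto
    moreover have "(\<lambda>i. \<beta> * measure (power_law \<alpha>) (D i)) sums (\<beta> * measure (power_law \<alpha>) (\<Union>i. D i))"
      using finite_measure_UNION[of D] D union(1) sets by (intro sums_mult) auto
    ultimately show ?case unfolding union.IH by (rule sums_unique2)
  qed
qed

section \<open>From scale laws to Levy measures\<close>

text \<open>With \<open>x\<close> integrated last, the mass of \<open>A\<close> is an
  \<open>M\<close>-integral of masses that the scale law gives to sets on the line, so a linear
  relation between scale laws passes to their mixtures. The measurability clause serves the
  additivity of that integral.\<close>

lemma (in levy_scale_mixture) emeasure_scale_mixture_swap:
  assumes A[measurable]: "A \<in> sets borel"
  shows "emeasure (scale_mixture \<kappa> M) A = (\<integral>\<^sup>+x. emeasure \<kappa> {c. c *\<^sub>R x \<in> A} \<partial>M)"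
    and "(\<lambda>x. emeasure \<kappa> {c. c *\<^sub>R x \<in> A}) \<in> borel_measurable M"
proof -
  have e: "emeasure \<kappa> {c. c *\<^sub>R x \<in> A} = (\<integral>\<^sup>+c. indicator A (c *\<^sub>R x) \<partial>\<kappa>)" for x :: 'a
  proof -
    have "(\<integral>\<^sup>+c. indicator A (c *\<^sub>R x) \<partial>\<kappa>) = (\<integral>\<^sup>+c. indicator {c. c *\<^sub>R x \<in> A} c \<partial>\<kappa>)"
      by (intro nn_integral_cong) (auto simp: indicator_def)
    also have "\<dots> = emeasure \<kappa> {c. c *\<^sub>R x \<in> A}"
      by (rule nn_integral_indicator) measurable
    finally show ?thesis ..
  qed
  have "emeasure (scale_mixture \<kappa> M) A = (\<integral>\<^sup>+x. indicator A x \<partial>scale_mixture \<kappa> M)"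
    by (simp add: scale_mixture_def)
  also have "\<dots> = (\<integral>\<^sup>+x. (\<integral>\<^sup>+c. indicator A (c *\<^sub>R x) \<partial>\<kappa>) \<partial>M)"
    by (rule nn_integral_scale_mixture_swap) measurable
  finally show "emeasure (scale_mixture \<kappa> M) A = (\<integral>\<^sup>+x. emeasure \<kappa> {c. c *\<^sub>R x \<in> A} \<partial>M)" unfolding e .
  show "(\<lambda>x. emeasure \<kappa> {c. c *\<^sub>R x \<in> A}) \<in> borel_measurable M"
    unfolding e by measurable
qed

lemma iterated_power_law_mixture:
  assumes \<alpha>: "\<alpha> > 0" and \<beta>: "\<beta> > 0" and M: "levy_spectral_measure M"
  shows "scale_mixture (power_law \<alpha>) (scale_mixture (power_law \<beta>) M)
    = scale_mixture (scale_mixture (power_law \<alpha>) (power_law \<beta>)) M"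
    and "levy_scale_mixture (scale_mixture (power_law \<alpha>) (power_law \<beta>)) M"
proof -
  note \<beta>' = levy_spectral_power_law[OF \<beta>]
  note m = levy_scale_mixture_power_law[OF \<alpha> \<beta>'] levy_scale_mixture_power_law[OF \<beta> M] \<beta>'
  show "scale_mixture (power_law \<alpha>) (scale_mixture (power_law \<beta>) M)
    = scale_mixture (scale_mixture (power_law \<alpha>) (power_law \<beta>)) M"
    by (rule scale_mixture_assoc[OF m])
  show "levy_scale_mixture (scale_mixture (power_law \<alpha>) (power_law \<beta>)) M"
    by (rule levy_scale_mixture_compose[OF m])
qed

text \<open>For \<alpha> < \<beta> all coefficients are nonnegative, so the relation is meaningful
  for infinite masses. Admitting both orders of the product for \<open>\<kappa>\<close> lets the
  opposite inequality be handled by exchanging \<alpha> and \<beta>.\<close>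

lemma emeasure_iterated_power_law_mixture_linear:
  assumes \<alpha>: "\<alpha> > 0" and \<beta>: "\<beta> > 0" and less: "\<alpha> < \<beta>" and M: "levy_spectral_measure M"
    and A[measurable]: "A \<in> sets borel" and \<kappa>: "\<kappa> = scale_mixture (power_law \<alpha>) (power_law \<beta>) \<or> \<kappa> = scale_mixture (power_law \<beta>) (power_law \<alpha>)"
  shows "ennreal (\<beta> - \<alpha>) * emeasure (scale_mixture \<kappa> M) A + ennreal \<alpha> * emeasure (scale_mixture (power_law \<beta>) M) A
     = ennreal \<beta> * emeasure (scale_mixture (power_law \<alpha>) M) A"
proof -
  interpret \<alpha>: levy_scale_mixture "power_law \<alpha>" M by (rule levy_scale_mixture_power_law[OF \<alpha> M])
  interpret \<beta>: levy_scale_mixture "power_law \<beta>" M by (rule levy_scale_mixture_power_law[OF \<beta> M])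
  interpret \<kappa>: levy_scale_mixture \<kappa> M using \<kappa> iterated_power_law_mixture(2) \<alpha> \<beta> M by blast
  note sw = \<alpha>.emeasure_scale_mixture_swap[OF A] \<beta>.emeasure_scale_mixture_swap[OF A] \<kappa>.emeasure_scale_mixture_swap[OF A]
  note [measurable] = sw(2,4,6)
  have "ennreal (\<beta> - \<alpha>) * emeasure \<kappa> B + ennreal \<alpha> * emeasure (power_law \<beta>) B = ennreal \<beta> * emeasure (power_law \<alpha>) B"
    if "B \<in> sets borel" for B
  proof -
    have "(\<beta> - \<alpha>) * measure \<kappa> B + \<alpha> * measure (power_law \<beta>) B = \<beta> * measure (power_law \<alpha>) B"
      using \<kappa>
    proof
      \<comment> \<open>With \<alpha> and \<beta> exchanged the real identity has coefficient
        \<open>\<alpha> - \<beta>\<close>; moving terms to the other side gives the same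
        relation.\<close>
      assume "\<kappa> = scale_mixture (power_law \<beta>) (power_law \<alpha>)"
      thus ?thesis using measure_power_law_mixture[OF \<beta> \<alpha> _ that] less by (simp add: algebra_simps)
    qed (use measure_power_law_mixture[OF \<alpha> \<beta> _ that] less in simp)
    thus ?thesis
      unfolding \<alpha>.emeasure_eq_measure \<beta>.emeasure_eq_measure \<kappa>.emeasure_eq_measure
      using \<alpha> \<beta> less by (simp flip: ennreal_mult ennreal_plus)
  qed
  moreover have "{c. c *\<^sub>R x \<in> A} \<in> sets borel" for x :: 'a by measurable
  ultimately have "ennreal (\<beta> - \<alpha>) * emeasure \<kappa> {c. c *\<^sub>R x \<in> A} + ennreal \<alpha> * emeasure (power_law \<beta>) {c. c *\<^sub>R x \<in> A}
      = ennreal \<beta> * emeasure (power_law \<alpha>) {c. c *\<^sub>R x \<in> A}" for x :: 'a by blast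
  hence "(\<integral>\<^sup>+x. ennreal (\<beta> - \<alpha>) * emeasure \<kappa> {c. c *\<^sub>R x \<in> A} + ennreal \<alpha> * emeasure (power_law \<beta>) {c. c *\<^sub>R x \<in> A} \<partial>M)
      = (\<integral>\<^sup>+x. ennreal \<beta> * emeasure (power_law \<alpha>) {c. c *\<^sub>R x \<in> A} \<partial>M)" by simp
  thus ?thesis unfolding sw(1,3,5) by (simp add: nn_integral_add nn_integral_cmult)
qed

lemma emeasure_iterated_power_law_mixture:
  assumes \<alpha>: "\<alpha> > 0" and \<beta>: "\<beta> > 0" and M: "levy_spectral_measure M" and A[measurable]: "A \<in> sets borel"
  shows "emeasure (scale_mixture (power_law \<alpha>) (scale_mixture (power_law \<beta>) M)) A =
    (\<integral>\<^sup>+t\<in>{0..1}. (\<integral>\<^sup>+s\<in>{0..1}. emeasure (dilate (t powr (1 / \<alpha>) * s powr (1 / \<beta>)) M) A \<partial>lborel) \<partial>lborel)"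
proof -
  interpret \<kappa>: levy_scale_mixture "scale_mixture (power_law \<alpha>) (power_law \<beta>)" M by (rule iterated_power_law_mixture(2)[OF \<alpha> \<beta> M])
  interpret \<alpha>\<beta>: levy_scale_mixture "power_law \<alpha>" "power_law \<beta>"
    by (rule levy_scale_mixture_power_law[OF \<alpha> levy_spectral_power_law[OF \<beta>]])
  have d: "emeasure (dilate c M) A = (\<integral>\<^sup>+x. indicator A (c *\<^sub>R x) \<partial>M)" for c
  proof -
    have "emeasure (dilate c M) A = (\<integral>\<^sup>+x. indicator A x \<partial>dilate c M)" by (simp add: dilate_def)
    also have "\<dots> = (\<integral>\<^sup>+x. indicator A (c *\<^sub>R x) \<partial>M)"
      unfolding dilate_def by (rule nn_integral_distr) measurable
    finally show ?thesis .
  qed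
  have [measurable]: "(\<lambda>c. emeasure (dilate c M) A) \<in> borel_measurable borel" unfolding d by measurable
  \<comment> \<open>The power laws use the half-open interval, the statement the closed one; the
    point 0 is Lebesgue null.\<close>
  have closed: "(\<integral>\<^sup>+t\<in>{0<..1}. f t \<partial>lborel) = (\<integral>\<^sup>+t\<in>{0..1}. f t \<partial>lborel)" for f :: "real \<Rightarrow> ennreal"
    by (rule nn_integral_cong_AE, use AE_lborel_singleton[of "0::real"] in eventually_elim) (auto simp: indicator_def)
  have "emeasure (scale_mixture (power_law \<alpha>) (scale_mixture (power_law \<beta>) M)) A
    = (\<integral>\<^sup>+c. emeasure (dilate c M) A \<partial>scale_mixture (power_law \<alpha>) (power_law \<beta>))"
    unfolding iterated_power_law_mixture(1)[OF \<alpha> \<beta> M] by (rule \<kappa>.emeasure_scale_mixture[OF A])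
  also have "\<dots> = (\<integral>\<^sup>+t. (\<integral>\<^sup>+s. emeasure (dilate (t *\<^sub>R s) M) A \<partial>power_law \<beta>) \<partial>power_law \<alpha>)"
    by (rule \<alpha>\<beta>.nn_integral_scale_mixture) measurable
  also have "\<dots> = (\<integral>\<^sup>+t\<in>{0<..1}. (\<integral>\<^sup>+s. emeasure (dilate (t powr (1 / \<alpha>) *\<^sub>R s) M) A \<partial>power_law \<beta>) \<partial>lborel)"
    by (rule nn_integral_power_law) measurable
  also have "\<dots> = (\<integral>\<^sup>+t\<in>{0<..1}. (\<integral>\<^sup>+s\<in>{0<..1}. emeasure (dilate (t powr (1 / \<alpha>) *\<^sub>R s powr (1 / \<beta>)) M) A \<partial>lborel) \<partial>lborel)"
  proof -
    have "(\<integral>\<^sup>+s. emeasure (dilate (c *\<^sub>R s) M) A \<partial>power_law \<beta>)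
        = (\<integral>\<^sup>+s\<in>{0<..1}. emeasure (dilate (c *\<^sub>R s powr (1 / \<beta>)) M) A \<partial>lborel)" for c
      by (rule nn_integral_power_law) measurable
    thus ?thesis by simp
  qed
  finally show ?thesis unfolding closed real_scaleR_def .
qed

section \<open>Comparison of the coefficients\<close>

lemma J_shift_power_law_mixture:
  assumes \<alpha>: "\<alpha> > 0" and \<beta>: "\<beta> > 0" and ne: "\<alpha> \<noteq> \<beta>" and M: "levy_spectral_measure M"
  shows "J_shift \<alpha> (J_shift \<beta> a M) (scale_mixture (power_law \<beta>) M) = (\<alpha> * \<beta> / ((1 + \<alpha>) * (1 + \<beta>))) *\<^sub>R a +
    (\<alpha> * \<beta> / (\<beta> - \<alpha>)) *\<^sub>R ((1 / (\<alpha> + 1)) *\<^sub>R tail_shift \<alpha> M - (1 / (\<beta> + 1)) *\<^sub>R tail_shift \<beta> M)"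
proof -
  have "\<alpha> + 1 \<noteq> 0" "\<beta> + 1 \<noteq> 0" "\<beta> - \<alpha> \<noteq> 0" using assms by auto
  \<comment> \<open>The third identity merges the two sources of the \<beta>-tail: the shift of the
    inner map and the tail of the mixed Levy measure.\<close>
  hence 1: "\<alpha> / (\<alpha> + 1) * (\<beta> / (\<beta> + 1)) = \<alpha> * \<beta> / ((1 + \<alpha>) * (1 + \<beta>))"
    "\<alpha> / (\<alpha> + 1) * (\<beta> / (\<beta> - \<alpha>)) = \<alpha> * \<beta> / (\<beta> - \<alpha>) * (1 / (\<alpha> + 1))"
    "\<alpha> / (\<alpha> + 1) * (\<beta> / (\<beta> + 1)) - \<alpha> / (\<alpha> + 1) * (\<beta> / (\<beta> - \<alpha>)) = - (\<alpha> * \<beta> / (\<beta> - \<alpha>) * (1 / (\<beta> + 1)))"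
    by (simp_all add: divide_simps) (simp_all add: algebra_simps)
  have "J_shift \<alpha> (J_shift \<beta> a M) (scale_mixture (power_law \<beta>) M) = (\<alpha> / (\<alpha> + 1) * (\<beta> / (\<beta> + 1))) *\<^sub>R a
     + (\<alpha> / (\<alpha> + 1) * (\<beta> / (\<beta> - \<alpha>))) *\<^sub>R tail_shift \<alpha> M
     + (\<alpha> / (\<alpha> + 1) * (\<beta> / (\<beta> + 1)) - \<alpha> / (\<alpha> + 1) * (\<beta> / (\<beta> - \<alpha>))) *\<^sub>R tail_shift \<beta> M"
    unfolding J_shift_def tail_shift_power_law_mixture[OF assms]
      scaleR_right_distrib scaleR_right_diff_distrib scaleR_left_diff_distrib scaleR_scaleR by (simp only: algebra_simps)
  thus ?thesis unfolding 1(3) unfolding 1(1,2) by (simp add: scaleR_right_diff_distrib scaleR_minus_left)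
qed

text \<open>The partial fraction at order 1: the two weights applied to \<alpha> / (\<alpha> + 1)
  and \<beta> / (\<beta> + 1) recombine to the product of these numbers. The tail terms match
  coefficient by coefficient.\<close>

lemma J_shift_linear:
  fixes a :: "'a::euclidean_space"
  assumes \<alpha>: "\<alpha> > 0" and \<beta>: "\<beta> > 0" and ne: "\<alpha> \<noteq> \<beta>"
  shows "(\<alpha> * \<beta> / ((1 + \<alpha>) * (1 + \<beta>))) *\<^sub>R a +
    (\<alpha> * \<beta> / (\<beta> - \<alpha>)) *\<^sub>R ((1 / (\<alpha> + 1)) *\<^sub>R tail_shift \<alpha> M - (1 / (\<beta> + 1)) *\<^sub>R tail_shift \<beta> M)
    = (\<beta> / (\<beta> - \<alpha>)) *\<^sub>R J_shift \<alpha> a M - (\<alpha> / (\<beta> - \<alpha>)) *\<^sub>R J_shift \<beta> a M"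
proof -
  have "\<alpha> + 1 \<noteq> 0" "\<beta> + 1 \<noteq> 0" "\<beta> - \<alpha> \<noteq> 0" using assms by auto
  hence 1: "\<alpha> * \<beta> / ((1 + \<alpha>) * (1 + \<beta>)) = \<beta> / (\<beta> - \<alpha>) * (\<alpha> / (\<alpha> + 1)) - \<alpha> / (\<beta> - \<alpha>) * (\<beta> / (\<beta> + 1))"
    by (simp add: divide_simps) (simp add: algebra_simps)
  show ?thesis
    unfolding 1 J_shift_def scaleR_right_distrib scaleR_right_diff_distrib scaleR_left_diff_distrib scaleR_scaleR
    by (simp add: mult_ac)
qed

text \<open>The weights have opposite signs, so two infinite values would make the difference
  indeterminate; \<open>fin\<close> excludes this. The value with the positive weight decides: if it
  is finite, all three are, and if it is infinite, so is \<open>x\<close>.\<close>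

lemma ereal_linear_combination:
  fixes x a b :: ennreal
  assumes \<alpha>: "\<alpha> > 0" and \<beta>: "\<beta> > 0"
    and eq: "\<alpha> < \<beta> \<and> ennreal (\<beta> - \<alpha>) * x + ennreal \<alpha> * b = ennreal \<beta> * a \<or>
      \<beta> < \<alpha> \<and> ennreal (\<alpha> - \<beta>) * x + ennreal \<beta> * a = ennreal \<alpha> * b"
    and fin: "a < \<infinity> \<or> b < \<infinity>"
  shows "enn2ereal x = ereal (\<beta> / (\<beta> - \<alpha>)) * enn2ereal a - ereal (\<alpha> / (\<beta> - \<alpha>)) * enn2ereal b"
  using eq
proof (elim disjE conjE)
  assume l: "\<alpha> < \<beta>" and e: "ennreal (\<beta> - \<alpha>) * x + ennreal \<alpha> * b = ennreal \<beta> * a"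
  show ?thesis
  proof (cases a)
    case a: (real r)
    have "x \<noteq> top" "b \<noteq> top" using e a l \<alpha> by (auto simp: ennreal_mult_eq_top_iff ennreal_mult_top simp flip: ennreal_mult)
    then obtain u v where uv: "x = ennreal u" "u \<ge> 0" "b = ennreal v" "v \<ge> 0" by (cases x; cases b) auto
    have "(\<beta> - \<alpha>) * u + \<alpha> * v = \<beta> * r"
      using e a uv l \<alpha> \<beta> by (simp flip: ennreal_mult ennreal_plus)
    hence "u = (\<beta> * r - \<alpha> * v) / (\<beta> - \<alpha>)" using l by (simp add: eq_divide_eq algebra_simps)
    hence "u = \<beta> / (\<beta> - \<alpha>) * r - \<alpha> / (\<beta> - \<alpha>) * v" by (simp add: diff_divide_distrib)
    thus ?thesis using uv a by simp
  next
    case top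
    then obtain v where v: "b = ennreal v" "v \<ge> 0" using fin by (cases b) auto
    have "x = top" using e top v l \<alpha> \<beta> by (cases x) (auto simp: ennreal_mult_top simp flip: ennreal_mult ennreal_plus)
    thus ?thesis using top v l \<beta> by (simp add: top_ereal_def)
  qed
next
  \<comment> \<open>Now \<open>\<beta> / (\<beta> - \<alpha>)\<close> is the negative weight, so the
    case split is on \<open>b\<close>.\<close>
  assume l: "\<beta> < \<alpha>" and e: "ennreal (\<alpha> - \<beta>) * x + ennreal \<beta> * a = ennreal \<alpha> * b"
  show ?thesis
  proof (cases b)
    case b: (real r)
    have "x \<noteq> top" "a \<noteq> top" using e b l \<beta> by (auto simp: ennreal_mult_eq_top_iff ennreal_mult_top simp flip: ennreal_mult)
    then obtain u v where uv: "x = ennreal u" "u \<ge> 0" "a = ennreal v" "v \<ge> 0" by (cases x; cases a) auto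
    have "(\<alpha> - \<beta>) * u + \<beta> * v = \<alpha> * r"
      using e b uv l \<alpha> \<beta> by (simp flip: ennreal_mult ennreal_plus)
    hence "u = (\<beta> * v - \<alpha> * r) / (\<beta> - \<alpha>)" using l by (simp add: eq_divide_eq algebra_simps)
    hence "u = \<beta> / (\<beta> - \<alpha>) * v - \<alpha> / (\<beta> - \<alpha>) * r" by (simp add: diff_divide_distrib)
    thus ?thesis using uv b by simp
  next
    case top
    then obtain v where v: "a = ennreal v" "v \<ge> 0" using fin by (cases a) auto
    have "x = top" using e top v l \<alpha> \<beta> by (cases x) (auto simp: ennreal_mult_top simp flip: ennreal_mult ennreal_plus)
    moreover have "\<alpha> / (\<beta> - \<alpha>) < 0" using l \<alpha> by (simp add: divide_pos_neg)
    ultimately show ?thesis using top v l \<alpha> by (simp add: top_ereal_def)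
  qed
qed

text \<open>\<open>levy_triplet\<close> is a definite description, whose value alone does not
  guarantee a triplet; the leading conjuncts assert that the three named triplets are genuine. Part
  (iii) appears as a difference where one of the masses is finite, and in additive form according to
  the sign of \<open>\<beta> - \<alpha>\<close>, which also covers sets of infinite mass.\<close>

theorem proposition3:
  fixes \<alpha> \<beta> :: real
    and \<mu> :: "'a::euclidean_space measure"
    and P :: "'a measure \<Rightarrow> 'w measure"
    and Y :: "'a measure \<Rightarrow> real \<Rightarrow> 'w \<Rightarrow> 'a"
    and a a\<alpha> a\<beta> a\<alpha>\<beta> :: 'a
    and R R\<alpha> R\<beta> R\<alpha>\<beta> :: "'a \<Rightarrow>\<^sub>L 'a"
    and M M\<alpha> M\<beta> M\<alpha>\<beta> :: "'a measure"
  assumes "levy_process_family P Y"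
    and "\<alpha> > 0" and "\<beta> > 0" and "\<alpha> \<noteq> \<beta>"
    and "has_levy_triplet \<mu> a R M"
    and "levy_triplet (J_map P Y \<alpha> \<mu>) = (a\<alpha>, R\<alpha>, M\<alpha>)"
    and "levy_triplet (J_map P Y \<beta> \<mu>) = (a\<beta>, R\<beta>, M\<beta>)"
    and "levy_triplet (J_map P Y \<alpha> (J_map P Y \<beta> \<mu>)) = (a\<alpha>\<beta>, R\<alpha>\<beta>, M\<alpha>\<beta>)"
  shows
    "(has_levy_triplet (J_map P Y \<alpha> \<mu>) a\<alpha> R\<alpha> M\<alpha> \<and>
      has_levy_triplet (J_map P Y \<beta> \<mu>) a\<beta> R\<beta> M\<beta> \<and>
      has_levy_triplet (J_map P Y \<alpha> (J_map P Y \<beta> \<mu>)) a\<alpha>\<beta> R\<alpha>\<beta> M\<alpha>\<beta>) \<and>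

     (a\<alpha>\<beta> = (\<alpha> * \<beta> / ((1 + \<alpha>) * (1 + \<beta>))) *\<^sub>R a +
        (\<alpha> * \<beta> / (\<beta> - \<alpha>)) *\<^sub>R
          ((1 / (\<alpha> + 1)) *\<^sub>R (LINT x:{x. norm x > 1}|M. (norm x powr (- 1 - \<alpha>)) *\<^sub>R x) -
           (1 / (\<beta> + 1)) *\<^sub>R (LINT x:{x. norm x > 1}|M. (norm x powr (- 1 - \<beta>)) *\<^sub>R x)) \<and>
      a\<alpha>\<beta> = (\<beta> / (\<beta> - \<alpha>)) *\<^sub>R a\<alpha> - (\<alpha> / (\<beta> - \<alpha>)) *\<^sub>R a\<beta>) \<and>

     (R\<alpha>\<beta> = ((\<alpha> / (2 + \<alpha>)) * (\<beta> / (2 + \<beta>))) *\<^sub>R R \<and>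
      R\<alpha>\<beta> = (\<beta> / (\<beta> - \<alpha>)) *\<^sub>R R\<alpha> - (\<alpha> / (\<beta> - \<alpha>)) *\<^sub>R R\<beta>) \<and>

     (\<forall>A \<in> sets borel. 0 \<notin> A \<longrightarrow>
        emeasure M\<alpha>\<beta> A =
          (\<integral>\<^sup>+t\<in>{0..1}. (\<integral>\<^sup>+s\<in>{0..1}.
             emeasure (dilate (t powr (1 / \<alpha>) * s powr (1 / \<beta>)) M) A \<partial>lborel) \<partial>lborel) \<and>
        (emeasure M\<alpha> A < \<infinity> \<or> emeasure M\<beta> A < \<infinity> \<longrightarrow>
          enn2ereal (emeasure M\<alpha>\<beta> A) =
            ereal (\<beta> / (\<beta> - \<alpha>)) * enn2ereal (emeasure M\<alpha> A) -
            ereal (\<alpha> / (\<beta> - \<alpha>)) * enn2ereal (emeasure M\<beta> A)) \<and>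
        (\<alpha> < \<beta> \<longrightarrow>
          ennreal (\<beta> - \<alpha>) * emeasure M\<alpha>\<beta> A + ennreal \<alpha> * emeasure M\<beta> A =
            ennreal \<beta> * emeasure M\<alpha> A) \<and>
        (\<beta> < \<alpha> \<longrightarrow>
          ennreal (\<alpha> - \<beta>) * emeasure M\<alpha>\<beta> A + ennreal \<beta> * emeasure M\<alpha> A =
            ennreal \<alpha> * emeasure M\<beta> A))"
proof -
  note fam = assms(1) and \<alpha> = assms(2) and \<beta> = assms(3) and ne = assms(4) and \<mu> = assms(5)
  have M: "levy_spectral_measure M" using \<mu> by (simp add: has_levy_triplet_def)
  let ?M = "\<lambda>\<gamma>. scale_mixture (power_law \<gamma>) M"
  let ?MM = "scale_mixture (power_law \<alpha>) (?M \<beta>)"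
  note T\<alpha> = has_levy_triplet_J_map[OF fam \<alpha> \<mu>] and T\<beta> = has_levy_triplet_J_map[OF fam \<beta> \<mu>]
  note T\<alpha>\<beta> = has_levy_triplet_J_map[OF fam \<alpha> T\<beta>]
  have E\<alpha>: "a\<alpha> = J_shift \<alpha> a M" "R\<alpha> = (\<alpha> / (2 + \<alpha>)) *\<^sub>R R" "M\<alpha> = ?M \<alpha>"
    using levy_triplet_eqI[OF T\<alpha>] assms(6) by auto
  have E\<beta>: "a\<beta> = J_shift \<beta> a M" "R\<beta> = (\<beta> / (2 + \<beta>)) *\<^sub>R R" "M\<beta> = ?M \<beta>"
    using levy_triplet_eqI[OF T\<beta>] assms(7) by auto
  have E\<alpha>\<beta>: "a\<alpha>\<beta> = J_shift \<alpha> (J_shift \<beta> a M) (?M \<beta>)" "R\<alpha>\<beta> = (\<alpha> / (2 + \<alpha>)) *\<^sub>R (\<beta> / (2 + \<beta>)) *\<^sub>R R" "M\<alpha>\<beta> = ?MM"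
    using levy_triplet_eqI[OF T\<alpha>\<beta>] assms(8) by auto
  \<comment> \<open>The same partial fraction at order 2, the moment by which the Gaussian part is
    scaled.\<close>
  have "(\<alpha> / (2 + \<alpha>)) * (\<beta> / (2 + \<beta>)) = \<beta> / (\<beta> - \<alpha>) * (\<alpha> / (2 + \<alpha>)) - \<alpha> / (\<beta> - \<alpha>) * (\<beta> / (2 + \<beta>))"
  proof -
    have "2 + \<alpha> \<noteq> 0" "2 + \<beta> \<noteq> 0" "\<beta> - \<alpha> \<noteq> 0" using \<alpha> \<beta> ne by auto
    thus ?thesis by (simp add: divide_simps) (simp add: algebra_simps)
  qed
  hence R: "R\<alpha>\<beta> = ((\<alpha> / (2 + \<alpha>)) * (\<beta> / (2 + \<beta>))) *\<^sub>R R"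
    "R\<alpha>\<beta> = (\<beta> / (\<beta> - \<alpha>)) *\<^sub>R R\<alpha> - (\<alpha> / (\<beta> - \<alpha>)) *\<^sub>R R\<beta>"
    unfolding E\<alpha>(2) E\<beta>(2) E\<alpha>\<beta>(2) scaleR_scaleR scaleR_left_diff_distrib[symmetric] by simp_all
  have lin: "\<alpha> < \<beta> \<Longrightarrow> ennreal (\<beta> - \<alpha>) * emeasure M\<alpha>\<beta> A + ennreal \<alpha> * emeasure M\<beta> A = ennreal \<beta> * emeasure M\<alpha> A"
    "\<beta> < \<alpha> \<Longrightarrow> ennreal (\<alpha> - \<beta>) * emeasure M\<alpha>\<beta> A + ennreal \<beta> * emeasure M\<alpha> A = ennreal \<alpha> * emeasure M\<beta> A"
    if "A \<in> sets borel" for A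
    unfolding E\<alpha>(3) E\<beta>(3) E\<alpha>\<beta>(3) iterated_power_law_mixture(1)[OF \<alpha> \<beta> M]
    using emeasure_iterated_power_law_mixture_linear[OF \<alpha> \<beta> _ M that]
      emeasure_iterated_power_law_mixture_linear[OF \<beta> \<alpha> _ M that] by blast+
  have "enn2ereal (emeasure M\<alpha>\<beta> A) = ereal (\<beta> / (\<beta> - \<alpha>)) * enn2ereal (emeasure M\<alpha> A) - ereal (\<alpha> / (\<beta> - \<alpha>)) * enn2ereal (emeasure M\<beta> A)"
    if "A \<in> sets borel" "emeasure M\<alpha> A < \<infinity> \<or> emeasure M\<beta> A < \<infinity>" for A
    using lin[OF that(1)] ne by (intro ereal_linear_combination[OF \<alpha> \<beta> _ that(2)]) linarith
  moreover have "emeasure M\<alpha>\<beta> A = (\<integral>\<^sup>+t\<in>{0..1}. (\<integral>\<^sup>+s\<in>{0..1}.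
      emeasure (dilate (t powr (1 / \<alpha>) * s powr (1 / \<beta>)) M) A \<partial>lborel) \<partial>lborel)" if "A \<in> sets borel" for A
    unfolding E\<alpha>\<beta>(3) by (rule emeasure_iterated_power_law_mixture[OF \<alpha> \<beta> M that])
  moreover note J_shift_power_law_mixture[OF \<alpha> \<beta> ne M, of a, folded E\<alpha>\<beta>(1)]
  moreover note J_shift_linear[OF \<alpha> \<beta> ne, of a M, folded E\<alpha>(1) E\<beta>(1)]
  moreover have "has_levy_triplet (J_map P Y \<alpha> \<mu>) a\<alpha> R\<alpha> M\<alpha>" using T\<alpha> by (simp only: E\<alpha>)
  moreover have "has_levy_triplet (J_map P Y \<beta> \<mu>) a\<beta> R\<beta> M\<beta>" using T\<beta> by (simp only: E\<beta>)
  moreover have "has_levy_triplet (J_map P Y \<alpha> (J_map P Y \<beta> \<mu>)) a\<alpha>\<beta> R\<alpha>\<beta> M\<alpha>\<beta>"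
    using T\<alpha>\<beta> by (simp only: E\<alpha>\<beta>)
  ultimately show ?thesis
    using R lin unfolding tail_shift_def by (intro conjI ballI impI) simp_all
qed

end
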